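(* Every computationally bounded adversary $\mathcal{A}$ has only negligible advantage over a random guess in winning the membership unobservability game $\mathit{Exp}_{G4}$ defined in the context.
   Context: **Underlying network.** Loopix is a mix network with user devices, provider nodes and layers of mix nodes, using Sphinx packets (source-routed, onion-encrypted header plus layered-encrypted payload). A single-use reply block (SURB) is a Sphinx header, constructible by anyone knowing a recipient's contact information, that lets its holder send one message to the recipient without learning who the recipient is. The contact information $\Delta$ of a user consists of her public key and provider/account identifiers. **Discovery nodes.** There are $n=3f+1$ discovery nodes, which behave as Loopix users; each has a database mapping registered usernames $\mathit{ID}$ to contact information, a signing key whose public key is known to all users, and a long-lived secret $k$ shared among all discovery nodes and unknown to users. Let $g$ generate an elliptic curve group of prime order $p$; a user $U$ has private key $x_U\in\mathbb{Z}_p$ and public key $g^{x_U}$. $\mathsf{KDF}$ is a key derivation function. $\Delta_{\mathsf{fake}}$ is a fixed contact information of a non-existent destination (messages to it are dropped by the network) whose public key $\mathit{pk}_{\mathsf{fake}}$ has a private key unknown to everyone. **Discovery protocol** (Alice searches for $\mathit{ID}_B$). *Lookup.* Alice picks a random nonce and, for each discovery node $i$, a SURB $S_i$ routing to herself, and sends $(\mathit{ID}_B,\mathit{nonce},S_i)$ to node $i$ via Loopix. A node drops the message if the nonce was used before. Otherwise it seeds a pseudorandom generator with $\mathsf{KDF}(\mathit{nonce}\parallel \mathit{ID}_B\parallel k)$ and uses it for all randomness (route, delays, group elements) in generating a SURB $\mathit{surb}$ to the contact information $\Delta_B$ registered for $\mathit{ID}_B$, or to $\Delta_{\mathsf{fake}}$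 if $\mathit{ID}_B$ is unregistered, and in drawing a blinding key $y_B\in\mathbb{Z}_p$; it sets $\mathit{bpk}_B=(g^{x_B})^{y_B}$, where $g^{x_B}$ is the public key in $\Delta_B$, or $\mathit{bpk}_B=(\mathit{pk}_{\mathsf{fake}})^{y_B}$ if unregistered. It sends $(\mathit{nonce},\mathit{surb},\mathit{bpk}_B,\mathsf{Sign}_{sk}(\mathit{nonce}\parallel\mathit{surb}\parallel\mathit{bpk}_B))$ to Alice using $S_i$, where $sk$ is its signing key. If $\mathit{ID}_B$ is registered it also sends $(\mathit{nonce},y_B,\mathsf{Sign}_{sk}(\mathit{nonce}\parallel y_B))$ to the owner of $\mathit{ID}_B$. Alice accepts $(\mathit{surb},\mathit{bpk}_B)$ once received, with her nonce and valid signatures, from at least $f+1$ distinct discovery nodes. *ContactInit.* Alice picks $a\in\mathbb{Z}_p$, computes $K_e=\mathsf{KDF}((\mathit{bpk}_B)^a\parallel\text{``init key''})$ and uses $\mathit{surb}$ to build a Sphinx packet $M_{\mathsf{init}}$ with payload $g^a$, the nonce, and, encrypted under $K_e$, a reply SURB, an optional codeword, and either her username or a blinded public key of hers. She sends $M_{\mathsf{init}}$ via Loopix to a discovery node, which places it in the network; it is routed according to $\mathit{surb}$. The recipient, if any, either responds or ignores the message. Without a reply Alice may retry through other discovery nodes. The last phase, AddFriend (an authenticated key exchange), takes place only if the recipient responds. **Registration.** The effect of the registration protocol Register by a user $U$ for $(\mathit{ID},\Delta)$ is that discovery nodes store the link between $\mathit{ID}$ and $\Delta$; registering requires control of the email address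 $\mathit{ID}$. **Assumptions on primitives.** SURBs are computationally indistinguishable from uniform random bit strings; blinded public keys of different underlying keys (in particular for a real user and for $\mathit{pk}_{\mathsf{fake}}$) under independent random blinding keys are indistinguishable; the KDF and pseudorandom generator are secure in the standard sense. **Game $\mathit{Exp}_{G4}$.** The adversary $\mathcal{A}$ controls an arbitrary number of users $U_{\mathcal{A}0},U_{\mathcal{A}1},\dots$, but controls no mix, provider or discovery nodes, and has no access to the internal states of any discovery or provider nodes. $\mathit{ID}_0$ and $\mathit{ID}_1$ are initially unregistered usernames known to both $\mathcal{A}$ and the challenger $\mathcal{C}$. $\mathcal{C}$ controls a user $U_{\mathcal{C}}$, generates a uniformly random bit $b\in\{0,1\}$, and runs Register to register $U_{\mathcal{C}}$ with username $\mathit{ID}_b$ and some arbitrary contact information $\Delta$ not controlled by $\mathcal{A}$. $\mathcal{A}$ then runs the discovery protocol for $\mathit{ID}_0$ and $\mathit{ID}_1$ from any adversary-controlled users arbitrarily many times, but $U_{\mathcal{C}}$ does not respond to any of those contact requests. Finally $\mathcal{A}$ outputs $b'$ and wins if $b=b'$. *)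

theory Defs
  imports "HOL-Probability.Probability" "HOL-Algebra.Coset" "HOL-Computational_Algebra.Primes"
begin

section \<open>Non-uniform polynomial-size computation\<close>

type_synonym bits = "bool list"

text \<open>A circuit is a straight-line program over NAND gates. Each gate names two existing wires
  (inputs first, then the earlier gates) and appends one wire; wires that do not exist carry False.\<close>

record circuit =
  gates :: "(nat \<times> nat) list"
  outputs :: "nat list"

definition wire :: "bits \<Rightarrow> nat \<Rightarrow> bool" where
  "wire w i \<longleftrightarrow> i < length w \<and> w ! i"

definition eval_gates :: "(nat \<times> nat) list \<Rightarrow> bits \<Rightarrow> bits" where
  "eval_gates gs x = foldl (\<lambda>w (i, j). w @ [\<not> (wire w i \<and> wire w j)]) x gs"

definition run :: "circuit \<Rightarrow> bits \<Rightarrow> bits" where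
  "run C x = map (wire (eval_gates (gates C) x)) (outputs C)"

definition circuit_size :: "circuit \<Rightarrow> nat" where
  "circuit_size C = length (gates C) + length (outputs C)"

definition poly_bounded :: "(nat \<Rightarrow> nat) \<Rightarrow> bool" where
  "poly_bounded s \<longleftrightarrow> (\<exists>c. \<forall>\<eta>. s \<eta> \<le> \<eta> ^ c + c)"

definition negligible_fun :: "(nat \<Rightarrow> real) \<Rightarrow> bool" where
  "negligible_fun e \<longleftrightarrow> (\<forall>c. \<forall>\<^sub>F \<eta> in sequentially. \<bar>e \<eta>\<bar> < 1 / real \<eta> ^ c)"

text \<open>\<open>efficient D F\<close>: on arguments from \<open>D\<close>, the function family \<open>F\<close> has circuits of size
  polynomial in the security parameter and the total argument length. There is one circuit for
  every tuple \<open>ns\<close> of argument lengths.\<close>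

definition efficient :: "(nat \<Rightarrow> bits list set) \<Rightarrow> (nat \<Rightarrow> bits list \<Rightarrow> bits) \<Rightarrow> bool" where
  "efficient D F \<longleftrightarrow> (\<exists>c. \<forall>\<eta> ns. \<exists>C. circuit_size C \<le> (\<eta> + sum_list ns) ^ c + c \<and>
     (\<forall>xs \<in> D \<eta>. map length xs = ns \<longrightarrow> run C (concat xs) = F \<eta> xs))"

definition uniform_bits :: "nat \<Rightarrow> bits pmf" where
  "uniform_bits l = pmf_of_set {x. length x = l}"

text \<open>Distinguishers are deterministic: the best coins can be hard-wired into the circuits.\<close>

definition comp_indist :: "(nat \<Rightarrow> bits pmf) \<Rightarrow> (nat \<Rightarrow> bits pmf) \<Rightarrow> bool" where
  "comp_indist X Y \<longleftrightarrow> (\<forall>D. poly_bounded (\<lambda>\<eta>. circuit_size (D \<eta>)) \<longrightarrow>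
     negligible_fun (\<lambda>\<eta>. measure_pmf.prob (X \<eta>) {x. run (D \<eta>) x = [True]}
                   - measure_pmf.prob (Y \<eta>) {x. run (D \<eta>) x = [True]}))"

definition stat_dist :: "'a pmf \<Rightarrow> 'a pmf \<Rightarrow> real" where
  "stat_dist p q = (SUP S. \<bar>measure_pmf.prob p S - measure_pmf.prob q S\<bar>)"

text \<open>An interactive adversary tosses \<open>coins\<close> coins. In each round the listed circuits compute the
  fields of its next message from everything it has seen so far: its initial input, its
  coins and all answers received. A final circuit computes its output bit.\<close>

record adversary =
  coins :: nat
  rounds :: "circuit list list"
  guess :: circuit

definition adversary_size :: "adversary \<Rightarrow> nat" where
  "adversary_size A = coins A + length (rounds A)
     + (\<Sum>cs\<leftarrow>rounds A. length cs + (\<Sum>C\<leftarrow>cs. circuit_size C)) + circuit_size (guess A)"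

definition computationally_bounded :: "(nat \<Rightarrow> adversary) \<Rightarrow> bool" where
  "computationally_bounded A \<longleftrightarrow> poly_bounded (\<lambda>\<eta>. adversary_size (A \<eta>))"

primrec interact ::
  "('s \<Rightarrow> bits list \<Rightarrow> (bits \<times> 's) pmf) \<Rightarrow> circuit list list \<Rightarrow> bits \<Rightarrow> 's \<Rightarrow> bits pmf" where
  "interact orc [] view s = return_pmf view"
| "interact orc (cs # rs) view s =
     do { (ans, s') \<leftarrow> orc s (map (\<lambda>C. run C view) cs);
          interact orc rs (view @ ans) s' }"

definition adversary_output ::
  "('s \<Rightarrow> bits list \<Rightarrow> (bits \<times> 's) pmf) \<Rightarrow> adversary \<Rightarrow> bits \<Rightarrow> 's \<Rightarrow> bool pmf" where
  "adversary_output orc A input s =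
     do { r \<leftarrow> uniform_bits (coins A);
          view \<leftarrow> interact orc (rounds A) (input @ r) s;
          return_pmf (run (guess A) view = [True]) }"


section \<open>Algorithms and parameters of the discovery system\<close>

abbreviation nat_of_bits :: "bits \<Rightarrow> nat" where
  "nat_of_bits \<equiv> horner_sum of_bool 2"

definition bits_of_nat :: "nat \<Rightarrow> nat \<Rightarrow> bits" where
  "bits_of_nat l m = map (bit m) [0..<l]"

record contact =
  pubkey :: bits
  address :: bits

text \<open>All parameters are families indexed by the security parameter. Group elements are identified
  with their canonical bit-string encodings. \<open>pki_gen\<close> samples the public network
  directory (the keys of the mix and provider nodes) from which SURBs are built.\<close>

record system =
  faults :: nat
  grp :: "nat \<Rightarrow> bits monoid"
  gen :: "nat \<Rightarrow> bits"
  pki_gen :: "nat \<Rightarrow> bits pmf"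
  kdf :: "nat \<Rightarrow> bits \<Rightarrow> bits"
  prg :: "nat \<Rightarrow> bits \<Rightarrow> bits"
  mk_surb :: "nat \<Rightarrow> bits \<Rightarrow> contact \<Rightarrow> bits \<Rightarrow> bits"
  draw :: "nat \<Rightarrow> bits \<Rightarrow> nat"
  sig_gen :: "nat \<Rightarrow> (bits \<times> bits) pmf"
  sign :: "nat \<Rightarrow> bits \<Rightarrow> bits \<Rightarrow> bits \<Rightarrow> bits"
  fake :: "nat \<Rightarrow> contact"
  grp_len :: "nat \<Rightarrow> nat"
  exp_len :: "nat \<Rightarrow> nat"
  addr_len :: "nat \<Rightarrow> nat"
  pki_len :: "nat \<Rightarrow> nat"
  nonce_len :: "nat \<Rightarrow> nat"
  key_len :: "nat \<Rightarrow> nat"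
  seed_len :: "nat \<Rightarrow> nat"
  surb_rand_len :: "nat \<Rightarrow> nat"
  draw_rand_len :: "nat \<Rightarrow> nat"
  surb_len :: "nat \<Rightarrow> nat"
  vk_len :: "nat \<Rightarrow> nat"
  sk_len :: "nat \<Rightarrow> nat"
  sig_rand_len :: "nat \<Rightarrow> nat"
  sig_len :: "nat \<Rightarrow> nat"

definition nodes :: "system \<Rightarrow> nat" where
  "nodes P = 3 * faults P + 1"

text \<open>The private key 0 is excluded: its public key is the neutral element, and blinding leaves
  it unchanged.\<close>

definition public_keys :: "system \<Rightarrow> nat \<Rightarrow> bits set" where
  "public_keys P \<eta> = {gen P \<eta> [^]\<^bsub>grp P \<eta>\<^esub> x |x::nat. 0 < x \<and> x < Coset.order (grp P \<eta>)}"

definition valid_contact :: "system \<Rightarrow> nat \<Rightarrow> contact \<Rightarrow> bool" where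
  "valid_contact P \<eta> d \<longleftrightarrow> pubkey d \<in> public_keys P \<eta> \<and> length (address d) = addr_len P \<eta>"

definition well_formed :: "system \<Rightarrow> bool" where
  "well_formed P \<longleftrightarrow>
     (\<forall>l \<in> {grp_len P, exp_len P, addr_len P, pki_len P, nonce_len P, key_len P, seed_len P,
            surb_rand_len P, draw_rand_len P, surb_len P, vk_len P, sk_len P, sig_rand_len P,
            sig_len P}. poly_bounded l) \<and>
     (\<forall>\<eta>. group (grp P \<eta>) \<and> prime (Coset.order (grp P \<eta>)) \<and>
          carrier (grp P \<eta>) = {gen P \<eta> [^]\<^bsub>grp P \<eta>\<^esub> x |x::nat. x < Coset.order (grp P \<eta>)} \<and>
          (\<forall>h \<in> carrier (grp P \<eta>). length h = grp_len P \<eta>) \<and>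
          Coset.order (grp P \<eta>) \<le> 2 ^ exp_len P \<eta> \<and>
          valid_contact P \<eta> (fake P \<eta>) \<and>
          (\<forall>pki \<in> set_pmf (pki_gen P \<eta>). length pki = pki_len P \<eta>) \<and>
          (\<forall>x. length (kdf P \<eta> x) = seed_len P \<eta>) \<and>
          (\<forall>s. length s = seed_len P \<eta> \<longrightarrow>
               length (prg P \<eta> s) = surb_rand_len P \<eta> + draw_rand_len P \<eta>) \<and>
          (\<forall>pki \<in> set_pmf (pki_gen P \<eta>). \<forall>d r. valid_contact P \<eta> d \<and> length r = surb_rand_len P \<eta> \<longrightarrow>
               length (mk_surb P \<eta> pki d r) = surb_len P \<eta>) \<and>
          (\<forall>w. length w = draw_rand_len P \<eta> \<longrightarrow> draw P \<eta> w < Coset.order (grp P \<eta>)) \<and>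
          (\<forall>(vk, sk) \<in> set_pmf (sig_gen P \<eta>). length vk = vk_len P \<eta> \<and> length sk = sk_len P \<eta>) \<and>
          (\<forall>sk m r. length sk = sk_len P \<eta> \<and> length r = sig_rand_len P \<eta> \<longrightarrow>
               length (sign P \<eta> sk m r) = sig_len P \<eta>))"

definition efficient_algorithms :: "system \<Rightarrow> bool" where
  "efficient_algorithms P \<longleftrightarrow>
     efficient (\<lambda>\<eta>. {[x] |x. True}) (\<lambda>\<eta> xs. kdf P \<eta> (xs ! 0)) \<and>
     efficient (\<lambda>\<eta>. {[s] |s. length s = seed_len P \<eta>}) (\<lambda>\<eta> xs. prg P \<eta> (xs ! 0)) \<and>
     efficient (\<lambda>\<eta>. {[pki, pubkey d, address d, r] |pki d r. pki \<in> set_pmf (pki_gen P \<eta>) \<and>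
                       valid_contact P \<eta> d \<and> length r = surb_rand_len P \<eta>})
       (\<lambda>\<eta> xs. mk_surb P \<eta> (xs ! 0) \<lparr>pubkey = xs ! 1, address = xs ! 2\<rparr> (xs ! 3)) \<and>
     efficient (\<lambda>\<eta>. {[w] |w. length w = draw_rand_len P \<eta>})
       (\<lambda>\<eta> xs. bits_of_nat (exp_len P \<eta>) (draw P \<eta> (xs ! 0))) \<and>
     efficient (\<lambda>\<eta>. {[h, e] |h e. h \<in> carrier (grp P \<eta>)})
       (\<lambda>\<eta> xs. xs ! 0 [^]\<^bsub>grp P \<eta>\<^esub> nat_of_bits (xs ! 1)) \<and>
     efficient (\<lambda>\<eta>. {[sk, m, r] |sk m r. length sk = sk_len P \<eta> \<and> length r = sig_rand_len P \<eta>})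
       (\<lambda>\<eta> xs. sign P \<eta> (xs ! 0) (xs ! 1) (xs ! 2))"


section \<open>Assumptions on the primitives\<close>

text \<open>The KDF is a pseudorandom function keyed by the secret that ends its input. The
  reference random function is sampled lazily.\<close>

definition kdf_oracle :: "system \<Rightarrow> nat \<Rightarrow> bits \<Rightarrow> bits list \<Rightarrow> (bits \<times> bits) pmf" where
  "kdf_oracle P \<eta> k msg = return_pmf (kdf P \<eta> (concat msg @ k), k)"

definition random_function_oracle ::
  "system \<Rightarrow> nat \<Rightarrow> (bits \<rightharpoonup> bits) \<Rightarrow> bits list \<Rightarrow> (bits \<times> (bits \<rightharpoonup> bits)) pmf" where
  "random_function_oracle P \<eta> T msg =
     (case T (concat msg) of
        Some v \<Rightarrow> return_pmf (v, T)
      | None \<Rightarrow> do { v \<leftarrow> uniform_bits (seed_len P \<eta>); return_pmf (v, T(concat msg \<mapsto> v)) })"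

definition kdf_secure :: "system \<Rightarrow> bool" where
  "kdf_secure P \<longleftrightarrow> (\<forall>A. computationally_bounded A \<longrightarrow>
     negligible_fun (\<lambda>\<eta>.
       pmf (do { k \<leftarrow> uniform_bits (key_len P \<eta>); adversary_output (kdf_oracle P \<eta>) (A \<eta>) [] k }) True
     - pmf (adversary_output (random_function_oracle P \<eta>) (A \<eta>) [] Map.empty) True))"

definition prg_secure :: "system \<Rightarrow> bool" where
  "prg_secure P \<longleftrightarrow> comp_indist
     (\<lambda>\<eta>. map_pmf (prg P \<eta>) (uniform_bits (seed_len P \<eta>)))
     (\<lambda>\<eta>. uniform_bits (surb_rand_len P \<eta> + draw_rand_len P \<eta>))"

definition surbs_pseudorandom :: "system \<Rightarrow> bool" where
  "surbs_pseudorandom P \<longleftrightarrow> (\<forall>d. (\<forall>\<eta>. valid_contact P \<eta> (d \<eta>)) \<longrightarrow> comp_indist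
     (\<lambda>\<eta>. do { pki \<leftarrow> pki_gen P \<eta>; r \<leftarrow> uniform_bits (surb_rand_len P \<eta>);
               return_pmf (pki @ mk_surb P \<eta> pki (d \<eta>) r) })
     (\<lambda>\<eta>. do { pki \<leftarrow> pki_gen P \<eta>; u \<leftarrow> uniform_bits (surb_len P \<eta>);
               return_pmf (pki @ u) }))"

definition random_exponent :: "system \<Rightarrow> nat \<Rightarrow> nat pmf" where
  "random_exponent P \<eta> = pmf_of_set {..<Coset.order (grp P \<eta>)}"

definition blinding_indist :: "system \<Rightarrow> bool" where
  "blinding_indist P \<longleftrightarrow>
     (\<forall>h h'. (\<forall>\<eta>. h \<eta> \<in> public_keys P \<eta> \<and> h' \<eta> \<in> public_keys P \<eta>) \<longrightarrow> comp_indist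
        (\<lambda>\<eta>. map_pmf (\<lambda>y. h \<eta> [^]\<^bsub>grp P \<eta>\<^esub> y) (random_exponent P \<eta>))
        (\<lambda>\<eta>. map_pmf (\<lambda>y. h' \<eta> [^]\<^bsub>grp P \<eta>\<^esub> y) (random_exponent P \<eta>)))"

text \<open>Finitely many coins cannot give an exactly uniform element of a set of odd prime size.\<close>

definition draws_uniformly :: "system \<Rightarrow> bool" where
  "draws_uniformly P \<longleftrightarrow> negligible_fun (\<lambda>\<eta>. stat_dist
     (map_pmf (draw P \<eta>) (uniform_bits (draw_rand_len P \<eta>))) (random_exponent P \<eta>))"


section \<open>The discovery protocol and the game\<close>

datatype request =
    Lookup nat bool bits bits
  | ContactInit nat bits bits
  | Malformed

text \<open>\<open>Lookup i j nonce s\<close> sends the lookup request for the username with index \<open>j\<close> to node \<open>i\<close>,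
  with reply block \<open>s\<close>; \<open>ContactInit i hdr payload\<close> hands the Sphinx packet with header \<open>hdr\<close>
  to node \<open>i\<close>. Requests reach nodes anonymously, so they do not name the sending user.\<close>

fun parse :: "bits list \<Rightarrow> request" where
  "parse [[c], [j], i, x, y] =
     (if c then ContactInit (nat_of_bits i) x y else Lookup (nat_of_bits i) j x y)"
| "parse _ = Malformed"

text \<open>What a discovery node derives for a lookup: destination, SURB, blinding key and blinded
  public key.\<close>

definition derive_surb ::
  "system \<Rightarrow> nat \<Rightarrow> bits \<Rightarrow> bits \<Rightarrow> (bits \<rightharpoonup> contact) \<Rightarrow> bits \<Rightarrow> bits \<Rightarrow>
   contact \<times> bits \<times> nat \<times> bits" where
  "derive_surb P \<eta> pki k db name nonce =
     (let d = (case db name of Some d \<Rightarrow> d | None \<Rightarrow> fake P \<eta>);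
          rnd = prg P \<eta> (kdf P \<eta> (nonce @ name @ k));
          surb = mk_surb P \<eta> pki d (take (surb_rand_len P \<eta>) rnd);
          y = draw P \<eta> (drop (surb_rand_len P \<eta>) rnd);
          bpk = pubkey d [^]\<^bsub>grp P \<eta>\<^esub> y
      in (d, surb, y, bpk))"

text \<open>\<open>issued\<close> records where the SURBs handed out lead to, and \<open>mail\<close> the messages delivered
  to honest recipients. Neither is visible to the adversary.\<close>

record state =
  used :: "nat \<Rightarrow> bits set"
  issued :: "(bits \<times> contact) list"
  mail :: "(contact \<times> bits) list"

definition initial_state :: state where
  "initial_state = \<lparr>used = (\<lambda>_. {}), issued = [], mail = []\<rparr>"

text \<open>In the game the recipient of a contact request ignores it.\<close>

definition recipient_reply :: "bits \<Rightarrow> bits \<Rightarrow> bits option" where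
  "recipient_reply hdr payload = None"

text \<open>The reply block \<open>s\<close> of a lookup routes to an adversary-controlled user, so the node's
  answer goes to the adversary whatever \<open>s\<close> is. A contact request goes where
  its header leads; a header that no node issued reaches no honest recipient.\<close>

definition serve ::
  "system \<Rightarrow> nat \<Rightarrow> bits \<Rightarrow> bits \<Rightarrow> bits list \<Rightarrow> (bits \<rightharpoonup> contact) \<Rightarrow> (bool \<Rightarrow> bits) \<Rightarrow>
   state \<Rightarrow> request \<Rightarrow> (bits option \<times> state) pmf" where
  "serve P \<eta> pki k sks db name \<sigma> req = (case req of
     Lookup i j nonce s \<Rightarrow>
       if i < nodes P \<and> length nonce = nonce_len P \<eta> \<and> nonce \<notin> used \<sigma> i then
         do { let (d, surb, y, bpk) = derive_surb P \<eta> pki k db (name j) nonce;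
              let y_bits = bits_of_nat (exp_len P \<eta>) y;
              r \<leftarrow> uniform_bits (sig_rand_len P \<eta>);
              r' \<leftarrow> uniform_bits (sig_rand_len P \<eta>);
              let sig = sign P \<eta> (sks ! i) (nonce @ surb @ bpk) r;
              let owner_msg = nonce @ y_bits @ sign P \<eta> (sks ! i) (nonce @ y_bits) r';
              return_pmf (Some (nonce @ surb @ bpk @ sig),
                \<sigma>\<lparr>used := (used \<sigma>)(i := insert nonce (used \<sigma> i)),
                  issued := (surb, d) # issued \<sigma>,
                  mail := (if name j \<in> dom db then (d, owner_msg) # mail \<sigma> else mail \<sigma>)\<rparr>) }
       else return_pmf (None, \<sigma>)
   | ContactInit i hdr payload \<Rightarrow>
       (case map_of (issued \<sigma>) hdr of
          Some d \<Rightarrow>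
            if i < nodes P \<and> d \<noteq> fake P \<eta>
            then return_pmf (recipient_reply hdr payload, \<sigma>\<lparr>mail := (d, hdr @ payload) # mail \<sigma>\<rparr>)
            else return_pmf (None, \<sigma>)
        | None \<Rightarrow> return_pmf (None, \<sigma>))
   | Malformed \<Rightarrow> return_pmf (None, \<sigma>))"

text \<open>Answers have a fixed length; the first bit says whether there is one.\<close>

definition encode_answer :: "system \<Rightarrow> nat \<Rightarrow> bits option \<Rightarrow> bits" where
  "encode_answer P \<eta> a = (case a of
     Some m \<Rightarrow> True # m
   | None \<Rightarrow> False # replicate (nonce_len P \<eta> + surb_len P \<eta> + grp_len P \<eta> + sig_len P \<eta>) False)"

definition discovery_oracle ::
  "system \<Rightarrow> nat \<Rightarrow> bits \<Rightarrow> bits \<Rightarrow> bits list \<Rightarrow> (bits \<rightharpoonup> contact) \<Rightarrow> (bool \<Rightarrow> bits) \<Rightarrow>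
   state \<Rightarrow> bits list \<Rightarrow> (bits \<times> state) pmf" where
  "discovery_oracle P \<eta> pki k sks db name \<sigma> msg =
     map_pmf (map_prod (encode_answer P \<eta>) id) (serve P \<eta> pki k sks db name \<sigma> (parse msg))"

definition register :: "bits \<Rightarrow> contact \<Rightarrow> (bits \<rightharpoonup> contact) \<Rightarrow> (bits \<rightharpoonup> contact)" where
  "register name d db = db(name \<mapsto> d)"

text \<open>The adversary's initial input consists of the network directory and the nodes' verification
  keys. Usernames, contact information and group parameters are fixed families, so a non-uniform
  adversary knows them anyway.\<close>

text \<open>The game returns whether the adversary wins. \<open>name False\<close> and \<open>name True\<close> are the two
  usernames, \<open>d\<close> is the contact information of the challenger's user, and
  \<open>db\<close> holds the users registered beforehand.\<close>

definition Exp_G4 ::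
  "system \<Rightarrow> nat \<Rightarrow> (bits \<rightharpoonup> contact) \<Rightarrow> (bool \<Rightarrow> bits) \<Rightarrow> contact \<Rightarrow> adversary \<Rightarrow> bool pmf" where
  "Exp_G4 P \<eta> db name d A =
     do { pki \<leftarrow> pki_gen P \<eta>;
          k \<leftarrow> uniform_bits (key_len P \<eta>);
          keys \<leftarrow> replicate_pmf (nodes P) (sig_gen P \<eta>);
          b \<leftarrow> bernoulli_pmf (1 / 2);
          let db' = register (name b) d db;
          b' \<leftarrow> adversary_output (discovery_oracle P \<eta> pki k (map snd keys) db' name) A
                 (pki @ concat (map fst keys)) initial_state;
          return_pmf (b' = b) }"

definition advantage_G4 ::
  "system \<Rightarrow> nat \<Rightarrow> (bits \<rightharpoonup> contact) \<Rightarrow> (bool \<Rightarrow> bits) \<Rightarrow> contact \<Rightarrow> adversary \<Rightarrow> real" where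
  "advantage_G4 P \<eta> db name d A = \<bar>pmf (Exp_G4 P \<eta> db name d A) True - 1 / 2\<bar>"

end

(* An honest recipient never answers, so a contact request tells the adversary nothing and only the
   answers to lookups matter. The two experiments differ only in which username is derived
   from the user's contact information and which from the fake one. After the shared KDF is replaced
   by a random function, every new nonce yields fresh seeds for the two usernames, and an answer
   depends on the contact only through the string SURB @ blinded key computed from a seed.
   Such strings are indistinguishable for any two contacts (pseudorandom generator, SURB,
   statistical closeness of the drawn exponent, blinding, and back), and a hybrid argument over the
   2 * rounds strings finishes the proof. The adversaries are non-uniform, so in every
   step all randomness except the challenge can be fixed to its best value; what remains is to
   bound the circuits that simulate the game from the challenge. *)

theory Submission
  imports Defs
begin

section \<open>Circuits\<close>

text \<open>Two features of the protocol shape the simulation. All nodes share \<open>k\<close>, so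
  a nonce sent to several nodes must yield the same strings each time, while each node rejects only
  its own repetitions. The simulator therefore carries a table that is searched by nonce alone for
  strings, but by node and nonce for replays. And the username of a lookup is known only at run
  time, so every round consumes one string per username. Strings drawn in a round that repeats a
  nonce are ignored, which is why independent seeds can replace a random function. The directory
  cannot be hard-wired everywhere: SURB pseudorandomness holds on average over the directory and
  jointly with it. It remains part of the challenge in the SURB step and in the hybrid over strings,
  where the other strings are computed from it inside the circuit. A circuit has a fixed number of
  inputs, so every value fed to one needs a length that is known when the circuit is built. Size
  bounds are uniform over auxiliary indices such as loop counters, because the number of iterations
  itself grows with the security parameter.\<close>

lemma eval_gates_Nil [simp]: "eval_gates [] x = x"
  by (simp add: eval_gates_def)

lemma eval_gates_snoc:
  "eval_gates (gs @ [(i, j)]) x =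
     eval_gates gs x @ [\<not> (wire (eval_gates gs x) i \<and> wire (eval_gates gs x) j)]"
  by (simp add: eval_gates_def)

lemma eval_gates_append: "eval_gates (gs @ hs) x = eval_gates hs (eval_gates gs x)"
  by (simp add: eval_gates_def)

lemma length_eval_gates [simp]: "length (eval_gates gs x) = length x + length gs"
proof (induction gs rule: rev_induct)
  case (snoc g gs)
  then show ?case by (cases g) (simp add: eval_gates_snoc)
qed simp

lemma wire_append: "wire (x @ y) i = (if i < length x then wire x i else wire y (i - length x))"
  by (auto simp: wire_def nth_append)

lemma wire_out_of_range [simp]: "length x \<le> i \<Longrightarrow> \<not> wire x i"
  by (simp add: wire_def)

lemma wire_eval_gates_input: "i < length x \<Longrightarrow> wire (eval_gates gs x) i = wire x i"
proof (induction gs rule: rev_induct)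
  case (snoc g gs)
  then show ?case by (cases g) (simp add: eval_gates_snoc wire_append)
qed simp

lemma length_run [simp]: "length (run C x) = length (outputs C)"
  by (simp add: run_def)

text \<open>A missing wire must be sent beyond the last wire of the whole program: the indices just
  past the current end come into existence later.\<close>

lemma wire_eval_gates_relocate:
  assumes "\<And>i. i < length x \<Longrightarrow>
      wire w (\<rho> i) = wire x i \<and> (\<rho> i < length w \<or> length w + length gs \<le> \<rho> i)"
    and "\<And>i. length x \<le> i \<Longrightarrow> \<rho> i = length w + (i - length x)"
  shows "wire (eval_gates (map (map_prod \<rho> \<rho>) gs) w) (\<rho> i) = wire (eval_gates gs x) i"
  using assms(1)
proof (induction gs arbitrary: i rule: rev_induct)
  case Nil
  then show ?case using assms(2)[of i] by (cases "i < length x") auto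
next
  case (snoc g gs)
  obtain a b where g: "g = (a, b)" by fastforce
  let ?W = "eval_gates (map (map_prod \<rho> \<rho>) gs) w" and ?X = "eval_gates gs x"
  have pre: "wire w (\<rho> i) = wire x i \<and> (\<rho> i < length w \<or> length w + length gs \<le> \<rho> i)"
    if "i < length x" for i
    using snoc.prems[OF that] by auto
  have IH: "wire ?W (\<rho> i) = wire ?X i" for i
    using snoc.IH[OF pre] by blast
  show ?case
  proof (cases "i < length x")
    case True
    \<comment> \<open>The new gate writes wire \<open>length w + length gs\<close>; a relocated
      input lies strictly on one side of it.\<close>
    then have "\<rho> i < length w \<or> length w + length gs + 1 \<le> \<rho> i"
      using snoc.prems[of i] by auto
    then show ?thesis using True IH[of i]
      by (auto simp: g eval_gates_snoc wire_append wire_def[of "[_]"])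
  next
    case False
    then show ?thesis using IH[of i] IH[of a] IH[of b] assms(2)[of i]
      by (auto simp: g eval_gates_snoc wire_append)
  qed
qed

text \<open>Environments \<open>e\<close> are arbitrary; circuits see only their encodings \<open>g e\<close>, which must have
  a common length because a circuit has a fixed number of inputs.\<close>

definition fixed_length :: "'e set \<Rightarrow> ('e \<Rightarrow> bits) \<Rightarrow> bool" where
  "fixed_length D g \<longleftrightarrow> (\<exists>n. \<forall>e\<in>D. length (g e) = n)"

definition reducible :: "'e set \<Rightarrow> nat \<Rightarrow> ('e \<Rightarrow> bits) \<Rightarrow> ('e \<Rightarrow> bits) \<Rightarrow> bool" where
  "reducible D s g f \<longleftrightarrow> fixed_length D g \<and>
     (\<exists>C. circuit_size C \<le> s \<and> (\<forall>e\<in>D. run C (g e) = f e))"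

lemma fixed_lengthI: "(\<And>e. e \<in> D \<Longrightarrow> length (g e) = n) \<Longrightarrow> fixed_length D g"
  by (auto simp: fixed_length_def)

lemma reducible_fixed_length: "reducible D s g f \<Longrightarrow> fixed_length D f"
  by (metis fixed_length_def length_run reducible_def)

text \<open>Each output wire counts towards the size, so a size bound is also a length bound;
  \<open>ppoly_poly_length\<close> relies on this.\<close>

lemma reducible_length: "reducible D s g f \<Longrightarrow> e \<in> D \<Longrightarrow> length (f e) \<le> s"
  unfolding reducible_def circuit_size_def by (metis add_leD2 length_run)

lemma reducible_mono: "reducible D s g f \<Longrightarrow> s \<le> t \<Longrightarrow> reducible D t g f"
  unfolding reducible_def using le_trans by blast

lemma reducible_cong: "reducible D s g f \<Longrightarrow> (\<And>e. e \<in> D \<Longrightarrow> f e = f' e) \<Longrightarrow> reducible D s g f'"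
  unfolding reducible_def by auto

lemma reducible_map:
  assumes "reducible D s g f" "h ` D' \<subseteq> D"
  shows "reducible D' s (\<lambda>e. g (h e)) (\<lambda>e. f (h e))"
  using assms unfolding reducible_def fixed_length_def by (meson image_subset_iff)

lemma reducible_wires:
  assumes "fixed_length D g" "\<And>e. e \<in> D \<Longrightarrow> f e = map (wire (g e)) idx"
  shows "reducible D (length idx) g f"
  unfolding reducible_def using assms
  by (auto intro!: exI[of _ "\<lparr>gates = [], outputs = idx\<rparr>"] simp: circuit_size_def run_def)

section \<open>Sequential and parallel composition of circuits\<close>

lemma reducible_comp:
  assumes "reducible D s g f" "reducible D t f h"
  shows "reducible D (s + t) g h"
proof -
  obtain n where n: "length (g e) = n" if "e \<in> D" for e
    using assms(1) by (auto simp: reducible_def fixed_length_def)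
  obtain C1 where C1: "circuit_size C1 \<le> s" "\<And>e. e \<in> D \<Longrightarrow> run C1 (g e) = f e"
    using assms(1) by (auto simp: reducible_def)
  obtain C2 where C2: "circuit_size C2 \<le> t" "\<And>e. e \<in> D \<Longrightarrow> run C2 (f e) = h e"
    using assms(2) by (auto simp: reducible_def)
  define n2 where "n2 = length (outputs C1)"
  define m where "m = n + length (gates C1)"
  \<comment> \<open>The inputs of the second circuit are the output wires of the first. An output
    that names a missing wire reads False; its index is moved past all gates of the second circuit,
    which would otherwise give it a value.\<close>
  define \<rho> where "\<rho> i = (if i < n2 then (if outputs C1 ! i < m then outputs C1 ! i
      else m + length (gates C2)) else m + (i - n2))" for i
  define C where "C = \<lparr>gates = gates C1 @ map (map_prod \<rho> \<rho>) (gates C2), outputs = map \<rho> (outputs C2)\<rparr>"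
  have "run C (g e) = h e" if e: "e \<in> D" for e
  proof -
    let ?w = "eval_gates (gates C1) (g e)"
    have fe: "f e = map (wire ?w) (outputs C1)"
      using C1(2)[OF e] by (simp add: run_def)
    have w: "length ?w = m" using n[OF e] by (simp add: m_def)
    have "wire (eval_gates (map (map_prod \<rho> \<rho>) (gates C2)) ?w) (\<rho> i)
        = wire (eval_gates (gates C2) (f e)) i" for i
    proof (rule wire_eval_gates_relocate)
      fix i assume "i < length (f e)"
      then show "wire ?w (\<rho> i) = wire (f e) i \<and>
          (\<rho> i < length ?w \<or> length ?w + length (gates C2) \<le> \<rho> i)"
        using w by (auto simp: fe \<rho>_def n2_def wire_def)
    next
      fix i assume "length (f e) \<le> i"
      then show "\<rho> i = length ?w + (i - length (f e))"
        using w by (simp add: fe \<rho>_def n2_def)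
    qed
    then have "run C (g e) = run C2 (f e)"
      by (simp add: run_def C_def eval_gates_append)
    then show ?thesis using C2(2)[OF e] by simp
  qed
  moreover have "circuit_size C \<le> s + t"
    using C1(1) C2(1) by (simp add: C_def circuit_size_def)
  ultimately show ?thesis using assms(1) unfolding reducible_def by blast
qed

lemma reducible_append:
  assumes "reducible D s g f" "reducible D t g h"
  shows "reducible D (s + t) g (\<lambda>e. f e @ h e)"
proof -
  obtain n where n: "length (g e) = n" if "e \<in> D" for e
    using assms(1) by (auto simp: reducible_def fixed_length_def)
  obtain C1 where C1: "circuit_size C1 \<le> s" "\<And>e. e \<in> D \<Longrightarrow> run C1 (g e) = f e"
    using assms(1) by (auto simp: reducible_def)
  obtain C2 where C2: "circuit_size C2 \<le> t" "\<And>e. e \<in> D \<Longrightarrow> run C2 (g e) = h e"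
    using assms(2) by (auto simp: reducible_def)
  define m where "m = n + length (gates C1)"
  define \<rho> where "\<rho> i = (if i < n then i else m + (i - n))" for i
  \<comment> \<open>An output of the first circuit may name a missing wire, which the gates of the
    second circuit would bring into existence; it is moved past the last of them.\<close>
  define \<sigma> where "\<sigma> i = (if i < m then i else m + length (gates C2))" for i
  define C where "C = \<lparr>gates = gates C1 @ map (map_prod \<rho> \<rho>) (gates C2),
    outputs = map \<sigma> (outputs C1) @ map \<rho> (outputs C2)\<rparr>"
  have "run C (g e) = f e @ h e" if e: "e \<in> D" for e
  proof -
    let ?w = "eval_gates (gates C1) (g e)"
    have w: "length ?w = m" using n[OF e] by (simp add: m_def)
    have 1: "wire (eval_gates (map (map_prod \<rho> \<rho>) (gates C2)) ?w) (\<rho> i)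
        = wire (eval_gates (gates C2) (g e)) i" for i
    proof (rule wire_eval_gates_relocate)
      fix i assume "i < length (g e)"
      then show "wire ?w (\<rho> i) = wire (g e) i \<and>
          (\<rho> i < length ?w \<or> length ?w + length (gates C2) \<le> \<rho> i)"
        using w n[OF e] by (auto simp: \<rho>_def wire_eval_gates_input m_def)
    next
      fix i assume "length (g e) \<le> i"
      then show "\<rho> i = length ?w + (i - length (g e))"
        using w n[OF e] by (simp add: \<rho>_def)
    qed
    have 2: "wire (eval_gates (map (map_prod \<rho> \<rho>) (gates C2)) ?w) (\<sigma> i) = wire ?w i" for i
      using w by (cases "i < m") (simp_all add: \<sigma>_def wire_eval_gates_input)
    have "run C (g e) = run C1 (g e) @ run C2 (g e)"
      using 1 2 by (simp add: run_def C_def eval_gates_append)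
    then show ?thesis using C1(2)[OF e] C2(2)[OF e] by simp
  qed
  moreover have "circuit_size C \<le> s + t"
    using C1(1) C2(1) by (simp add: C_def circuit_size_def)
  ultimately show ?thesis using assms(1) unfolding reducible_def by blast
qed

section \<open>Elementary circuits and iteration\<close>

lemma reducible_run:
  "fixed_length D g \<Longrightarrow> reducible D (circuit_size C) g (\<lambda>e. run C (g e))"
  unfolding reducible_def by blast

lemma reducible_nand:
  assumes "fixed_length D (\<lambda>e. [a e, b e])"
  shows "reducible D 2 (\<lambda>e. [a e, b e]) (\<lambda>e. [\<not> (a e \<and> b e)])"
  unfolding reducible_def using assms
  by (auto intro!: exI[of _ "\<lparr>gates = [(0, 1)], outputs = [2]\<rparr>"]
        simp: circuit_size_def run_def eval_gates_def wire_def)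

text \<open>Wire \<open>n\<close> is the first missing one: the gate negates False, and its result
  then becomes wire \<open>n\<close> itself.\<close>

lemma reducible_True:
  assumes "fixed_length D g"
  shows "reducible D 2 g (\<lambda>e. [True])"
proof -
  obtain n where n: "length (g e) = n" if "e \<in> D" for e
    using assms by (auto simp: fixed_length_def)
  show ?thesis
    unfolding reducible_def using assms n
    by (auto intro!: exI[of _ "\<lparr>gates = [(n, n)], outputs = [n]\<rparr>"]
        simp: circuit_size_def run_def eval_gates_def wire_append wire_def nth_append)
qed

text \<open>An output that names a missing wire yields False without any gate. The size 2 only
  matches \<open>reducible_True\<close>, so that \<open>reducible_const\<close> can treat all bits
  alike.\<close>

lemma reducible_False:
  assumes "fixed_length D g"
  shows "reducible D 2 g (\<lambda>e. [False])"
proof -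
  obtain n where n: "length (g e) = n" if "e \<in> D" for e
    using assms by (auto simp: fixed_length_def)
  have "reducible D (length [n]) g (\<lambda>e. [False])"
    by (rule reducible_wires) (use assms n in auto)
  then show ?thesis by (rule reducible_mono) simp
qed

lemma reducible_empty: "reducible {} s g f"
  unfolding reducible_def fixed_length_def
  by (auto intro!: exI[of _ "\<lparr>gates = [], outputs = []\<rparr>"] simp: circuit_size_def)

lemma reducible_Nil: "fixed_length D g \<Longrightarrow> reducible D s g (\<lambda>e. [])"
  using reducible_wires[of D g "\<lambda>e. []" "[]"] reducible_mono by fastforce

lemma reducible_concat:
  assumes "fixed_length D g" "\<And>k. k < n \<Longrightarrow> reducible D s g (f k)"
  shows "reducible D (n * s) g (\<lambda>e. concat (map (\<lambda>k. f k e) [0..<n]))"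
  using assms(2)
proof (induction n)
  case 0
  then show ?case using assms(1) by (simp add: reducible_Nil)
next
  case (Suc n)
  then show ?case
    using reducible_append[of D "n * s" g _ s "f n"] by (simp add: add.commute)
qed

lemma reducible_const:
  assumes "fixed_length D g"
  shows "reducible D (length c * 2) g (\<lambda>e. c)"
proof -
  have "reducible D (length c * 2) g (\<lambda>e. concat (map (\<lambda>k. [c ! k]) [0..<length c]))"
    using reducible_True[OF assms] reducible_False[OF assms]
    by (intro reducible_concat[OF assms]) (metis (full_types))
  moreover have "concat (map (\<lambda>k. [c ! k]) [0..<length c]) = c"
    by (simp add: concat_map_singleton map_nth)
  ultimately show ?thesis by simp
qed

lemma map_wire_upt: "b \<le> length x \<Longrightarrow> map (wire x) [a..<b] = take (b - a) (drop a x)"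
  by (intro nth_equalityI) (auto simp: wire_def)

text \<open>Sizes of straight-line programs add up under composition, so the total is linear in the
  number of steps. Each step reads the original input besides the accumulator; copying that input
  costs at most \<open>t\<close> outputs per step.\<close>

lemma reducible_iter:
  assumes "reducible D t g (acc 0)" "fixed_length D g" "\<And>e. e \<in> D \<Longrightarrow> length (g e) \<le> t"
    and "\<And>k. k < n \<Longrightarrow> reducible D s (\<lambda>e. g e @ acc k e) (acc (Suc k))"
  shows "reducible D (t + n * (t + s)) g (acc n)"
  using assms(4)
proof (induction n)
  case 0
  then show ?case using assms(1) by simp
next
  case (Suc n)
  have "reducible D t g g"
  proof -
    obtain m where m: "length (g e) = m" if "e \<in> D" for e
      using assms(2) by (auto simp: fixed_length_def)
    have *: "reducible D (length [0..<m]) g g"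
      using m by (intro reducible_wires[OF assms(2)]) (simp add: map_wire_upt)
    show ?thesis
    \<comment> \<open>On an empty domain \<open>m\<close> is arbitrary and cannot be
      bounded.\<close>
    proof (cases "D = {}")
      case False
      then have "m \<le> t" using assms(3) m by auto
      with * show ?thesis by (auto intro: reducible_mono)
    qed (simp add: reducible_empty)
  qed
  from reducible_append[OF this Suc.IH[OF Suc.prems]]
  have "reducible D (t + (t + n * (t + s))) g (\<lambda>e. g e @ acc n e)" by simp
  from reducible_comp[OF this Suc.prems] show ?case
    by (rule reducible_mono) (simp_all add: algebra_simps)
qed

section \<open>Polynomial-size families\<close>

text \<open>Bounds are required only where some environment exists, since lengths on an empty set
  are arbitrary. The base \<open>N + 2\<close> is at least 2, so every constant lies below a power
  of it at \<open>N = 0\<close> and \<open>N = 1\<close> as well.\<close>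

definition poly_on :: "(nat \<Rightarrow> 'i \<Rightarrow> 'e set) \<Rightarrow> (nat \<Rightarrow> 'i \<Rightarrow> nat) \<Rightarrow> bool" where
  "poly_on D a \<longleftrightarrow> (\<exists>c. \<forall>N i. D N i \<noteq> {} \<longrightarrow> a N i \<le> (N + 2) ^ c)"

text \<open>The index \<open>i\<close> stands for auxiliary data such as a loop counter. One
  polynomial in \<open>N\<close> covers all indices, so that loops of polynomial length stay
  polynomial.\<close>

definition ppoly ::
  "(nat \<Rightarrow> 'i \<Rightarrow> 'e set) \<Rightarrow> (nat \<Rightarrow> 'i \<Rightarrow> 'e \<Rightarrow> bits) \<Rightarrow> (nat \<Rightarrow> 'i \<Rightarrow> 'e \<Rightarrow> bits) \<Rightarrow> bool" where
  "ppoly D g f \<longleftrightarrow> (\<exists>s. poly_on D s \<and> (\<forall>N i. reducible (D N i) (s N i) (g N i) (f N i)))"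

lemma ppolyI:
  "poly_on D s \<Longrightarrow> (\<And>N i. reducible (D N i) (s N i) (g N i) (f N i)) \<Longrightarrow> ppoly D g f"
  unfolding ppoly_def by blast

lemma poly_on_const: "poly_on D (\<lambda>N i. c)"
  unfolding poly_on_def
proof (intro exI allI impI)
  fix N :: nat
  have "c \<le> 2 ^ c" by (simp add: less_imp_le)
  also have "(2::nat) ^ c \<le> (N + 2) ^ c" by (rule power_mono) auto
  finally show "c \<le> (N + 2) ^ c" .
qed

lemma poly_on_mono:
  "poly_on D b \<Longrightarrow> (\<And>N i. D N i \<noteq> {} \<Longrightarrow> a N i \<le> b N i) \<Longrightarrow> poly_on D a"
  unfolding poly_on_def by (meson le_trans)

lemma poly_on_mult:
  assumes "poly_on D a" "poly_on D b"
  shows "poly_on D (\<lambda>N i. a N i * b N i)"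
proof -
  obtain c d where c: "\<And>N i. D N i \<noteq> {} \<Longrightarrow> a N i \<le> (N + 2) ^ c"
    and d: "\<And>N i. D N i \<noteq> {} \<Longrightarrow> b N i \<le> (N + 2) ^ d"
    using assms unfolding poly_on_def by blast
  have "a N i * b N i \<le> (N + 2) ^ (c + d)" if "D N i \<noteq> {}" for N i
    using mult_le_mono[OF c[OF that] d[OF that]] by (simp add: power_add)
  then show ?thesis unfolding poly_on_def by blast
qed

lemma poly_on_Suc:
  assumes "poly_on D a"
  shows "poly_on D (\<lambda>N i. Suc (a N i))"
proof -
  obtain c where c: "\<And>N i. D N i \<noteq> {} \<Longrightarrow> a N i \<le> (N + 2) ^ c"
    using assms unfolding poly_on_def by blast
  have "Suc (a N i) \<le> (N + 2) ^ Suc c" if "D N i \<noteq> {}" for N i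
  proof -
    have "1 \<le> (N + 2) ^ c" by simp
    then have "Suc (a N i) \<le> 2 * (N + 2) ^ c" using c[OF that] by linarith
    also have "\<dots> \<le> (N + 2) ^ Suc c" by simp
    finally show ?thesis .
  qed
  then show ?thesis unfolding poly_on_def by blast
qed

text \<open>Reduces to products through \<open>a + b \<le> Suc a * Suc b\<close>.\<close>

lemma poly_on_add:
  assumes "poly_on D a" "poly_on D b"
  shows "poly_on D (\<lambda>N i. a N i + b N i)"
  using poly_on_mult[OF poly_on_Suc[OF assms(1)] poly_on_Suc[OF assms(2)]]
  by (rule poly_on_mono) simp

lemma poly_on_power:
  assumes "poly_on D a"
  shows "poly_on D (\<lambda>N i. a N i ^ c)"
  by (induction c) (auto intro: poly_on_mult assms poly_on_const)

lemma poly_on_reindex: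
  assumes "poly_on D a" "\<And>N j. D' N j \<noteq> {} \<Longrightarrow> D N (\<pi> N j) \<noteq> {}"
  shows "poly_on D' (\<lambda>N j. a N (\<pi> N j))"
  using assms unfolding poly_on_def by blast

lemma poly_bounded_iff: "poly_bounded s \<longleftrightarrow> (\<exists>c. \<forall>N. s N \<le> (N + 2) ^ c)"
proof
  assume "poly_bounded s"
  then obtain c where c: "s N \<le> N ^ c + c" for N by (auto simp: poly_bounded_def)
  have "s N \<le> (N + 2) ^ Suc c" for N
  proof -
    have "N ^ c \<le> (N + 2) ^ c" by (rule power_mono) auto
    moreover have "c \<le> 2 ^ c" by (simp add: less_imp_le)
    moreover have "(2::nat) ^ c \<le> (N + 2) ^ c" by (rule power_mono) auto
    ultimately have "s N \<le> 2 * (N + 2) ^ c" using c[of N] by linarith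
    also have "\<dots> \<le> (N + 2) ^ Suc c" by simp
    finally show ?thesis .
  qed
  then show "\<exists>c. \<forall>N. s N \<le> (N + 2) ^ c" by blast
next
  assume "\<exists>c. \<forall>N. s N \<le> (N + 2) ^ c"
  then obtain c where c: "s N \<le> (N + 2) ^ c" for N by auto
  \<comment> \<open>One number serves twice: \<open>2 * c\<close> as exponent, by
    \<open>N + 2 \<le> N ^ 2\<close> for \<open>N \<ge> 2\<close>, and \<open>3 ^ c\<close> as
    additive constant for \<open>N < 2\<close>.\<close>
  have "s N \<le> N ^ (2 * c + 3 ^ c) + (2 * c + 3 ^ c)" for N
  proof (cases "N < 2")
    case True
    then have "(N + 2) ^ c \<le> 3 ^ c" by (intro power_mono) auto
    then show ?thesis using c[of N] by linarith
  next
    case False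
    then have "N + 2 \<le> 2 * N" "2 * N \<le> N * N" by auto
    then have "N + 2 \<le> N ^ 2" unfolding power2_eq_square by linarith
    then have "(N + 2) ^ c \<le> (N ^ 2) ^ c" by (rule power_mono) simp
    also have "\<dots> = N ^ (2 * c)" by (simp add: power_mult)
    also have "\<dots> \<le> N ^ (2 * c + 3 ^ c)" using False by (intro power_increasing) auto
    finally show ?thesis using c[of N] by linarith
  qed
  then show "poly_bounded s" unfolding poly_bounded_def by blast
qed

lemma poly_onI: "poly_bounded s \<Longrightarrow> poly_on D (\<lambda>N i. s N)"
  by (auto simp: poly_bounded_iff poly_on_def)

lemma ppoly_fixed_length: "ppoly D g f \<Longrightarrow> fixed_length (D N i) (f N i)"
  unfolding ppoly_def using reducible_fixed_length by blast

lemma ppoly_fixed_length_base: "ppoly D g f \<Longrightarrow> fixed_length (D N i) (g N i)"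
  unfolding ppoly_def reducible_def by blast

lemma ppoly_poly_length:
  assumes "ppoly D g f"
  obtains l where "poly_on D l" "\<And>N i e. e \<in> D N i \<Longrightarrow> length (f N i e) = l N i"
proof -
  obtain s where s: "poly_on D s" "\<And>N i. reducible (D N i) (s N i) (g N i) (f N i)"
    using assms unfolding ppoly_def by blast
  have "\<forall>N i. \<exists>n. \<forall>e\<in>D N i. length (f N i e) = n"
    using ppoly_fixed_length[OF assms] unfolding fixed_length_def by blast
  then obtain l where l: "\<And>N i e. e \<in> D N i \<Longrightarrow> length (f N i e) = l N i" by metis
  have "poly_on D l"
    using s(1) by (rule poly_on_mono) (metis all_not_in_conv l reducible_length s(2))
  then show ?thesis using l that by blast
qed

lemma ppoly_cong:
  assumes "ppoly D g f" "\<And>N i e. e \<in> D N i \<Longrightarrow> f N i e = f' N i e"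
  shows "ppoly D g f'"
proof -
  obtain s where s: "poly_on D s" "\<And>N i. reducible (D N i) (s N i) (g N i) (f N i)"
    using assms(1) unfolding ppoly_def by blast
  show ?thesis by (rule ppolyI[OF s(1)]) (rule reducible_cong[OF s(2) assms(2)])
qed

lemma ppoly_map:
  assumes "ppoly D g f" "\<And>N j e. e \<in> D' N j \<Longrightarrow> h N j e \<in> D N (\<pi> N j)"
  shows "ppoly D' (\<lambda>N j e. g N (\<pi> N j) (h N j e)) (\<lambda>N j e. f N (\<pi> N j) (h N j e))"
proof -
  obtain s where s: "poly_on D s" "\<And>N i. reducible (D N i) (s N i) (g N i) (f N i)"
    using assms(1) unfolding ppoly_def by blast
  have ne: "D N (\<pi> N j) \<noteq> {}" if "D' N j \<noteq> {}" for N j using assms(2) that by blast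
  show ?thesis
    by (rule ppolyI[OF poly_on_reindex[OF s(1) ne]], assumption)
      (rule reducible_map[OF s(2)], rule image_subsetI, rule assms(2))
qed

section \<open>Closure of efficient families under composition, slicing and Boolean
  operations\<close>

lemma ppoly_comp:
  assumes "ppoly D g f" "ppoly D f h"
  shows "ppoly D g h"
proof -
  obtain s where s: "poly_on D s" "\<And>N i. reducible (D N i) (s N i) (g N i) (f N i)"
    using assms(1) unfolding ppoly_def by blast
  obtain t where t: "poly_on D t" "\<And>N i. reducible (D N i) (t N i) (f N i) (h N i)"
    using assms(2) unfolding ppoly_def by blast
  show ?thesis by (rule ppolyI[OF poly_on_add[OF s(1) t(1)]]) (rule reducible_comp[OF s(2) t(2)])
qed

lemma ppoly_append:
  assumes "ppoly D g f" "ppoly D g h"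
  shows "ppoly D g (\<lambda>N i e. f N i e @ h N i e)"
proof -
  obtain s where s: "poly_on D s" "\<And>N i. reducible (D N i) (s N i) (g N i) (f N i)"
    using assms(1) unfolding ppoly_def by blast
  obtain t where t: "poly_on D t" "\<And>N i. reducible (D N i) (t N i) (g N i) (h N i)"
    using assms(2) unfolding ppoly_def by blast
  show ?thesis by (rule ppolyI[OF poly_on_add[OF s(1) t(1)]]) (rule reducible_append[OF s(2) t(2)])
qed

lemma ppoly_Cons:
  assumes "ppoly D g (\<lambda>N i e. [b N i e])" "ppoly D g f"
  shows "ppoly D g (\<lambda>N i e. b N i e # f N i e)"
  using ppoly_append[OF assms] by simp

lemma ppoly_wires:
  assumes "\<And>N i. fixed_length (D N i) (g N i)" "poly_on D (\<lambda>N i. length (idx N i))"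
    and "\<And>N i e. e \<in> D N i \<Longrightarrow> f N i e = map (wire (g N i e)) (idx N i)"
  shows "ppoly D g f"
  by (rule ppolyI[OF assms(2)]) (rule reducible_wires[OF assms(1,3)])

lemma ppoly_id:
  assumes "\<And>N i e. e \<in> D N i \<Longrightarrow> length (g N i e) = l N i" "poly_on D l"
  shows "ppoly D g g"
  by (rule ppoly_wires[where idx = "\<lambda>N i. [0..<l N i]"])
    (use assms in \<open>auto simp: fixed_length_def map_wire_upt\<close>)

text \<open>Wires are selected by position, so the part in front must have a fixed length.\<close>

lemma ppoly_slice:
  assumes "ppoly D g (\<lambda>N i e. a N i e @ f N i e @ b N i e)"
    and "\<And>N i. fixed_length (D N i) (a N i)" "\<And>N i. fixed_length (D N i) (f N i)"
  shows "ppoly D g f"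
proof -
  obtain l where l: "poly_on D l"
    "\<And>N i e. e \<in> D N i \<Longrightarrow> length (a N i e @ f N i e @ b N i e) = l N i"
    using ppoly_poly_length[OF assms(1)] by blast
  obtain la lf where la: "\<And>N i e. e \<in> D N i \<Longrightarrow> length (a N i e) = la N i"
    and lf: "\<And>N i e. e \<in> D N i \<Longrightarrow> length (f N i e) = lf N i"
    using assms(2,3) unfolding fixed_length_def by metis
  have "ppoly D (\<lambda>N i e. a N i e @ f N i e @ b N i e) f"
  proof (rule ppoly_wires[where idx = "\<lambda>N i. [la N i..<la N i + lf N i]"])
    show "poly_on D (\<lambda>N i. length [la N i..<la N i + lf N i])"
      using l(1)
    proof (rule poly_on_mono)
      fix N i assume "D N i \<noteq> {}"
      then obtain e where "e \<in> D N i" by blast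
      from l(2)[OF this] lf[OF this] show "length [la N i..<la N i + lf N i] \<le> l N i" by simp
    qed
    show "f N i e = map (wire (a N i e @ f N i e @ b N i e)) [la N i..<la N i + lf N i]"
      if "e \<in> D N i" for N i e
      using la[OF that] lf[OF that] by (simp add: map_wire_upt)
    show "fixed_length (D N i) (\<lambda>e. a N i e @ f N i e @ b N i e)" for N i
      using l(2) by (blast intro: fixed_lengthI)
  qed
  with assms(1) show ?thesis by (rule ppoly_comp)
qed

lemma ppoly_appendD1:
  assumes "ppoly D g (\<lambda>N i e. f N i e @ b N i e)" "\<And>N i. fixed_length (D N i) (f N i)"
  shows "ppoly D g f"
  using ppoly_slice[of D g "\<lambda>_ _ _. []" f b] assms by (simp add: fixed_length_def)

lemma ppoly_appendD2:
  assumes "ppoly D g (\<lambda>N i e. a N i e @ f N i e)" "\<And>N i. fixed_length (D N i) (a N i)"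
  shows "ppoly D g f"
proof -
  have "fixed_length (D N i) (f N i)" for N i
    using ppoly_fixed_length[OF assms(1), of N i] assms(2)[of N i]
    unfolding fixed_length_def by (metis length_append add_diff_cancel_left')
  then show ?thesis
    using ppoly_slice[of D g a f "\<lambda>_ _ _. []"] assms by simp
qed

lemma ppoly_take:
  assumes "ppoly D g f"
  shows "ppoly D g (\<lambda>N i e. take (n N i) (f N i e))"
proof (rule ppoly_appendD1[where b = "\<lambda>N i e. drop (n N i) (f N i e)"])
  show "fixed_length (D N i) (\<lambda>e. take (n N i) (f N i e))" for N i
    using ppoly_fixed_length[OF assms, of N i] unfolding fixed_length_def by (metis length_take)
qed (use assms in simp)

lemma ppoly_drop:
  assumes "ppoly D g f"
  shows "ppoly D g (\<lambda>N i e. drop (n N i) (f N i e))"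
proof (rule ppoly_appendD2[where a = "\<lambda>N i e. take (n N i) (f N i e)"])
  show "fixed_length (D N i) (\<lambda>e. take (n N i) (f N i e))" for N i
    using ppoly_fixed_length[OF assms, of N i] unfolding fixed_length_def by (metis length_take)
qed (use assms in simp)

lemma ppoly_bit:
  assumes "ppoly D g f" "\<And>N i e. e \<in> D N i \<Longrightarrow> k N i < length (f N i e)"
  shows "ppoly D g (\<lambda>N i e. [f N i e ! k N i])"
proof (rule ppoly_cong)
  show "ppoly D g (\<lambda>N i e. take 1 (drop (k N i) (f N i e)))"
    using ppoly_take[where n = "\<lambda>_ _. 1", OF ppoly_drop[where n = k, OF assms(1)]] .
  show "take 1 (drop (k N i) (f N i e)) = [f N i e ! k N i]" if "e \<in> D N i" for N i e
    using assms(2)[OF that] by (simp flip: Cons_nth_drop_Suc)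
qed

text \<open>The added part of the input need not be efficiently computable; circuits just read the
  prefix.\<close>

lemma ppoly_base_append:
  assumes "ppoly D g f" "ppoly D g g" "\<And>N i. fixed_length (D N i) (a N i)"
  shows "ppoly D (\<lambda>N i e. g N i e @ a N i e) f"
proof -
  obtain l where l: "poly_on D l" "\<And>N i e. e \<in> D N i \<Longrightarrow> length (g N i e) = l N i"
    using ppoly_poly_length[OF assms(2)] by blast
  have "ppoly D (\<lambda>N i e. g N i e @ a N i e) g"
    by (rule ppoly_wires[where idx = "\<lambda>N i. [0..<l N i]"])
      (use l assms(3) in \<open>auto simp: fixed_length_def map_wire_upt, metis\<close>)
  then show ?thesis using assms(1) by (rule ppoly_comp)
qed

lemma ppoly_const:
  assumes "\<And>N i. fixed_length (D N i) (g N i)" "poly_on D (\<lambda>N i. length (c N i))"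
  shows "ppoly D g (\<lambda>N i e. c N i)"
  unfolding ppoly_def
proof (intro exI conjI allI)
  show "poly_on D (\<lambda>N i. length (c N i) * 2)"
    by (intro poly_on_mult poly_on_const assms)
qed (use assms reducible_const in blast)

lemma ppoly_nand:
  assumes "ppoly D g (\<lambda>N i e. [a N i e])" "ppoly D g (\<lambda>N i e. [b N i e])"
  shows "ppoly D g (\<lambda>N i e. [\<not> (a N i e \<and> b N i e)])"
proof -
  have "ppoly D (\<lambda>N i e. [a N i e, b N i e]) (\<lambda>N i e. [\<not> (a N i e \<and> b N i e)])"
    unfolding ppoly_def
    by (intro exI[of _ "\<lambda>_ _. 2"] conjI poly_on_const allI reducible_nand)
      (auto simp: fixed_length_def)
  with ppoly_Cons[OF assms] show ?thesis by (rule ppoly_comp)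
qed

lemma ppoly_not:
  assumes "ppoly D g (\<lambda>N i e. [a N i e])"
  shows "ppoly D g (\<lambda>N i e. [\<not> a N i e])"
  using ppoly_nand[OF assms assms] by simp

lemma ppoly_and:
  assumes "ppoly D g (\<lambda>N i e. [a N i e])" "ppoly D g (\<lambda>N i e. [b N i e])"
  shows "ppoly D g (\<lambda>N i e. [a N i e \<and> b N i e])"
  using ppoly_not[OF ppoly_nand[OF assms]] by simp

lemma ppoly_or:
  assumes "ppoly D g (\<lambda>N i e. [a N i e])" "ppoly D g (\<lambda>N i e. [b N i e])"
  shows "ppoly D g (\<lambda>N i e. [a N i e \<or> b N i e])"
  using ppoly_nand[OF ppoly_not[OF assms(1)] ppoly_not[OF assms(2)]] by simp

lemma ppoly_iff:
  assumes "ppoly D g (\<lambda>N i e. [a N i e])" "ppoly D g (\<lambda>N i e. [b N i e])"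
  shows "ppoly D g (\<lambda>N i e. [a N i e = b N i e])"
  using ppoly_or[OF ppoly_and[OF assms] ppoly_and[OF ppoly_not[OF assms(1)] ppoly_not[OF assms(2)]]]
  by (rule ppoly_cong) auto

text \<open>The condition is known when the circuit is built, so one of two circuits is chosen
  rather than a value selected, and the branches may differ in length.\<close>

lemma ppoly_static_if:
  assumes "ppoly D g f" "ppoly D g h"
  shows "ppoly D g (\<lambda>N i e. if B N i then f N i e else h N i e)"
proof -
  obtain s where s: "poly_on D s" "\<And>N i. reducible (D N i) (s N i) (g N i) (f N i)"
    using assms(1) unfolding ppoly_def by blast
  obtain t where t: "poly_on D t" "\<And>N i. reducible (D N i) (t N i) (g N i) (h N i)"
    using assms(2) unfolding ppoly_def by blast
  show ?thesis unfolding ppoly_def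
  proof (intro exI conjI allI)
    show "poly_on D (\<lambda>N i. s N i + t N i)" using s t by (intro poly_on_add)
    show "reducible (D N i) (s N i + t N i) (g N i) (\<lambda>e. if B N i then f N i e else h N i e)" for N i
      using reducible_mono[OF s(2)[of N i], of "s N i + t N i"]
        reducible_mono[OF t(2)[of N i], of "s N i + t N i"] by (cases "B N i") simp_all
  qed
qed

text \<open>Adds a position to the index. Positions from \<open>n\<close> on get an empty set of
  environments, on which \<open>poly_on\<close> asks for nothing.\<close>

definition indexed :: "(nat \<Rightarrow> 'i \<Rightarrow> nat) \<Rightarrow> (nat \<Rightarrow> 'i \<Rightarrow> 'e set) \<Rightarrow> nat \<Rightarrow> 'i \<times> nat \<Rightarrow> 'e set" where
  "indexed n D N j = (if snd j < n N (fst j) then D N (fst j) else {})"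

lemma mem_indexed [simp]: "e \<in> indexed n D N j \<longleftrightarrow> snd j < n N (fst j) \<and> e \<in> D N (fst j)"
  by (simp add: indexed_def)

lemma ppoly_indexed:
  assumes "ppoly D g f"
  shows "ppoly (indexed n D) (\<lambda>N j. g N (fst j)) (\<lambda>N j. f N (fst j))"
  using ppoly_map[OF assms, of "indexed n D" "\<lambda>_ _ e. e" "\<lambda>_. fst"]
  by simp

text \<open>The bound obtained for pairs is replaced by its polynomial in \<open>N\<close>, which no
  longer mentions the position \<open>k\<close>; only then can it be multiplied by the number of
  positions.\<close>

lemma ppoly_indexedE:
  assumes "ppoly (indexed n D) (\<lambda>N j. g N (fst j) (snd j)) (\<lambda>N j. f N (fst j) (snd j))" "poly_on D n"
  obtains s where "poly_on D s"
    "\<And>N i k. k < n N i \<Longrightarrow> reducible (D N i) (s N i) (g N i k) (f N i k)"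
proof -
  obtain s where s: "poly_on (indexed n D) s"
    "\<And>N i k. reducible (indexed n D N (i, k)) (s N (i, k)) (g N i k) (f N i k)"
    using assms(1) unfolding ppoly_def by force
  obtain c where c: "\<And>N i. indexed n D N i \<noteq> {} \<Longrightarrow> s N i \<le> (N + 2) ^ c"
    using s(1) by (auto simp: poly_on_def)
  have "reducible (D N i) ((N + 2) ^ c) (g N i k) (f N i k)" if "k < n N i" for N i k
  proof (cases "D N i = {}")
    case False
    then have "s N (i, k) \<le> (N + 2) ^ c" using that by (intro c) (simp add: indexed_def)
    then show ?thesis using s(2)[of N i k] that reducible_mono by (fastforce simp: indexed_def)
  qed (simp add: reducible_empty)
  moreover have "poly_on D (\<lambda>N i. (N + 2) ^ c)" unfolding poly_on_def by blast
  ultimately show ?thesis using that by blast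
qed

lemma ppoly_concat:
  assumes "ppoly (indexed n D) (\<lambda>N j. g N (fst j)) (\<lambda>N j. f N (fst j) (snd j))" "poly_on D n"
    and "\<And>N i. fixed_length (D N i) (g N i)"
  shows "ppoly D g (\<lambda>N i e. concat (map (\<lambda>k. f N i k e) [0..<n N i]))"
proof -
  obtain s where s: "poly_on D s"
    "\<And>N i k. k < n N i \<Longrightarrow> reducible (D N i) (s N i) (g N i) (f N i k)"
    using ppoly_indexedE[OF assms(1,2)] by blast
  show ?thesis
    by (rule ppolyI[OF poly_on_mult[OF assms(2) s(1)]]) (rule reducible_concat[OF assms(3) s(2)])
qed

lemma ppoly_bits:
  assumes "ppoly (indexed n D) (\<lambda>N j. g N (fst j)) (\<lambda>N j e. [f N (fst j) e ! snd j])" "poly_on D n"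
    and "\<And>N i. fixed_length (D N i) (g N i)" "\<And>N i e. e \<in> D N i \<Longrightarrow> length (f N i e) = n N i"
  shows "ppoly D g f"
proof (rule ppoly_cong)
  show "ppoly D g (\<lambda>N i e. concat (map (\<lambda>k. [f N i e ! k]) [0..<n N i]))"
    using assms(1-3) by (intro ppoly_concat)
  show "concat (map (\<lambda>k. [f N i e ! k]) [0..<n N i]) = f N i e" if "e \<in> D N i" for N i e
    using assms(4)[OF that] by (metis concat_map_singleton map_nth)
qed

lemma ppoly_iter:
  assumes "ppoly (indexed n D) (\<lambda>N j e. g N (fst j) e @ acc N (fst j) (snd j) e) (\<lambda>N j. acc N (fst j) (Suc (snd j)))"
    and "ppoly D g (\<lambda>N i. acc N i 0)" "poly_on D n" "ppoly D g g"
  shows "ppoly D g (\<lambda>N i. acc N i (n N i))"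
proof -
  obtain s where s: "poly_on D s"
    "\<And>N i k. k < n N i \<Longrightarrow> reducible (D N i) (s N i) (\<lambda>e. g N i e @ acc N i k e) (acc N i (Suc k))"
    by (rule ppoly_indexedE[OF _ assms(3), where g = "\<lambda>N i k e. g N i e @ acc N i k e"
          and f = "\<lambda>N i k. acc N i (Suc k)"]) (use assms(1) in auto)
  obtain l where l: "poly_on D l" "\<And>N i e. e \<in> D N i \<Longrightarrow> length (g N i e) = l N i"
    using ppoly_poly_length[OF assms(4)] by blast
  obtain t where t: "poly_on D t" "\<And>N i. reducible (D N i) (t N i) (g N i) (acc N i 0)"
    using assms(2) unfolding ppoly_def by blast
  define u where "u N i = t N i + l N i" for N i
  have u: "poly_on D u" unfolding u_def by (intro poly_on_add t l)
  show ?thesis unfolding ppoly_def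
  proof (intro exI conjI allI)
    show "poly_on D (\<lambda>N i. u N i + n N i * (u N i + s N i))"
      by (intro poly_on_add poly_on_mult u s assms(3))
    show "reducible (D N i) (u N i + n N i * (u N i + s N i)) (g N i) (acc N i (n N i))" for N i
      using l(2) by (intro reducible_iter s(2) reducible_mono[OF t(2)])
        (auto simp: u_def fixed_length_def)
  qed
qed

text \<open>The loop body is built over an abstract circuit input \<open>G\<close>, known only to
  provide the surrounding values and the accumulator, so the same combinators apply inside the loop.
  The accumulator is part of that input, hence the polynomial bound on its length.\<close>

lemma ppoly_loop:
  assumes step: "\<And>G. ppoly (indexed n D) G G \<Longrightarrow>
      (\<And>f. ppoly D g f \<Longrightarrow> ppoly (indexed n D) G (\<lambda>N j. f N (fst j))) \<Longrightarrow>
      ppoly (indexed n D) G (\<lambda>N j. acc N (fst j) (snd j)) \<Longrightarrow>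
      ppoly (indexed n D) G (\<lambda>N j. acc N (fst j) (Suc (snd j)))"
    and "ppoly D g (\<lambda>N i. acc N i 0)" "poly_on D n" and gg: "ppoly D g g"
    and len: "\<And>N i k e. e \<in> D N i \<Longrightarrow> k < n N i \<Longrightarrow> length (acc N i k e) = l N i k"
    and l: "poly_on (indexed n D) (\<lambda>N j. l N (fst j) (snd j))"
  shows "ppoly D g (\<lambda>N i. acc N i (n N i))"
proof (rule ppoly_iter)
  let ?D = "indexed n D" and ?G = "\<lambda>N j e. g N (fst j) e @ acc N (fst j) (snd j) e"
  obtain lg where lg: "poly_on D lg" "\<And>N i e. e \<in> D N i \<Longrightarrow> length (g N i e) = lg N i"
    using ppoly_poly_length[OF gg] by blast
  have "poly_on ?D (\<lambda>N j. lg N (fst j))"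
    using lg(1) by (rule poly_on_reindex) (auto simp: indexed_def split: if_splits)
  then have "poly_on ?D (\<lambda>N j. lg N (fst j) + l N (fst j) (snd j))"
    using l by (rule poly_on_add)
  then have GG: "ppoly ?D ?G ?G"
    by (rule ppoly_id[rotated]) (simp add: len lg)
  show "ppoly ?D ?G (\<lambda>N j. acc N (fst j) (Suc (snd j)))"
  proof (rule step[OF GG])
    show "ppoly ?D ?G (\<lambda>N j. f N (fst j))" if "ppoly D g f" for f
      by (rule ppoly_base_append[OF ppoly_indexed[OF that] ppoly_indexed[OF gg]])
        (rule fixed_lengthI[of _ _ "l _ _ _"], simp add: len)
    show "ppoly ?D ?G (\<lambda>N j. acc N (fst j) (snd j))"
      by (rule ppoly_appendD2[OF GG]) (rule fixed_lengthI[of _ _ "lg _ _"], simp add: lg)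
  qed
qed (use assms in auto)

section \<open>Comparison, selection and calls of efficient algorithms\<close>

lemma ppoly_literal:
  assumes "ppoly D g g"
  shows "ppoly D g (\<lambda>N i e. c)"
  by (rule ppoly_const[OF ppoly_fixed_length[OF assms] poly_on_const])

lemma ppoly_eq:
  assumes x: "ppoly D g x" and y: "ppoly D g y" and gg: "ppoly D g g"
    and len: "\<And>N i e. e \<in> D N i \<Longrightarrow> length (x N i e) = length (y N i e)"
  shows "ppoly D g (\<lambda>N i e. [x N i e = y N i e])"
proof -
  obtain l where l: "poly_on D l" "\<And>N i e. e \<in> D N i \<Longrightarrow> length (x N i e) = l N i"
    using ppoly_poly_length[OF x] by blast
  \<comment> \<open>The one-bit accumulator says whether the prefixes of length \<open>k\<close>
    agree, so each step compares a single pair of bits.\<close>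
  define acc where "acc N i k e = [take k (x N i e) = take k (y N i e)]" for N i k e
  have "ppoly D g (\<lambda>N i. acc N i (l N i))"
  proof (rule ppoly_loop)
    fix G assume G: "\<And>f. ppoly D g f \<Longrightarrow> ppoly (indexed l D) G (\<lambda>N j. f N (fst j))"
      and a: "ppoly (indexed l D) G (\<lambda>N j. acc N (fst j) (snd j))"
    have "ppoly (indexed l D) G (\<lambda>N j e. [x N (fst j) e ! snd j])"
      "ppoly (indexed l D) G (\<lambda>N j e. [y N (fst j) e ! snd j])"
      by (rule ppoly_bit[OF G[OF x]] ppoly_bit[OF G[OF y]]; use l len in auto)+
    from ppoly_and[OF a[unfolded acc_def] ppoly_iff[OF this]]
    show "ppoly (indexed l D) G (\<lambda>N j. acc N (fst j) (Suc (snd j)))"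
    proof (rule ppoly_cong)
      fix N j e assume "e \<in> indexed l D N j"
      then have "snd j < length (x N (fst j) e)" "snd j < length (y N (fst j) e)"
        using l(2) len by auto
      then show "[take (snd j) (x N (fst j) e) = take (snd j) (y N (fst j) e) \<and>
          x N (fst j) e ! snd j = y N (fst j) e ! snd j] = acc N (fst j) (Suc (snd j)) e"
        by (simp add: acc_def take_Suc_conv_app_nth)
    qed
  next
    show "ppoly D g (\<lambda>N i. acc N i 0)"
      by (rule ppoly_cong[OF ppoly_literal[OF gg, of "[True]"]]) (simp add: acc_def)
  qed (auto simp: acc_def l gg poly_on_const)
  then show ?thesis by (rule ppoly_cong) (use l len in \<open>auto simp: acc_def\<close>)
qed

text \<open>Each output bit is a multiplexer. Equal lengths are required because the number of
  outputs cannot depend on the environment.\<close>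

lemma ppoly_if:
  assumes "ppoly D g (\<lambda>N i e. [c N i e])" "ppoly D g x" "ppoly D g y"
    and "\<And>N i e. e \<in> D N i \<Longrightarrow> length (x N i e) = length (y N i e)"
  shows "ppoly D g (\<lambda>N i e. if c N i e then x N i e else y N i e)"
proof -
  obtain l where l: "poly_on D l" "\<And>N i e. e \<in> D N i \<Longrightarrow> length (x N i e) = l N i"
    using ppoly_poly_length[OF assms(2)] by blast
  have ly: "length (y N i e) = l N i" if "e \<in> D N i" for N i e
    using l assms(4) that by simp
  let ?D = "indexed l D" and ?g = "\<lambda>N j. g N (fst j)"
  have bits: "ppoly ?D ?g (\<lambda>N j e. [z N (fst j) e ! snd j])"
    if "ppoly D g z" "\<And>N i e. e \<in> D N i \<Longrightarrow> length (z N i e) = l N i" for z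
  proof -
    show ?thesis using that by (intro ppoly_bit ppoly_indexed) auto
  qed
  have c: "ppoly ?D ?g (\<lambda>N j e. [c N (fst j) e])"
    using ppoly_indexed[OF assms(1), of l] .
  show ?thesis
  proof (rule ppoly_bits[where n = l])
    show "ppoly ?D ?g (\<lambda>N j e. [(if c N (fst j) e then x N (fst j) e else y N (fst j) e) ! snd j])"
      using ppoly_or[OF ppoly_and[OF c bits[OF assms(2) l(2)]]
          ppoly_and[OF ppoly_not[OF c] bits[OF assms(3) ly]]]
      by (rule ppoly_cong) auto
    show "fixed_length (D N i) (g N i)" for N i
      using assms(1) by (rule ppoly_fixed_length_base)
  qed (use l ly in auto)
qed

lemma ppoly_concat_nth:
  assumes "ppoly D g (\<lambda>N i e. concat (xs N i e))"
    and "\<And>N i e. e \<in> D N i \<Longrightarrow> k N i < length (xs N i e)"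
    and "\<And>N i e x. e \<in> D N i \<Longrightarrow> x \<in> set (xs N i e) \<Longrightarrow> length x = L N i"
  shows "ppoly D g (\<lambda>N i e. xs N i e ! k N i)"
proof (rule ppoly_slice[where a = "\<lambda>N i e. concat (take (k N i) (xs N i e))"
      and b = "\<lambda>N i e. concat (drop (Suc (k N i)) (xs N i e))"])
  show "ppoly D g (\<lambda>N i e. concat (take (k N i) (xs N i e)) @ xs N i e ! k N i @
      concat (drop (Suc (k N i)) (xs N i e)))"
    using assms(1)
  proof (rule ppoly_cong)
    fix N i e assume "e \<in> D N i"
    then have "xs N i e = take (k N i) (xs N i e) @ xs N i e ! k N i # drop (Suc (k N i)) (xs N i e)"
      using assms(2) id_take_nth_drop by blast
    then show "concat (xs N i e) = concat (take (k N i) (xs N i e)) @ xs N i e ! k N i @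
      concat (drop (Suc (k N i)) (xs N i e))"
      by (metis concat.simps(2) concat_append)
  qed
  show "fixed_length (D N i) (\<lambda>e. concat (take (k N i) (xs N i e)))" for N i
  proof (rule fixed_lengthI[where n = "k N i * L N i"])
    fix e assume e: "e \<in> D N i"
    have "map length (take (k N i) (xs N i e)) = replicate (k N i) (L N i)"
      using assms(2)[OF e] assms(3)[OF e] by (intro nth_equalityI) auto
    then show "length (concat (take (k N i) (xs N i e))) = k N i * L N i"
      by (simp add: length_concat sum_list_replicate)
  qed
  show "fixed_length (D N i) (\<lambda>e. xs N i e ! k N i)" for N i
    using assms(2,3) by (intro fixed_lengthI[where n = "L N i"]) auto
qed

text \<open>The induction nests \<open>K\<close> conditionals. The size stays polynomial because
  \<open>K\<close> does not depend on \<open>N\<close>; it will be the number of nodes.\<close>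

lemma ppoly_cases:
  fixes m :: "nat \<Rightarrow> 'i \<Rightarrow> 'e \<Rightarrow> nat option"
  assumes "\<And>a. a < K \<Longrightarrow> ppoly D g (\<lambda>N i e. [m N i e = Some a])" "\<And>a. a < K \<Longrightarrow> ppoly D g (f a)"
    and "ppoly D g h"
    and "\<And>a N i e. a < K \<Longrightarrow> e \<in> D N i \<Longrightarrow> length (f a N i e) = length (h N i e)"
  shows "ppoly D g (\<lambda>N i e. case m N i e of Some a \<Rightarrow> if a < K then f a N i e else h N i e | None \<Rightarrow> h N i e)"
  using assms(1,2,4)
proof (induction K)
  case 0
  show ?case by (rule ppoly_cong[OF assms(3)]) (simp split: option.split)
next
  case (Suc K)
  have IH: "ppoly D g (\<lambda>N i e. case m N i e of Some a \<Rightarrow> if a < K then f a N i e else h N i e | None \<Rightarrow> h N i e)"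
    using Suc.prems by (intro Suc.IH) auto
  show ?case
    by (rule ppoly_cong[OF ppoly_if[OF Suc.prems(1)[of K] Suc.prems(2)[of K] IH]])
      (use Suc.prems(3) in \<open>auto split: option.split simp: less_Suc_eq\<close>)
qed

lemma ppoly_run:
  assumes "ppoly D g f" "poly_on D (\<lambda>N i. circuit_size (C N i))"
  shows "ppoly D g (\<lambda>N i e. run (C N i) (f N i e))"
proof -
  have "ppoly D f (\<lambda>N i e. run (C N i) (f N i e))"
    by (rule ppolyI[OF assms(2)]) (rule reducible_run[OF ppoly_fixed_length[OF assms(1)]])
  with assms(1) show ?thesis by (rule ppoly_comp)
qed

text \<open>The argument lengths depend on the index alone and thereby select the circuit; their sum
  is the length of the concatenated input, which is already polynomial.\<close>

lemma ppoly_efficient: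
  assumes "efficient E F" "ppoly D g (\<lambda>N i e. concat (xs N i e))"
    and "\<And>N i e. e \<in> D N i \<Longrightarrow> xs N i e \<in> E N"
    and "\<And>N i e. e \<in> D N i \<Longrightarrow> map length (xs N i e) = ns N i"
  shows "ppoly D g (\<lambda>N i e. F N (xs N i e))"
proof -
  obtain c where c: "\<And>N ns. \<exists>C. circuit_size C \<le> (N + sum_list ns) ^ c + c \<and>
     (\<forall>xs \<in> E N. map length xs = ns \<longrightarrow> run C (concat xs) = F N xs)"
    using assms(1) unfolding efficient_def by blast
  obtain l where l: "poly_on D l" "\<And>N i e. e \<in> D N i \<Longrightarrow> length (concat (xs N i e)) = l N i"
    using ppoly_poly_length[OF assms(2)] by blast
  have "ppoly D (\<lambda>N i e. concat (xs N i e)) (\<lambda>N i e. F N (xs N i e))"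
    unfolding ppoly_def
  proof (intro exI conjI allI)
    have "poly_on D (\<lambda>N i. N :: nat)" unfolding poly_on_def by (intro exI[of _ 1]) simp
    then show "poly_on D (\<lambda>N i. (N + l N i) ^ c + c)"
      by (intro poly_on_add poly_on_power poly_on_const l)
    show "reducible (D N i) ((N + l N i) ^ c + c) (\<lambda>e. concat (xs N i e)) (\<lambda>e. F N (xs N i e))" for N i
    proof (cases "D N i = {}")
      case False
      then obtain e where "e \<in> D N i" by blast
      then have "sum_list (ns N i) = l N i"
        using assms(4) l(2) by (metis length_concat)
      then show ?thesis
        using c[of N "ns N i"] assms(3,4) l(2) unfolding reducible_def fixed_length_def by metis
    qed (simp add: reducible_empty)
  qed
  with assms(2) show ?thesis by (rule ppoly_comp)
qed

lemma ppoly_if_cong: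
  assumes "ppoly D g (\<lambda>N i e. [c N i e])" "ppoly D g x" "ppoly D g y"
    and "\<And>N i e. e \<in> D N i \<Longrightarrow> length (x N i e) = length (y N i e)"
    and "\<And>N i e. e \<in> D N i \<Longrightarrow> (if c N i e then x N i e else y N i e) = f N i e"
  shows "ppoly D g f"
  by (rule ppoly_cong[OF ppoly_if[OF assms(1-4)]]) (use assms(5) in auto)

lemma ppoly_eq_const:
  assumes "ppoly D g x" "ppoly D g g"
  shows "ppoly D g (\<lambda>N i e. [x N i e = c N i])"
proof -
  obtain l where l: "poly_on D l" "\<And>N i e. e \<in> D N i \<Longrightarrow> length (x N i e) = l N i"
    using ppoly_poly_length[OF assms(1)] by blast
  \<comment> \<open>The constant may have the wrong length, even a superpolynomial one. Then the
    comparison is False for a static reason, and \<open>y\<close> is merely a placeholder of the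
    right length.\<close>
  define y where "y N i = (if l N i = length (c N i) then c N i else replicate (l N i) False)" for N i
  have y: "length (y N i) = l N i" for N i by (simp add: y_def)
  have fl: "fixed_length (D N i) (g N i)" for N i using assms(2) by (rule ppoly_fixed_length)
  have "ppoly D g (\<lambda>N i e. [x N i e = y N i])"
    by (intro ppoly_eq assms ppoly_const fl) (simp_all add: l y)
  from ppoly_static_if[OF this ppoly_literal[OF assms(2), of "[False]"],
      of "\<lambda>N i. l N i = length (c N i)"]
  show ?thesis
    by (rule ppoly_cong) (auto simp: y_def l poly_on_const dest: arg_cong[of _ _ length])
qed

lemma nat_of_bits_less: "nat_of_bits x < 2 ^ length x"
  by (induction x) auto

text \<open>Turns comparison with a number into comparison with a string. The bound on
  \<open>a\<close> excludes numbers whose truncated encoding would coincide with that of a smaller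
  one.\<close>

lemma nat_of_bits_eq_iff:
  "nat_of_bits x = a \<longleftrightarrow> a < 2 ^ length x \<and> x = bits_of_nat (length x) a"
proof
  assume a: "nat_of_bits x = a"
  have "a < 2 ^ length x" using nat_of_bits_less[of x] a by simp
  moreover have "x = bits_of_nat (length x) a"
    unfolding a[symmetric] bits_of_nat_def
    by (intro nth_equalityI) (simp_all add: bit_horner_sum_bit_iff)
  ultimately show "a < 2 ^ length x \<and> x = bits_of_nat (length x) a" by blast
next
  assume a: "a < 2 ^ length x \<and> x = bits_of_nat (length x) a"
  have "nat_of_bits (map (bit a) [0..<length x]) = take_bit (length x) a"
    by (rule horner_sum_bit_eq_take_bit)
  also have "\<dots> = a" using a by (simp add: take_bit_nat_eq_self)
  finally show "nat_of_bits x = a" using a by (simp add: bits_of_nat_def)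
qed

lemma nat_of_bits_of_nat: "a < 2 ^ l \<Longrightarrow> nat_of_bits (bits_of_nat l a) = a"
  by (simp add: nat_of_bits_eq_iff bits_of_nat_def)

lemma ppoly_nat_eq_const:
  assumes "ppoly D g x" "ppoly D g g"
  shows "ppoly D g (\<lambda>N i e. [nat_of_bits (x N i e) = a])"
proof -
  obtain l where l: "poly_on D l" "\<And>N i e. e \<in> D N i \<Longrightarrow> length (x N i e) = l N i"
    using ppoly_poly_length[OF assms(1)] by blast
  from ppoly_static_if[OF ppoly_eq_const[OF assms, of "\<lambda>N i. bits_of_nat (l N i) a"]
      ppoly_literal[OF assms(2), of "[False]"], of "\<lambda>N i. a < 2 ^ l N i"]
  show ?thesis
    by (rule ppoly_cong) (simp add: nat_of_bits_eq_iff l)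
qed

lemma ppoly_map_upt:
  assumes "\<And>a. a < K \<Longrightarrow> ppoly D g (\<lambda>N i e. [f a N i e])" "ppoly D g g"
  shows "ppoly D g (\<lambda>N i e. map (\<lambda>a. f a N i e) [0..<K])"
  using assms(1)
proof (induction K)
  case 0
  show ?case
    using ppoly_literal[OF assms(2)] by simp
next
  case (Suc K)
  then show ?case using ppoly_append[of D g "\<lambda>N i e. map (\<lambda>a. f a N i e) [0..<K]"] by simp
qed

section \<open>Simulating the game from the samples drawn for its lookups\<close>

text \<open>A table entry holds, for one round, the node addressed by a well-formed lookup (\<open>None\<close> for
  any other request), the nonce, and the strings SURB @ blinded key for the two usernames.\<close>

type_synonym entry = "nat option \<times> bits \<times> bits \<times> bits"

text \<open>The requirements on a lookup that concern lengths only. They are decided by the numbers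
  of outputs, hence independent of the view and usable in \<open>ppoly_static_if\<close>.\<close>

definition well_shaped :: "system \<Rightarrow> nat \<Rightarrow> circuit list \<Rightarrow> bool" where
  "well_shaped P N cs \<longleftrightarrow> length cs = 5 \<and> length (outputs (cs ! 0)) = 1 \<and>
     length (outputs (cs ! 1)) = 1 \<and> length (outputs (cs ! 3)) = nonce_len P N"

definition req_key :: "system \<Rightarrow> nat \<Rightarrow> circuit list \<Rightarrow> bits \<Rightarrow> nat option" where
  "req_key P N cs v =
     (if well_shaped P N cs \<and> run (cs ! 0) v = [False] \<and> nat_of_bits (run (cs ! 2) v) < nodes P
      then Some (nat_of_bits (run (cs ! 2) v)) else None)"

definition req_name :: "system \<Rightarrow> nat \<Rightarrow> circuit list \<Rightarrow> bits \<Rightarrow> bool" where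
  "req_name P N cs v \<longleftrightarrow> well_shaped P N cs \<and> run (cs ! 1) v = [True]"

text \<open>The default value has the regular length, so that a round without a lookup also fills a
  table entry of the common format and can be given queries of its own.\<close>

definition req_nonce :: "system \<Rightarrow> nat \<Rightarrow> circuit list \<Rightarrow> bits \<Rightarrow> bits" where
  "req_nonce P N cs v =
     (if well_shaped P N cs then run (cs ! 3) v else replicate (nonce_len P N) False)"

text \<open>Only the nonce is compared, not the node: the secret is shared, so the same nonce leads
  to the same strings at every node. The default \<open>y\<close> is the pair of the current
  round.\<close>

primrec lookup :: "bits \<Rightarrow> entry list \<Rightarrow> bits \<times> bits \<Rightarrow> bits \<times> bits" where
  "lookup n [] y = y"
| "lookup n (e # tab) y = (if fst (snd e) = n then snd (snd e) else lookup n tab y)"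

text \<open>In contrast to \<open>lookup\<close>, the node counts: every node keeps its own set of
  used nonces. Entries of rejected replays may stay in the table, since they repeat a node and nonce
  already present.\<close>

definition replayed :: "nat option \<Rightarrow> bits \<Rightarrow> entry list \<Rightarrow> bool" where
  "replayed k n tab \<longleftrightarrow> (\<exists>e\<in>set tab. fst e = k \<and> fst (snd e) = n)"

definition sim_answer ::
  "system \<Rightarrow> nat \<Rightarrow> bits list \<Rightarrow> nat option \<Rightarrow> bits \<Rightarrow> bool \<Rightarrow> bits \<Rightarrow> bits \<Rightarrow> bits" where
  "sim_answer P N sks key nonce dup z \<rho> = encode_answer P N
     (case key of
        Some i \<Rightarrow> if dup then None else Some (nonce @ z @ sign P N (sks ! i) (nonce @ z) \<rho>)
      | None \<Rightarrow> None)"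

text \<open>The pair \<open>z\<close> belongs to the round and takes effect only if the nonce is
  new. Every request, even a malformed one, adds an entry, so the length of the table is determined
  by the number of rounds.\<close>

definition sim_step ::
  "system \<Rightarrow> nat \<Rightarrow> bits list \<Rightarrow> circuit list \<times> bits \<Rightarrow> bits \<times> bits \<Rightarrow>
   bits \<times> entry list \<Rightarrow> bits \<times> entry list" where
  "sim_step P N sks l z s =
     (let v = fst s; tab = snd s; cs = fst l;
          key = req_key P N cs v; nonce = req_nonce P N cs v; y = lookup nonce tab z
      in (v @ sim_answer P N sks key nonce (replayed key nonce tab)
               (if req_name P N cs v then snd y else fst y) (snd l),
          (key, nonce, y) # tab))"

definition sample_len :: "system \<Rightarrow> nat \<Rightarrow> nat" where
  "sample_len P N = surb_len P N + grp_len P N"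

definition answer_len :: "system \<Rightarrow> nat \<Rightarrow> nat" where
  "answer_len P N = Suc (nonce_len P N + sample_len P N + sig_len P N)"

definition entry_ok :: "system \<Rightarrow> nat \<Rightarrow> entry \<Rightarrow> bool" where
  "entry_ok P N e \<longleftrightarrow> (\<forall>a. fst e = Some a \<longrightarrow> a < nodes P) \<and> length (fst (snd e)) = nonce_len P N \<and>
     length (fst (snd (snd e))) = sample_len P N \<and> length (snd (snd (snd e))) = sample_len P N"

text \<open>A unary code: the test for a given node is a single wire, and \<open>None\<close>
  becomes the zero string.\<close>

definition key_bits :: "nat \<Rightarrow> nat option \<Rightarrow> bits" where
  "key_bits K k = map (\<lambda>a. k = Some a) [0..<K]"

definition encode_entry :: "nat \<Rightarrow> entry \<Rightarrow> bits" where
  "encode_entry K e = key_bits K (fst e) @ fst (snd e) @ fst (snd (snd e)) @ snd (snd (snd e))"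

definition encode_sim :: "nat \<Rightarrow> bits \<times> entry list \<Rightarrow> bits" where
  "encode_sim K s = fst s @ concat (map (encode_entry K) (snd s))"

lemma length_key_bits [simp]: "length (key_bits K k) = K"
  by (simp add: key_bits_def)

lemma key_bits_inject:
  assumes "\<And>a. k = Some a \<Longrightarrow> a < K" "\<And>a. k' = Some a \<Longrightarrow> a < K"
  shows "key_bits K k = key_bits K k' \<longleftrightarrow> k = k'"
proof
  assume "key_bits K k = key_bits K k'"
  then have "\<forall>a<K. (k = Some a) = (k' = Some a)"
    by (simp add: key_bits_def)
  then show "k = k'" using assms by (cases k; cases k') auto
qed simp

lemma length_encode_entry: "entry_ok P N e \<Longrightarrow>
  length (encode_entry (nodes P) e) = nodes P + nonce_len P N + 2 * sample_len P N"
  by (simp add: encode_entry_def entry_ok_def)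

lemma length_req_nonce [simp]: "length (req_nonce P N cs v) = nonce_len P N"
  by (simp add: req_nonce_def well_shaped_def)

lemma req_key_less: "req_key P N cs v = Some a \<Longrightarrow> a < nodes P"
  by (auto simp: req_key_def split: if_splits)

lemma lookup_length:
  assumes "\<forall>e\<in>set tab. entry_ok P N e" "length (fst y) = sample_len P N" "length (snd y) = sample_len P N"
  shows "length (fst (lookup n tab y)) = sample_len P N" "length (snd (lookup n tab y)) = sample_len P N"
  using assms by (induction tab) (auto simp: entry_ok_def)

lemma length_sim_answer:
  assumes "well_formed P" "\<forall>a<nodes P. length (sks ! a) = sk_len P N" "length \<rho> = sig_rand_len P N"
    and "\<And>a. key = Some a \<Longrightarrow> a < nodes P" "length nonce = nonce_len P N" "length z = sample_len P N"
  shows "length (sim_answer P N sks key nonce dup z \<rho>) = answer_len P N"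
proof -
  have "length (sign P N (sks ! a) m \<rho>) = sig_len P N" if "a < nodes P" for a m
    using assms(1,2,3) that unfolding well_formed_def by blast
  then show ?thesis
    using assms(4-6) by (auto simp: sim_answer_def encode_answer_def answer_len_def sample_len_def
        split: option.split)
qed

lemma sim_step_ok:
  assumes "well_formed P" "\<forall>a<nodes P. length (sks ! a) = sk_len P N" "length (snd l) = sig_rand_len P N"
    and "\<forall>e\<in>set (snd s). entry_ok P N e"
    and "length (fst z) = sample_len P N" "length (snd z) = sample_len P N"
  shows "length (fst (sim_step P N sks l z s)) = length (fst s) + answer_len P N"
    and "length (snd (sim_step P N sks l z s)) = Suc (length (snd s))"
    and "\<forall>e\<in>set (snd (sim_step P N sks l z s)). entry_ok P N e"
proof -
  note y = lookup_length[OF assms(4-6)]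
  show "length (fst (sim_step P N sks l z s)) = length (fst s) + answer_len P N"
    using length_sim_answer[OF assms(1-3)] y req_key_less by (simp add: sim_step_def Let_def)
  show "length (snd (sim_step P N sks l z s)) = Suc (length (snd s))"
    by (simp add: sim_step_def Let_def)
  show "\<forall>e\<in>set (snd (sim_step P N sks l z s)). entry_ok P N e"
    using y assms(4) req_key_less by (auto simp: sim_step_def Let_def entry_ok_def)
qed

section \<open>Efficiency of the simulated rounds\<close>

lemma well_formed_poly:
  assumes "well_formed P"
  shows "poly_bounded (grp_len P)" "poly_bounded (exp_len P)" "poly_bounded (addr_len P)"
    "poly_bounded (pki_len P)" "poly_bounded (nonce_len P)" "poly_bounded (seed_len P)"
    "poly_bounded (surb_rand_len P)" "poly_bounded (draw_rand_len P)" "poly_bounded (surb_len P)"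
    "poly_bounded (vk_len P)" "poly_bounded (sk_len P)" "poly_bounded (sig_rand_len P)"
    "poly_bounded (sig_len P)"
  using assms by (auto simp: well_formed_def)

lemma poly_on_sample_len: "well_formed P \<Longrightarrow> poly_on D (\<lambda>N i. sample_len P N)"
  unfolding sample_len_def by (intro poly_on_add poly_onI well_formed_poly)

lemma poly_on_answer_len: "well_formed P \<Longrightarrow> poly_on D (\<lambda>N i. answer_len P N)"
  unfolding answer_len_def
  by (intro poly_on_Suc poly_on_add poly_onI well_formed_poly poly_on_sample_len)

lemma ppoly_field:
  assumes "ppoly D g v" "poly_on D (\<lambda>N i. \<Sum>C\<leftarrow>c N i. circuit_size C)"
  shows "ppoly D g (\<lambda>N i e.
    run (if a < length (c N i) then c N i ! a else \<lparr>gates = [], outputs = []\<rparr>) (v N i e))"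
proof (rule ppoly_run[OF assms(1)])
  show "poly_on D (\<lambda>N i. circuit_size (if a < length (c N i) then c N i ! a
      else \<lparr>gates = [], outputs = []\<rparr>))"
    using assms(2) by (rule poly_on_mono)
      (auto intro!: member_le_sum_list nth_mem simp: circuit_size_def[of "\<lparr>gates = [], outputs = []\<rparr>"])
qed

lemma ppoly_req_nonce:
  assumes wf: "well_formed P" and v: "ppoly D g v"
    and c: "poly_on D (\<lambda>N i. \<Sum>C\<leftarrow>c N i. circuit_size C)"
  shows "ppoly D g (\<lambda>N i e. req_nonce P N (c N i) (v N i e))"
proof -
  have fl: "fixed_length (D N i) (g N i)" for N i using v by (rule ppoly_fixed_length_base)
  have "poly_on D (\<lambda>N i. length (replicate (nonce_len P N) False))"
    using poly_onI[OF well_formed_poly(5)[OF wf]] by simp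
  from ppoly_static_if[OF ppoly_field[OF v c, of 3] ppoly_const[OF fl this],
      of "\<lambda>N i. well_shaped P N (c N i)"]
  show ?thesis by (rule ppoly_cong) (auto simp: req_nonce_def well_shaped_def)
qed

text \<open>Request fields, replay test, table search and signature are built separately and then
  joined. Where the signing key matters, one circuit per node is built, which is affordable because
  the number of nodes is constant.\<close>

lemma ppoly_sim_step:
  fixes l :: "nat \<Rightarrow> 'i \<Rightarrow> circuit list \<times> bits"
  assumes wf: "well_formed P" and eff: "efficient_algorithms P"
    and sks: "\<And>N. \<forall>a<nodes P. length (sks N ! a) = sk_len P N"
    and \<rho>: "\<And>N i. D N i \<noteq> {} \<Longrightarrow> length (snd (l N i)) = sig_rand_len P N"
    and cs: "poly_on D (\<lambda>N i. \<Sum>C\<leftarrow>fst (l N i). circuit_size C)"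
    and gg: "ppoly D g g"
    and v: "ppoly D g v" and tab: "ppoly D g (\<lambda>N i e. concat (map (encode_entry (nodes P)) (tab N i e)))"
    and n: "\<And>N i e. e \<in> D N i \<Longrightarrow> length (tab N i e) = n N i" "poly_on D n"
    and ok: "\<And>N i e. e \<in> D N i \<Longrightarrow> \<forall>x\<in>set (tab N i e). entry_ok P N x"
    and zF: "ppoly D g zF" "\<And>N i e. e \<in> D N i \<Longrightarrow> length (zF N i e) = sample_len P N"
    and zT: "ppoly D g zT" "\<And>N i e. e \<in> D N i \<Longrightarrow> length (zT N i e) = sample_len P N"
  shows "ppoly D g (\<lambda>N i e. encode_sim (nodes P)
    (sim_step P N (sks N) (l N i) (zF N i e, zT N i e) (v N i e, tab N i e)))"
proof -
  let ?K = "nodes P" and ?c = "\<lambda>N i. fst (l N i)"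
  define ws where "ws N i = well_shaped P N (?c N i)" for N i
  \<comment> \<open>An absent field is read from a circuit without outputs, so that the definition
    is total; \<open>well_shaped\<close> excludes this case wherever the value is used.\<close>
  define fld where "fld a N i e =
    run (if a < length (?c N i) then ?c N i ! a else \<lparr>gates = [], outputs = []\<rparr>) (v N i e)" for a N i e
  define key where "key N i e = req_key P N (?c N i) (v N i e)" for N i e
  define nonce where "nonce N i e = req_nonce P N (?c N i) (v N i e)" for N i e
  define name where "name N i e = req_name P N (?c N i) (v N i e)" for N i e
  define y where "y N i e = lookup (nonce N i e) (tab N i e) (zF N i e, zT N i e)" for N i e
  define dup where "dup N i e = replayed (key N i e) (nonce N i e) (tab N i e)" for N i e
  define z where "z N i e = (if name N i e then snd (y N i e) else fst (y N i e))" for N i e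
  define kn where "kn N i e = key_bits ?K (key N i e) @ nonce N i e" for N i e
  note poly = poly_onI[OF well_formed_poly(1)[OF wf]]
    poly_onI[OF well_formed_poly(5)[OF wf]]
    poly_onI[OF well_formed_poly(9)[OF wf]]
    poly_onI[OF well_formed_poly(11)[OF wf]]
    poly_onI[OF well_formed_poly(12)[OF wf]]
    poly_onI[OF well_formed_poly(13)[OF wf]]
  have fl: "fixed_length (D N i) (g N i)" for N i using gg by (rule ppoly_fixed_length)
  have ff: "ppoly D g (\<lambda>N i e. [False])"
    using gg by (rule ppoly_literal)
  have fld: "ppoly D g (fld a)" for a
    unfolding fld_def by (rule ppoly_field[OF v cs])
  have nonce: "ppoly D g nonce"
    unfolding nonce_def by (rule ppoly_req_nonce[OF wf v cs])
  have len_nonce: "length (nonce N i e) = nonce_len P N" for N i e by (simp add: nonce_def)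
  have name: "ppoly D g (\<lambda>N i e. [name N i e])"
    using ppoly_static_if[OF ppoly_eq_const[OF fld[of 1] gg, of "\<lambda>_ _. [True]"] ff, of ws]
    by (rule ppoly_cong) (auto simp: name_def req_name_def ws_def fld_def well_shaped_def)
  have key: "ppoly D g (\<lambda>N i e. [key N i e = Some a])" if "a < ?K" for a
    using ppoly_static_if[OF ppoly_and[OF ppoly_eq_const[OF fld[of 0] gg, of "\<lambda>_ _. [False]"]
          ppoly_nat_eq_const[OF fld[of 2] gg, of a]] ff, of ws]
    by (rule ppoly_cong) (use that in \<open>auto simp: key_def req_key_def ws_def fld_def well_shaped_def\<close>)
  have kbits: "ppoly D g (\<lambda>N i e. key_bits ?K (key N i e))"
    unfolding key_bits_def by (intro ppoly_map_upt key gg)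
  have kn: "ppoly D g kn" unfolding kn_def by (intro ppoly_append kbits nonce)
  have key_less: "key N i e = Some a \<Longrightarrow> a < ?K" for N i e a
    by (simp add: key_def req_key_less)
  \<comment> \<open>Entries are counted from the end of the table. Scanning backwards lets the
    accumulator hold the result for a suffix, in accordance with the recursion of
    \<open>lookup\<close>.\<close>
  define ent where "ent N j e = encode_entry ?K (tab N (fst j) e ! (n N (fst j) - Suc (snd j)))"
    for N and j :: "'i \<times> nat" and e
  let ?D = "indexed n D"
  have ent: "ppoly ?D G ent"
    if G: "\<And>f. ppoly D g f \<Longrightarrow> ppoly ?D G (\<lambda>N j. f N (fst j))" for G
  proof -
    have "ppoly ?D G (\<lambda>N j e. map (encode_entry ?K) (tab N (fst j) e) ! (n N (fst j) - Suc (snd j)))"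
      by (rule ppoly_concat_nth[OF G[OF tab], where L = "\<lambda>N _. ?K + nonce_len P N + 2 * sample_len P N"])
        (use ok in \<open>auto simp: n length_encode_entry\<close>)
    then show ?thesis by (rule ppoly_cong) (simp add: ent_def n)
  qed
  have ent_nth: "entry_ok P N (tab N (fst j) e ! (n N (fst j) - Suc (snd j)))"
    "length (ent N j e) = ?K + nonce_len P N + 2 * sample_len P N"
    "drop (n N (fst j) - Suc (snd j)) (tab N (fst j) e) =
       tab N (fst j) e ! (n N (fst j) - Suc (snd j)) # drop (n N (fst j) - snd j) (tab N (fst j) e)"
    if "e \<in> ?D N j" for N j e
  proof -
    show 1: "entry_ok P N (tab N (fst j) e ! (n N (fst j) - Suc (snd j)))"
      using that ok[of e N "fst j"] n(1)[of e N "fst j"] by auto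
    show "length (ent N j e) = ?K + nonce_len P N + 2 * sample_len P N"
      using 1 by (simp add: ent_def length_encode_entry)
    show "drop (n N (fst j) - Suc (snd j)) (tab N (fst j) e) =
       tab N (fst j) e ! (n N (fst j) - Suc (snd j)) # drop (n N (fst j) - snd j) (tab N (fst j) e)"
      using that n(1)[of e N "fst j"]
      by (metis Cons_nth_drop_Suc Suc_diff_Suc diff_Suc_less less_nat_zero_code mem_indexed neq0_conv)
  qed
  have dup: "ppoly D g (\<lambda>N i e. [dup N i e])"
  proof -
    define acc where "acc N i k e = [replayed (key N i e) (nonce N i e) (drop (n N i - k) (tab N i e))]"
      for N i k e
    have "ppoly D g (\<lambda>N i. acc N i (n N i))"
    proof (rule ppoly_loop)
      fix G assume GG: "ppoly ?D G G" and G: "\<And>f. ppoly D g f \<Longrightarrow> ppoly ?D G (\<lambda>N j. f N (fst j))"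
        and a: "ppoly ?D G (\<lambda>N j. acc N (fst j) (snd j))"
      \<comment> \<open>An encoded entry begins with the key bits and the nonce, so both are
        compared at once.\<close>
      have "ppoly ?D G (\<lambda>N j e. [take (?K + nonce_len P N) (ent N j e) = kn N (fst j) e])"
        by (intro ppoly_eq ppoly_take ent G kn GG) (simp_all add: ent_nth kn_def len_nonce)
      from ppoly_or[OF this a[unfolded acc_def]]
      show "ppoly ?D G (\<lambda>N j. acc N (fst j) (Suc (snd j)))"
      proof (rule ppoly_cong)
        fix N j e assume e: "e \<in> ?D N j"
        let ?x = "tab N (fst j) e ! (n N (fst j) - Suc (snd j))"
        have "take (?K + nonce_len P N) (ent N j e) = key_bits ?K (fst ?x) @ fst (snd ?x)"
          using ent_nth(1)[OF e] by (simp add: ent_def encode_entry_def entry_ok_def)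
        then have "take (?K + nonce_len P N) (ent N j e) = kn N (fst j) e \<longleftrightarrow>
          fst ?x = key N (fst j) e \<and> fst (snd ?x) = nonce N (fst j) e"
          using ent_nth(1)[OF e] key_less by (simp add: kn_def key_bits_inject entry_ok_def)
        then show "[take (?K + nonce_len P N) (ent N j e) = kn N (fst j) e \<or>
           replayed (key N (fst j) e) (nonce N (fst j) e) (drop (n N (fst j) - snd j) (tab N (fst j) e))]
           = acc N (fst j) (Suc (snd j)) e"
          by (simp add: acc_def ent_nth(3)[OF e] replayed_def)
      qed
    next
      show "ppoly D g (\<lambda>N i. acc N i 0)"
        by (rule ppoly_cong[OF ff]) (simp add: acc_def n replayed_def)
    qed (auto simp: acc_def n gg poly_on_const)
    then show ?thesis by (rule ppoly_cong) (simp add: acc_def dup_def)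
  qed
  have len_lookup: "length (fst (lookup w (drop k (tab N i e)) (zF N i e, zT N i e))) = sample_len P N"
    "length (snd (lookup w (drop k (tab N i e)) (zF N i e, zT N i e))) = sample_len P N"
    if "e \<in> D N i" for w k N i e
    using ok[OF that] zF(2)[OF that] zT(2)[OF that] by (auto intro!: lookup_length dest: in_set_dropD)
  have y: "ppoly D g (\<lambda>N i e. fst (y N i e) @ snd (y N i e))"
  proof -
    define acc where "acc N i k e = (let w = lookup (nonce N i e) (drop (n N i - k) (tab N i e))
      (zF N i e, zT N i e) in fst w @ snd w)" for N i k e
    have "ppoly D g (\<lambda>N i. acc N i (n N i))"
    proof (rule ppoly_loop)
      fix G assume GG: "ppoly ?D G G" and G: "\<And>f. ppoly D g f \<Longrightarrow> ppoly ?D G (\<lambda>N j. f N (fst j))"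
        and a: "ppoly ?D G (\<lambda>N j. acc N (fst j) (snd j))"
      \<comment> \<open>The key bits are skipped, because the strings do not depend on the
        node.\<close>
      have "ppoly ?D G (\<lambda>N j e. [take (nonce_len P N) (drop ?K (ent N j e)) = nonce N (fst j) e])"
        by (intro ppoly_eq ppoly_take ppoly_drop ent G nonce GG) (simp_all add: ent_nth len_nonce)
      then show "ppoly ?D G (\<lambda>N j. acc N (fst j) (Suc (snd j)))"
      proof (rule ppoly_if_cong)
        show "ppoly ?D G (\<lambda>N j e. drop (?K + nonce_len P N) (ent N j e))"
          by (intro ppoly_drop ent G)
        show "ppoly ?D G (\<lambda>N j. acc N (fst j) (snd j))" by (rule a)
        fix N j e assume e: "e \<in> ?D N j"
        then show "(if take (nonce_len P N) (drop ?K (ent N j e)) = nonce N (fst j) e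
            then drop (?K + nonce_len P N) (ent N j e) else acc N (fst j) (snd j) e)
            = acc N (fst j) (Suc (snd j)) e"
          using ent_nth(1)[OF e]
          by (simp add: acc_def ent_nth(3)[OF e] ent_def encode_entry_def entry_ok_def Let_def len_nonce)
        show "length (drop (?K + nonce_len P N) (ent N j e)) = length (acc N (fst j) (snd j) e)"
          using e by (simp add: ent_nth(2)[OF e] acc_def Let_def len_lookup)
      qed
    next
      show "ppoly D g (\<lambda>N i. acc N i 0)"
        by (rule ppoly_cong[OF ppoly_append[OF zF(1) zT(1)]]) (simp add: acc_def n Let_def)
    next
      show "length (acc N i k e) = 2 * sample_len P N" if "e \<in> D N i" for N i k e
        using that by (simp add: acc_def Let_def len_lookup)
    qed (auto simp: n gg intro!: poly_on_mult poly_on_const poly_on_sample_len wf)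
    then show ?thesis by (rule ppoly_cong) (simp add: acc_def y_def Let_def)
  qed
  have len_y: "length (fst (y N i e)) = sample_len P N" "length (snd (y N i e)) = sample_len P N"
    if "e \<in> D N i" for N i e
    using len_lookup[OF that, of _ 0] by (simp_all add: y_def)
  have z: "ppoly D g z"
    by (rule ppoly_if_cong[OF name ppoly_drop[OF y, of "\<lambda>N _. sample_len P N"]
          ppoly_take[OF y, of "\<lambda>N _. sample_len P N"]]) (auto simp: z_def len_y)
  have len_z: "length (z N i e) = sample_len P N" if "e \<in> D N i" for N i e
    using len_y[OF that] by (simp add: z_def)
  \<comment> \<open>The signing key is hard-wired, which gives each node its own circuit;
    \<open>ppoly_cases\<close> selects among the resulting answers.\<close>
  have sig: "ppoly D g (\<lambda>N i e. sign P N (sks N ! a) (nonce N i e @ z N i e) (snd (l N i)))"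
    if a: "a < ?K" for a
  proof -
    have "ppoly D g (\<lambda>N i e. (\<lambda>N xs. sign P N (xs ! 0) (xs ! 1) (xs ! 2)) N
        [sks N ! a, nonce N i e @ z N i e, snd (l N i)])"
    proof (rule ppoly_efficient)
      show "efficient (\<lambda>N. {[sk, m, r] |sk m r. length sk = sk_len P N \<and> length r = sig_rand_len P N})
       (\<lambda>N xs. sign P N (xs ! 0) (xs ! 1) (xs ! 2))"
        using eff by (simp add: efficient_algorithms_def)
      have "poly_on D (\<lambda>N i. length (snd (l N i)))"
        using poly(5) by (rule poly_on_mono) (simp add: \<rho>)
      then show "ppoly D g (\<lambda>N i e. concat [sks N ! a, nonce N i e @ z N i e, snd (l N i)])"
        unfolding concat.simps append_Nil2
        by (intro ppoly_append ppoly_const fl nonce z) (simp_all add: sks a poly)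
      show "[sks N ! a, nonce N i e @ z N i e, snd (l N i)] \<in>
          {[sk, m, r] |sk m r. length sk = sk_len P N \<and> length r = sig_rand_len P N}"
        if "e \<in> D N i" for N i e
        using that \<rho>[of N i] sks a by auto
      show "map length [sks N ! a, nonce N i e @ z N i e, snd (l N i)] =
          [sk_len P N, nonce_len P N + sample_len P N, sig_rand_len P N]"
        if "e \<in> D N i" for N i e
        using that \<rho>[of N i] sks a by (auto simp: len_nonce len_z)
    qed
    then show ?thesis by simp
  qed
  define ans where "ans N i e = sim_answer P N (sks N) (key N i e) (nonce N i e) (dup N i e) (z N i e) (snd (l N i))"
    for N i e
  let ?ans = "\<lambda>k b N i e. sim_answer P N (sks N) k (nonce N i e) b (z N i e) (snd (l N i))"
  have len_ans: "length (?ans (key N i e) b N i e) = answer_len P N"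
    "a < ?K \<Longrightarrow> length (?ans (Some a) b N i e) = answer_len P N"
    "length (?ans None b N i e) = answer_len P N"
    if "e \<in> D N i" for N i e a b
    by (rule length_sim_answer[OF wf sks]; use that \<rho>[of N i] len_nonce len_z key_less in auto)+
  have no: "ppoly D g (\<lambda>N i e. ?ans None b N i e)" for b
    unfolding sim_answer_def encode_answer_def option.case
    by (intro ppoly_const fl)
      (auto intro!: poly_on_Suc poly_on_add poly)
  have yes: "ppoly D g (\<lambda>N i e. ?ans (Some a) False N i e)"
    if "a < ?K" for a
    using ppoly_append[OF ppoly_literal[OF gg, of "[True]"] ppoly_append[OF nonce ppoly_append[OF z sig[OF that]]]]
    by (simp add: sim_answer_def encode_answer_def poly_on_const)
  have "ppoly D g (\<lambda>N i e. ?ans (key N i e) False N i e)"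
    by (rule ppoly_cong[OF ppoly_cases[OF key yes no]])
      (auto simp: len_ans dest: key_less split: option.split)
  \<comment> \<open>A replay is answered exactly like a request with key
    \<open>None\<close>.\<close>
  from dup no this have ans: "ppoly D g ans"
    by (rule ppoly_if_cong[where x = "\<lambda>N i e. ?ans None False N i e"])
      (simp_all only: len_ans, auto simp: ans_def sim_answer_def split: option.split)
  have "ppoly D g (\<lambda>N i e. (v N i e @ ans N i e) @ (key_bits ?K (key N i e) @ nonce N i e @
     (fst (y N i e) @ snd (y N i e))) @ concat (map (encode_entry ?K) (tab N i e)))"
    by (intro ppoly_append v ans kbits nonce y tab)
  then show ?thesis
    by (rule ppoly_cong)
      (simp add: encode_sim_def sim_step_def Let_def encode_entry_def key_def[symmetric]
        nonce_def[symmetric] name_def[symmetric] y_def[symmetric] dup_def[symmetric]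
        z_def ans_def)
qed


text \<open>Round \<open>r\<close> owns the samples \<open>2 * r\<close> for
  \<open>name False\<close> and \<open>2 * r + 1\<close> for \<open>name True\<close>.\<close>

definition sim_fold ::
  "system \<Rightarrow> nat \<Rightarrow> bits list \<Rightarrow> (circuit list \<times> bits) list \<Rightarrow> (nat \<Rightarrow> bits) \<Rightarrow> nat list \<Rightarrow>
   bits \<times> entry list \<Rightarrow> bits \<times> entry list" where
  "sim_fold P N sks ls Z = fold (\<lambda>r. sim_step P N sks (ls ! r) (Z (2 * r), Z (2 * r + 1)))"

lemma sim_fold_ok:
  assumes "well_formed P" "\<forall>a<nodes P. length (sks ! a) = sk_len P N"
    and "\<And>r. r < k \<Longrightarrow> length (snd (ls ! r)) = sig_rand_len P N"
    and "\<And>t. t < 2 * k \<Longrightarrow> length (Z t) = sample_len P N"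
  shows "length (fst (sim_fold P N sks ls Z [0..<k] (v, []))) = length v + k * answer_len P N \<and>
    length (snd (sim_fold P N sks ls Z [0..<k] (v, []))) = k \<and>
    (\<forall>e\<in>set (snd (sim_fold P N sks ls Z [0..<k] (v, []))). entry_ok P N e)"
  using assms(3,4)
proof (induction k)
  case 0
  then show ?case by (simp add: sim_fold_def)
next
  case (Suc k)
  let ?s = "sim_fold P N sks ls Z [0..<k] (v, [])"
  have IH: "length (fst ?s) = length v + k * answer_len P N" "length (snd ?s) = k"
    "\<forall>e\<in>set (snd ?s). entry_ok P N e"
    using Suc by auto
  have "sim_fold P N sks ls Z [0..<Suc k] (v, [])
      = sim_step P N sks (ls ! k) (Z (2 * k), Z (2 * k + 1)) ?s"
    by (simp add: sim_fold_def)
  then show ?case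
    using sim_step_ok[OF assms(1,2) _ IH(3), of "ls ! k" "(Z (2 * k), Z (2 * k + 1))"] IH Suc.prems
    by simp
qed

text \<open>An index is a pair of a number of rounds and a number of samples.\<close>

definition sim_env :: "system \<Rightarrow> (nat \<Rightarrow> nat) \<Rightarrow> nat \<Rightarrow> nat \<times> nat \<Rightarrow> (bits \<times> bits list) set" where
  "sim_env P R N i = {(pki, zs). length pki = pki_len P N \<and> length zs = snd i \<and>
     (\<forall>z\<in>set zs. length z = sample_len P N) \<and> fst i \<le> R N \<and> 2 * fst i \<le> snd i \<and> snd i \<le> 2 * R N}"

lemma length_concat_const: "(\<forall>x\<in>set xs. length x = l) \<Longrightarrow> length (concat xs) = length xs * l"
  by (induction xs) auto

text \<open>\<open>ls\<close> lists the circuits of each round with the coins of the signature in its answer; the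
  initial view is the network directory followed by \<open>w\<close>.\<close>

locale simulation =
  fixes P :: system and sks :: "nat \<Rightarrow> bits list" and ls :: "nat \<Rightarrow> (circuit list \<times> bits) list"
    and R :: "nat \<Rightarrow> nat" and w :: "nat \<Rightarrow> bits"
  assumes wf: "well_formed P" and eff: "efficient_algorithms P"
    and sks: "\<And>N. \<forall>a<nodes P. length (sks N ! a) = sk_len P N"
    and ls: "\<And>N. length (ls N) = R N" "\<And>N. \<forall>l\<in>set (ls N). length (snd l) = sig_rand_len P N"
    and R: "poly_bounded R"
    and cs: "poly_bounded (\<lambda>N. \<Sum>l\<leftarrow>ls N. \<Sum>C\<leftarrow>fst l. circuit_size C)"
    and w: "poly_bounded (\<lambda>N. length (w N))"
begin

lemma circuits_of_round:
  assumes "r < R N"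
  shows "(\<Sum>C\<leftarrow>fst (ls N ! r). circuit_size C) \<le> (\<Sum>l\<leftarrow>ls N. \<Sum>C\<leftarrow>fst l. circuit_size C)"
  using assms ls(1)[of N] by (intro member_le_sum_list) auto

text \<open>Directory and samples are the only inputs; keys, request circuits, signature coins and
  \<open>w\<close> are constants. The number of rounds is an index because the KDF adversary needs
  the view after every round, and surplus samples are allowed because at its second query of a round
  it holds one more seed than the simulated rounds consume.\<close>

lemma ppoly_sim_fold:
  "ppoly (sim_env P R) (\<lambda>N i e. fst e @ concat (snd e))
    (\<lambda>N i e. fst (sim_fold P N (sks N) (ls N) (\<lambda>t. snd e ! t) [0..<fst i] (fst e @ w N, [])))"
proof -
  let ?E = "sim_env P R" and ?g = "\<lambda>N (i :: nat \<times> nat) (e :: bits \<times> bits list). fst e @ concat (snd e)"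
  let ?n = "\<lambda>(N :: nat) (i :: nat \<times> nat). fst i"
  define st where "st N k e = sim_fold P N (sks N) (ls N) (\<lambda>t. snd e ! t) [0..<k] (fst e @ w N, [])"
    for N k and e :: "bits \<times> bits list"
  have st: "length (fst (st N k e)) = pki_len P N + length (w N) + k * answer_len P N"
    "length (snd (st N k e)) = k" "\<forall>x\<in>set (snd (st N k e)). entry_ok P N x"
    if "e \<in> ?E N i" "k \<le> fst i" for N i k e
    using sim_fold_ok[OF wf sks, of k "ls N" N "\<lambda>t. snd e ! t" "fst e @ w N"] that ls[of N]
    by (auto simp: sim_env_def st_def)
  define lv where "lv N k = pki_len P N + length (w N) + k * answer_len P N" for N k
  define lt where "lt N k = k * (nodes P + nonce_len P N + 2 * sample_len P N)" for N and k :: nat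
  have n: "poly_on ?E ?n"
    using poly_onI[OF R] by (rule poly_on_mono) (auto simp: sim_env_def)
  have k: "poly_on (indexed ?n ?E) (\<lambda>N j. snd j)"
    using poly_onI[OF R] by (rule poly_on_mono) (auto simp: sim_env_def indexed_def split: if_splits)
  note nl = poly_onI[OF well_formed_poly(5)[OF wf]]
  note pl = poly_onI[OF well_formed_poly(4)[OF wf]]
  have lv: "poly_on (indexed ?n ?E) (\<lambda>N j. lv N (snd j))"
    unfolding lv_def by (intro poly_on_add poly_on_mult pl poly_onI[OF w] k poly_on_answer_len wf)
  have lt: "poly_on (indexed ?n ?E) (\<lambda>N j. lt N (snd j))"
    unfolding lt_def by (intro poly_on_add poly_on_mult nl k poly_on_const poly_on_sample_len wf)
  have gl: "length (?g N i e) = pki_len P N + snd i * sample_len P N" if "e \<in> ?E N i" for N i e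
    using that length_concat_const[of "snd e"] by (auto simp: sim_env_def)
  have m: "poly_on ?E (\<lambda>N i. snd i)"
    using poly_on_mult[OF poly_on_const[of ?E 2] poly_onI[OF R]]
    by (rule poly_on_mono) (auto simp: sim_env_def)
  have gg: "ppoly ?E ?g ?g"
    by (rule ppoly_id[OF gl]) (auto intro!: poly_on_add poly_on_mult pl m poly_on_sample_len wf)
  have zs: "ppoly ?E ?g (\<lambda>N i e. concat (snd e))"
    by (rule ppoly_appendD2[OF gg]) (auto simp: sim_env_def fixed_length_def)
  have pki: "ppoly ?E ?g (\<lambda>N i e. fst e)"
    by (rule ppoly_appendD1[OF gg]) (auto simp: sim_env_def fixed_length_def)
  define acc where "acc N (i :: nat \<times> nat) k e = encode_sim (nodes P) (st N k e)" for N i k e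
  have len_tab: "length (concat (map (encode_entry (nodes P)) (snd (st N k e)))) = lt N k"
    if "e \<in> ?E N i" "k \<le> fst i" for N i k e
    using st(2,3)[OF that] length_concat_const[of "map (encode_entry (nodes P)) (snd (st N k e))"]
    by (simp add: lt_def length_encode_entry)
  have "ppoly ?E ?g (\<lambda>N i. acc N i (?n N i))"
  proof (rule ppoly_loop)
    let ?D = "indexed ?n ?E"
    fix G assume GG: "ppoly ?D G G" and G: "\<And>f. ppoly ?E ?g f \<Longrightarrow> ppoly ?D G (\<lambda>N j. f N (fst j))"
      and a: "ppoly ?D G (\<lambda>N j. acc N (fst j) (snd j))"
    have a': "ppoly ?D G (\<lambda>N j e. fst (st N (snd j) e) @
        concat (map (encode_entry (nodes P)) (snd (st N (snd j) e))))"
      using a by (rule ppoly_cong) (simp add: acc_def encode_sim_def)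
    have fl: "fixed_length (?D N j) (\<lambda>e. fst (st N (snd j) e))" for N j
      by (rule fixed_lengthI) (auto simp: st)
    have v: "ppoly ?D G (\<lambda>N j e. fst (st N (snd j) e))"
      using a' fl by (rule ppoly_appendD1)
    have tab: "ppoly ?D G (\<lambda>N j e. concat (map (encode_entry (nodes P)) (snd (st N (snd j) e))))"
      using a' fl by (rule ppoly_appendD2)
    have z: "ppoly ?D G (\<lambda>N j e. snd e ! (2 * snd j))" "ppoly ?D G (\<lambda>N j e. snd e ! (2 * snd j + 1))"
      by (rule ppoly_concat_nth[OF G[OF zs]]; auto simp: sim_env_def)+
    have "ppoly ?D G (\<lambda>N j e. encode_sim (nodes P) (sim_step P N (sks N) (ls N ! snd j)
      (snd e ! (2 * snd j), snd e ! (2 * snd j + 1)) (fst (st N (snd j) e), snd (st N (snd j) e))))"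
    proof (rule ppoly_sim_step[OF wf eff sks _ _ GG v tab _ k _ z(1) _ z(2)])
      show "length (snd (ls N ! snd j)) = sig_rand_len P N" if "?D N j \<noteq> {}" for N j
        using that ls[of N] by (auto simp: indexed_def sim_env_def split: if_splits)
      show "poly_on ?D (\<lambda>N j. \<Sum>C\<leftarrow>fst (ls N ! snd j). circuit_size C)"
        using poly_onI[OF cs]
        by (rule poly_on_mono)
          (auto simp: indexed_def sim_env_def split: if_splits intro!: circuits_of_round)
      show "length (snd (st N (snd j) e)) = snd j"
        "\<forall>x\<in>set (snd (st N (snd j) e)). entry_ok P N x" if "e \<in> ?D N j" for N j e
        using st(2,3)[of e N "fst j" "snd j"] that by simp_all
    qed (auto simp: sim_env_def)
    then show "ppoly ?D G (\<lambda>N j. acc N (fst j) (Suc (snd j)))"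
      by (rule ppoly_cong) (simp add: acc_def st_def sim_fold_def)
  next
    have "ppoly ?E ?g (\<lambda>N i e. fst e @ w N)"
      by (intro ppoly_append pki ppoly_const ppoly_fixed_length[OF gg] poly_onI w)
    then show "ppoly ?E ?g (\<lambda>N i. acc N i 0)"
      by (rule ppoly_cong) (simp add: acc_def st_def sim_fold_def encode_sim_def)
  next
    show "length (acc N i k e) = lv N k + lt N k" if "e \<in> ?E N i" "k < ?n N i" for N i k e
      using that by (simp add: acc_def encode_sim_def len_tab st lv_def)
  qed (auto intro!: poly_on_add n gg lv lt)
  then have "ppoly ?E ?g (\<lambda>N i e. fst (st N (fst i) e) @ concat (map (encode_entry (nodes P)) (snd (st N (fst i) e))))"
    by (rule ppoly_cong) (simp add: acc_def encode_sim_def)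
  then have "ppoly ?E ?g (\<lambda>N i e. fst (st N (fst i) e))"
    by (rule ppoly_appendD1) (rule fixed_lengthI, auto simp: st)
  then show ?thesis by (simp add: st_def)
qed

end

section \<open>The samples\<close>

text \<open>Takes the expanded randomness, not the seed, so that the hybrid with truly random coins
  is an instance too.\<close>

definition sample_of :: "system \<Rightarrow> nat \<Rightarrow> bits \<Rightarrow> contact \<Rightarrow> bits \<Rightarrow> bits" where
  "sample_of P N pki d rnd = mk_surb P N pki d (take (surb_rand_len P N) rnd) @
     pubkey d [^]\<^bsub>grp P N\<^esub> draw P N (drop (surb_rand_len P N) rnd)"

definition sample :: "system \<Rightarrow> nat \<Rightarrow> bits \<Rightarrow> contact \<Rightarrow> bits \<Rightarrow> bits" where
  "sample P N pki d s = sample_of P N pki d (prg P N s)"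

lemma public_keys_carrier:
  assumes "well_formed P" "h \<in> public_keys P N"
  shows "h \<in> carrier (grp P N)"
proof -
  have "carrier (grp P N) = {gen P N [^]\<^bsub>grp P N\<^esub> x |x::nat. x < Coset.order (grp P N)}"
    using assms(1) by (simp add: well_formed_def)
  then show ?thesis using assms(2) by (auto simp: public_keys_def)
qed

lemma pow_carrier:
  assumes "well_formed P" "h \<in> carrier (grp P N)"
  shows "h [^]\<^bsub>grp P N\<^esub> (y::nat) \<in> carrier (grp P N)" "length (h [^]\<^bsub>grp P N\<^esub> y) = grp_len P N"
proof -
  have "group (grp P N)" using assms(1) by (simp add: well_formed_def)
  then show 1: "h [^]\<^bsub>grp P N\<^esub> y \<in> carrier (grp P N)"
    using assms(2) by (simp add: group.is_monoid monoid.nat_pow_closed)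
  then show "length (h [^]\<^bsub>grp P N\<^esub> y) = grp_len P N"
    using assms(1) by (simp add: well_formed_def)
qed

lemma valid_contactD:
  assumes "well_formed P" "valid_contact P N d"
  shows "pubkey d \<in> carrier (grp P N)" "length (address d) = addr_len P N" "length (pubkey d) = grp_len P N"
proof -
  show "pubkey d \<in> carrier (grp P N)" "length (address d) = addr_len P N"
    using assms public_keys_carrier by (auto simp: valid_contact_def)
  then show "length (pubkey d) = grp_len P N" using assms(1) by (simp add: well_formed_def)
qed

lemma length_sample_of:
  assumes "well_formed P" "valid_contact P N d" "pki \<in> set_pmf (pki_gen P N)"
    "length rnd = surb_rand_len P N + draw_rand_len P N"
  shows "length (sample_of P N pki d rnd) = sample_len P N"
  using assms pow_carrier[OF assms(1) valid_contactD(1)[OF assms(1,2)]]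
  by (simp add: sample_of_def sample_len_def well_formed_def)

lemma length_sample:
  assumes "well_formed P" "valid_contact P N d" "pki \<in> set_pmf (pki_gen P N)" "length s = seed_len P N"
  shows "length (sample P N pki d s) = sample_len P N"
  unfolding sample_def using assms by (intro length_sample_of) (simp_all add: well_formed_def)

lemma ppoly_pow:
  assumes wf: "well_formed P" and eff: "efficient_algorithms P"
    and d: "\<And>N i. D N i \<noteq> {} \<Longrightarrow> valid_contact P N (d N i)"
    and r: "ppoly D g r" "\<And>N i e. e \<in> D N i \<Longrightarrow> length (r N i e) = draw_rand_len P N"
  shows "ppoly D g (\<lambda>N i e. pubkey (d N i) [^]\<^bsub>grp P N\<^esub> draw P N (r N i e))"
proof -
  have fl: "fixed_length (D N i) (g N i)" for N i using r(1) by (rule ppoly_fixed_length_base)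
  have 1: "ppoly D g (\<lambda>N i e. bits_of_nat (exp_len P N) (draw P N (r N i e)))"
    using ppoly_efficient[of "\<lambda>N. {[w] |w. length w = draw_rand_len P N}"
        "\<lambda>N xs. bits_of_nat (exp_len P N) (draw P N (xs ! 0))" D g "\<lambda>N i e. [r N i e]"
        "\<lambda>N i. [draw_rand_len P N]"] eff r
    by (simp add: efficient_algorithms_def)
  have pk: "poly_on D (\<lambda>N i. length (pubkey (d N i)))"
    using poly_onI[OF well_formed_poly(1)[OF wf]]
    by (rule poly_on_mono) (simp add: valid_contactD[OF wf d])
  have "ppoly D g (\<lambda>N i e. (\<lambda>N xs. xs ! 0 [^]\<^bsub>grp P N\<^esub> nat_of_bits (xs ! 1)) N
      [pubkey (d N i), bits_of_nat (exp_len P N) (draw P N (r N i e))])"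
  proof (rule ppoly_efficient)
    show "efficient (\<lambda>N. {[h, e] |h e. h \<in> carrier (grp P N)})
       (\<lambda>N xs. xs ! 0 [^]\<^bsub>grp P N\<^esub> nat_of_bits (xs ! 1))"
      using eff by (simp add: efficient_algorithms_def)
    show "ppoly D g (\<lambda>N i e. concat [pubkey (d N i), bits_of_nat (exp_len P N) (draw P N (r N i e))])"
      unfolding concat.simps append_Nil2 by (intro ppoly_append ppoly_const fl pk 1)
    show "[pubkey (d N i), bits_of_nat (exp_len P N) (draw P N (r N i e))] \<in> {[h, e] |h e. h \<in> carrier (grp P N)}"
      if "e \<in> D N i" for N i e
      using valid_contactD[OF wf d, of N i] that by blast
    show "map length [pubkey (d N i), bits_of_nat (exp_len P N) (draw P N (r N i e))] = [grp_len P N, exp_len P N]"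
      if "e \<in> D N i" for N i e
      using valid_contactD(3)[OF wf d, of N i] that by (auto simp: bits_of_nat_def)
  qed
  then show ?thesis
  proof (rule ppoly_cong)
    fix N i e assume e: "e \<in> D N i"
    \<comment> \<open>The exponent reaches the group operation as a bit string; being below the
      group order, it fits into \<open>exp_len\<close> bits.\<close>
    have "draw P N (r N i e) < Coset.order (grp P N)" "Coset.order (grp P N) \<le> 2 ^ exp_len P N"
      using wf r(2)[OF e] by (simp_all add: well_formed_def)
    then have "nat_of_bits (bits_of_nat (exp_len P N) (draw P N (r N i e))) = draw P N (r N i e)"
      by (intro nat_of_bits_of_nat) simp
    then show "(\<lambda>N xs. xs ! 0 [^]\<^bsub>grp P N\<^esub> nat_of_bits (xs ! 1)) N
      [pubkey (d N i), bits_of_nat (exp_len P N) (draw P N (r N i e))] =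
      pubkey (d N i) [^]\<^bsub>grp P N\<^esub> draw P N (r N i e)" by simp
  qed
qed

text \<open>The contact is a constant, whereas the directory is read from the environment, since it
  can be a random part of the challenge.\<close>

lemma ppoly_mk_surb:
  assumes wf: "well_formed P" and eff: "efficient_algorithms P"
    and d: "\<And>N i. D N i \<noteq> {} \<Longrightarrow> valid_contact P N (d N i)"
    and p: "ppoly D g p" "\<And>N i e. e \<in> D N i \<Longrightarrow> p N i e \<in> set_pmf (pki_gen P N)"
    and r: "ppoly D g r" "\<And>N i e. e \<in> D N i \<Longrightarrow> length (r N i e) = surb_rand_len P N"
  shows "ppoly D g (\<lambda>N i e. mk_surb P N (p N i e) (d N i) (r N i e))"
proof -
  have fl: "fixed_length (D N i) (g N i)" for N i using r(1) by (rule ppoly_fixed_length_base)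
  have pk: "poly_on D (\<lambda>N i. length (pubkey (d N i)))"
    using poly_onI[OF well_formed_poly(1)[OF wf]]
    by (rule poly_on_mono) (simp add: valid_contactD[OF wf d])
  have ad: "poly_on D (\<lambda>N i. length (address (d N i)))"
    using poly_onI[OF well_formed_poly(3)[OF wf]]
    by (rule poly_on_mono) (simp add: valid_contactD[OF wf d])
  have "ppoly D g (\<lambda>N i e. (\<lambda>N xs. mk_surb P N (xs ! 0) \<lparr>pubkey = xs ! 1, address = xs ! 2\<rparr> (xs ! 3)) N
      [p N i e, pubkey (d N i), address (d N i), r N i e])"
  proof (rule ppoly_efficient)
    show "efficient (\<lambda>N. {[pki, pubkey d, address d, r] |pki d r. pki \<in> set_pmf (pki_gen P N) \<and>
                       valid_contact P N d \<and> length r = surb_rand_len P N})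
       (\<lambda>N xs. mk_surb P N (xs ! 0) \<lparr>pubkey = xs ! 1, address = xs ! 2\<rparr> (xs ! 3))"
      using eff by (simp add: efficient_algorithms_def)
    show "ppoly D g (\<lambda>N i e. concat [p N i e, pubkey (d N i), address (d N i), r N i e])"
      unfolding concat.simps append_Nil2 by (intro ppoly_append ppoly_const fl pk ad p r)
    show "[p N i e, pubkey (d N i), address (d N i), r N i e] \<in>
        {[pki, pubkey d, address d, r] |pki d r. pki \<in> set_pmf (pki_gen P N) \<and>
                       valid_contact P N d \<and> length r = surb_rand_len P N}"
      if "e \<in> D N i" for N i e
      using d[of N i] p(2)[OF that] r(2)[OF that] that by blast
    show "map length [p N i e, pubkey (d N i), address (d N i), r N i e] =
        [pki_len P N, grp_len P N, addr_len P N, surb_rand_len P N]"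
      if "e \<in> D N i" for N i e
    proof -
      have "D N i \<noteq> {}" using that by blast
      moreover have "length (p N i e) = pki_len P N" using wf p(2)[OF that] by (simp add: well_formed_def)
      ultimately show ?thesis using valid_contactD[OF wf d, of N i] r(2)[OF that] by simp
    qed
  qed
  moreover have "\<lparr>pubkey = pubkey x, address = address x\<rparr> = x" for x :: contact by (cases x) simp
  ultimately show ?thesis by simp
qed

lemma ppoly_sample_of:
  assumes wf: "well_formed P" and eff: "efficient_algorithms P"
    and d: "\<And>N i. D N i \<noteq> {} \<Longrightarrow> valid_contact P N (d N i)"
    and p: "ppoly D g p" "\<And>N i e. e \<in> D N i \<Longrightarrow> p N i e \<in> set_pmf (pki_gen P N)"
    and r: "ppoly D g r" "\<And>N i e. e \<in> D N i \<Longrightarrow> length (r N i e) = surb_rand_len P N + draw_rand_len P N"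
  shows "ppoly D g (\<lambda>N i e. sample_of P N (p N i e) (d N i) (r N i e))"
  unfolding sample_of_def
  by (intro ppoly_append ppoly_mk_surb ppoly_pow wf eff d p ppoly_take ppoly_drop r) (simp_all add: r)

lemma ppoly_sample:
  assumes wf: "well_formed P" and eff: "efficient_algorithms P"
    and d: "\<And>N i. D N i \<noteq> {} \<Longrightarrow> valid_contact P N (d N i)"
    and p: "ppoly D g p" "\<And>N i e. e \<in> D N i \<Longrightarrow> p N i e \<in> set_pmf (pki_gen P N)"
    and s: "ppoly D g s" "\<And>N i e. e \<in> D N i \<Longrightarrow> length (s N i e) = seed_len P N"
  shows "ppoly D g (\<lambda>N i e. sample P N (p N i e) (d N i) (s N i e))"
  unfolding sample_def
proof (rule ppoly_sample_of[OF wf eff d p])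
  show "ppoly D g (\<lambda>N i e. prg P N (s N i e))"
    using ppoly_efficient[of "\<lambda>N. {[s] |s. length s = seed_len P N}" "\<lambda>N xs. prg P N (xs ! 0)"
        D g "\<lambda>N i e. [s N i e]" "\<lambda>N i. [seed_len P N]"] eff s
    by (simp add: efficient_algorithms_def)
  show "length (prg P N (s N i e)) = surb_rand_len P N + draw_rand_len P N" if "e \<in> D N i" for N i e
    using wf s(2)[OF that] by (simp add: well_formed_def)
qed

section \<open>Negligible differences\<close>

lemma negligible_mono:
  assumes "negligible_fun f" "\<And>N. \<bar>e N\<bar> \<le> \<bar>f N\<bar>"
  shows "negligible_fun e"
  unfolding negligible_fun_def
proof
  fix c
  have "\<forall>\<^sub>F N in sequentially. \<bar>f N\<bar> < 1 / real N ^ c"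
    using assms(1) unfolding negligible_fun_def by blast
  then show "\<forall>\<^sub>F N in sequentially. \<bar>e N\<bar> < 1 / real N ^ c"
    by eventually_elim (use assms(2) le_less_trans in blast)
qed

text \<open>A bound \<open>(N + 2) ^ k\<close> on the factor is at most \<open>N ^ (2 * k)\<close>
  for \<open>N \<ge> 2\<close>, so the exponent \<open>c + 2 * k\<close> for \<open>e\<close> leaves
  \<open>c\<close>.\<close>

lemma negligible_poly_mult:
  assumes "negligible_fun e" "poly_bounded n"
  shows "negligible_fun (\<lambda>N. real (n N) * e N)"
  unfolding negligible_fun_def
proof
  fix c
  obtain k where k: "\<And>N. n N \<le> (N + 2) ^ k" using assms(2) by (auto simp: poly_bounded_iff)
  have "\<forall>\<^sub>F N in sequentially. \<bar>e N\<bar> < 1 / real N ^ (c + 2 * k)"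
    using assms(1) unfolding negligible_fun_def by blast
  then show "\<forall>\<^sub>F N in sequentially. \<bar>real (n N) * e N\<bar> < 1 / real N ^ c"
    using eventually_ge_at_top[of 2]
  proof eventually_elim
    case (elim N)
    have "N + 2 \<le> 2 * N" "2 * N \<le> N * N" using elim by auto
    then have "N + 2 \<le> N ^ 2" unfolding power2_eq_square by linarith
    then have "(N + 2) ^ k \<le> (N ^ 2) ^ k" by (rule power_mono) simp
    then have "n N \<le> N ^ (2 * k)" using k[of N] by (simp add: power_mult)
    then have "real (n N) \<le> real N ^ (2 * k)" by (metis of_nat_le_iff of_nat_power)
    then have "\<bar>real (n N) * e N\<bar> \<le> real N ^ (2 * k) * \<bar>e N\<bar>"
      by (simp add: abs_mult mult_right_mono)
    also have "\<dots> < real N ^ (2 * k) * (1 / real N ^ (c + 2 * k))"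
      using elim by (intro mult_strict_left_mono) auto
    also have "\<dots> = 1 / real N ^ c" using elim by (simp add: power_add)
    finally show ?case .
  qed
qed

text \<open>The maximum inherits the bounds directly; the remaining factor 2 is absorbed by
  \<open>negligible_poly_mult\<close>.\<close>

lemma negligible_add:
  assumes "negligible_fun e" "negligible_fun f"
  shows "negligible_fun (\<lambda>N. e N + f N)"
proof -
  have "negligible_fun (\<lambda>N. max \<bar>e N\<bar> \<bar>f N\<bar>)"
    unfolding negligible_fun_def
  proof
    fix c
    have "\<forall>\<^sub>F N in sequentially. \<bar>e N\<bar> < 1 / real N ^ c" "\<forall>\<^sub>F N in sequentially. \<bar>f N\<bar> < 1 / real N ^ c"
      using assms unfolding negligible_fun_def by blast+
    then show "\<forall>\<^sub>F N in sequentially. \<bar>max \<bar>e N\<bar> \<bar>f N\<bar>\<bar> < 1 / real N ^ c"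
      by eventually_elim auto
  qed
  moreover have "poly_bounded (\<lambda>_. 2)" unfolding poly_bounded_def by (intro exI[of _ 2]) auto
  ultimately have "negligible_fun (\<lambda>N. real 2 * max \<bar>e N\<bar> \<bar>f N\<bar>)"
    by (rule negligible_poly_mult)
  then show ?thesis by (rule negligible_mono) auto
qed

lemma negligible_trans:
  assumes "negligible_fun (\<lambda>N. a N - b N)" "negligible_fun (\<lambda>N. b N - c N)"
  shows "negligible_fun (\<lambda>N. a N - c N :: real)"
  using negligible_add[OF assms] by simp

lemma negligible_sym:
  assumes "negligible_fun (\<lambda>N. a N - b N)"
  shows "negligible_fun (\<lambda>N. b N - a N :: real)"
  using assms by (rule negligible_mono) simp

abbreviation Pr :: "bool pmf \<Rightarrow> real" where
  "Pr p \<equiv> pmf p True"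

text \<open>A mean cannot exceed all of its terms, so some outcome of \<open>p\<close> separates the
  two experiments at least as well as the average does.\<close>

lemma averaging:
  "\<exists>x\<in>set_pmf p. \<bar>Pr (bind_pmf p f) - Pr (bind_pmf p g)\<bar> \<le> \<bar>Pr (f x) - Pr (g x)\<bar>"
proof (rule ccontr)
  let ?h = "\<lambda>x. \<bar>Pr (f x) - Pr (g x)\<bar>"
  have int: "integrable (measure_pmf p) (\<lambda>x. Pr (k x))" for k
    by (intro measure_pmf.integrable_const_bound[where B = 1]) (auto simp: pmf_le_1)
  have int': "integrable (measure_pmf p) ?h" using int by (intro integrable_abs Bochner_Integration.integrable_diff)
  assume "\<not> ?thesis"
  then have less: "?h x < \<bar>Pr (bind_pmf p f) - Pr (bind_pmf p g)\<bar>" if "x \<in> set_pmf p" for x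
    using that by force
  have "Pr (bind_pmf p f) - Pr (bind_pmf p g)
      = measure_pmf.expectation p (\<lambda>x. Pr (f x) - Pr (g x))"
    by (simp add: pmf_bind Bochner_Integration.integral_diff[OF int int])
  then have "\<bar>Pr (bind_pmf p f) - Pr (bind_pmf p g)\<bar> \<le> measure_pmf.expectation p ?h"
    by (simp add: integral_abs_bound)
  also have "\<dots> < \<bar>Pr (bind_pmf p f) - Pr (bind_pmf p g)\<bar>"
    using less by (intro measure_pmf.expectation_less int') (auto simp: AE_measure_pmf_iff)
  finally show False by simp
qed

text \<open>The outcome is chosen separately for every \<open>N\<close>. Nothing makes this choice
  computable, so it suits circuit families, into which \<open>c N\<close> can be built.\<close>

lemma negligible_averaging:
  assumes "\<And>c. (\<And>N. c N \<in> set_pmf (p N)) \<Longrightarrow>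
    negligible_fun (\<lambda>N. Pr (f N (c N)) - Pr (g N (c N)))"
  shows "negligible_fun (\<lambda>N. Pr (bind_pmf (p N) (f N)) - Pr (bind_pmf (p N) (g N)))"
proof -
  have "\<forall>N. \<exists>x. x \<in> set_pmf (p N) \<and>
    \<bar>Pr (bind_pmf (p N) (f N)) - Pr (bind_pmf (p N) (g N))\<bar>
      \<le> \<bar>Pr (f N x) - Pr (g N x)\<bar>"
    by (intro allI averaging[unfolded Bex_def])
  from choice[OF this] obtain c where c: "\<forall>N. c N \<in> set_pmf (p N) \<and>
    \<bar>Pr (bind_pmf (p N) (f N)) - Pr (bind_pmf (p N) (g N))\<bar>
      \<le> \<bar>Pr (f N (c N)) - Pr (g N (c N))\<bar>" ..
  then have "negligible_fun (\<lambda>N. Pr (f N (c N)) - Pr (g N (c N)))"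
    by (intro assms) blast
  then show ?thesis by (rule negligible_mono) (use c in blast)
qed

lemma Pr_map: "Pr (map_pmf f p) = measure_pmf.prob p {x. f x}"
proof -
  have "f -` {True} = {x. f x}" by auto
  then show ?thesis by (simp add: pmf_map)
qed

lemma stat_dist_bound:
  "\<bar>Pr (map_pmf f p) - Pr (map_pmf f q)\<bar> \<le> stat_dist p q"
  unfolding Pr_map stat_dist_def
proof (rule cSUP_upper)
  show "bdd_above (range (\<lambda>S. \<bar>measure_pmf.prob p S - measure_pmf.prob q S\<bar>))"
  proof (rule bdd_aboveI2)
    fix S
    show "\<bar>measure_pmf.prob p S - measure_pmf.prob q S\<bar> \<le> 1"
      using measure_pmf.prob_le_1[of p S] measure_pmf.prob_le_1[of q S]
        measure_nonneg[of "measure_pmf p" S] measure_nonneg[of "measure_pmf q" S] by linarith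
  qed
qed simp

text \<open>The circuits have to be right only on the supports; the trivial index type leaves one
  circuit per \<open>N\<close>.\<close>

lemma comp_indist_ppoly:
  assumes "comp_indist X Y" "ppoly D (\<lambda>N (i :: unit) e. e) (\<lambda>N i. f N)"
    and "\<And>N. set_pmf (X N) \<subseteq> D N ()" "\<And>N. set_pmf (Y N) \<subseteq> D N ()"
  shows "negligible_fun (\<lambda>N. Pr (map_pmf (\<lambda>x. f N x = [True]) (X N)) -
    Pr (map_pmf (\<lambda>x. f N x = [True]) (Y N)))"
proof -
  obtain s where s: "poly_on D s" "\<And>N i. reducible (D N i) (s N i) (\<lambda>e. e) (f N)"
    using assms(2) unfolding ppoly_def by blast
  obtain c where c: "\<And>N i. D N i \<noteq> {} \<Longrightarrow> s N i \<le> (N + 2) ^ c"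
    using s(1) unfolding poly_on_def by blast
  have "\<exists>C. circuit_size C \<le> s N () \<and> (\<forall>e\<in>D N (). run C e = f N e)" for N
    using s(2)[of N "()"] unfolding reducible_def by blast
  then obtain C where C: "\<And>N. circuit_size (C N) \<le> s N ()" "\<And>N e. e \<in> D N () \<Longrightarrow> run (C N) e = f N e"
    by metis
  have ne: "D N () \<noteq> {}" for N using assms(3)[of N] set_pmf_not_empty[of "X N"] by blast
  have "poly_bounded (\<lambda>N. circuit_size (C N))"
    unfolding poly_bounded_iff using c[OF ne] C(1) le_trans by blast
  then have "negligible_fun (\<lambda>N. measure_pmf.prob (X N) {x. run (C N) x = [True]}
                   - measure_pmf.prob (Y N) {x. run (C N) x = [True]})"
    using assms(1) by (simp add: comp_indist_def)
  moreover have "map_pmf (\<lambda>x. run (C N) x = [True]) p = map_pmf (\<lambda>x. f N x = [True]) p"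
    if "set_pmf p \<subseteq> D N ()" for p N
    using that C(2) by (intro map_pmf_cong) auto
  ultimately show ?thesis
    unfolding Pr_map[symmetric] using assms(3,4) by simp
qed

text \<open>The pattern of the computational hybrid steps: \<open>c\<close> is side information
  independent of the challenge, and averaging turns it into a constant of the distinguisher.\<close>

lemma comp_indist_hardwire:
  assumes "comp_indist X Y"
    and a: "\<And>N. a N = Pr (bind_pmf (p N) (\<lambda>c. map_pmf (\<lambda>x. f N c x = [True]) (X N)))"
    and b: "\<And>N. b N = Pr (bind_pmf (p N) (\<lambda>c. map_pmf (\<lambda>x. f N c x = [True]) (Y N)))"
    and f: "\<And>c. (\<And>N. c N \<in> set_pmf (p N)) \<Longrightarrow> ppoly D (\<lambda>N (i :: unit) e. e) (\<lambda>N i. f N (c N))"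
    and D: "\<And>N. set_pmf (X N) \<subseteq> D N ()" "\<And>N. set_pmf (Y N) \<subseteq> D N ()"
  shows "negligible_fun (\<lambda>N. a N - b N)"
  unfolding a b by (intro negligible_averaging comp_indist_ppoly[where D = D] assms(1) f D)

lemma comp_indistI:
  assumes "\<And>D. poly_bounded (\<lambda>N. circuit_size (D N)) \<Longrightarrow>
    negligible_fun (\<lambda>N. Pr (map_pmf (\<lambda>x. run (D N) x = [True]) (X N)) -
      Pr (map_pmf (\<lambda>x. run (D N) x = [True]) (Y N)))"
  shows "comp_indist X Y"
  using assms unfolding comp_indist_def Pr_map by blast

lemma comp_indist_trans: "comp_indist X Y \<Longrightarrow> comp_indist Y Z \<Longrightarrow> comp_indist X Z"
  unfolding comp_indist_def using negligible_trans by fast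

lemma comp_indist_sym: "comp_indist X Y \<Longrightarrow> comp_indist Y X"
  unfolding comp_indist_def using negligible_sym by fast

section \<open>Indistinguishability of samples\<close>

lemma finite_bits: "finite {x::bits. length x = l}"
  using finite_lists_length_eq[of "UNIV :: bool set" l] by simp

lemma bits_nonempty: "{x::bits. length x = l} \<noteq> {}"
proof -
  have "replicate l False \<in> {x. length x = l}" by simp
  then show ?thesis by blast
qed

lemma set_uniform_bits [simp]: "set_pmf (uniform_bits l) = {x. length x = l}"
  unfolding uniform_bits_def by (rule set_pmf_of_set[OF bits_nonempty finite_bits])

lemma pair_pmf_of_set:
  assumes "finite A" "A \<noteq> {}" "finite B" "B \<noteq> {}"
  shows "pair_pmf (pmf_of_set A) (pmf_of_set B) = pmf_of_set (A \<times> B)"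
proof (rule pmf_eqI)
  fix x :: "'a \<times> 'b"
  show "pmf (pair_pmf (pmf_of_set A) (pmf_of_set B)) x = pmf (pmf_of_set (A \<times> B)) x"
    using assms by (cases x) (simp add: pmf_pair pmf_of_set card_cartesian_product indicator_def)
qed

text \<open>Separates the coins of the SURB from those of the exponent, which makes the two parts of
  a sample independent once the directory is given.\<close>

lemma uniform_bits_append:
  "uniform_bits (a + b) = do { x \<leftarrow> uniform_bits a; y \<leftarrow> uniform_bits b; return_pmf (x @ y) }"
proof -
  have inj: "inj_on (\<lambda>(x, y). x @ y) ({x::bits. length x = a} \<times> {x. length x = b})"
    by (auto simp: inj_on_def)
  have "(\<lambda>(x, y). x @ y) ` ({x::bits. length x = a} \<times> {x. length x = b}) = {x. length x = a + b}"
  proof safe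
    fix x :: bits assume "length x = a + b"
    then show "x \<in> (\<lambda>(x, y). x @ y) ` ({x. length x = a} \<times> {x. length x = b})"
      by (intro image_eqI[of _ _ "(take a x, drop a x)"]) auto
  qed auto
  then have "uniform_bits (a + b) = map_pmf (\<lambda>(x, y). x @ y) (pmf_of_set ({x. length x = a} \<times> {x. length x = b}))"
    unfolding uniform_bits_def using finite_bits bits_nonempty
    by (subst map_pmf_of_set_inj[OF inj]) auto
  also have "\<dots> = map_pmf (\<lambda>(x, y). x @ y) (pair_pmf (uniform_bits a) (uniform_bits b))"
    unfolding uniform_bits_def by (subst pair_pmf_of_set) (rule finite_bits bits_nonempty refl)+
  finally show ?thesis
    by (simp add: pair_pmf_def map_bind_pmf)
qed

text \<open>The directory accompanies the sample because the adversary sees it and because a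
  simulator computes further samples from it.\<close>

definition sample_dist :: "system \<Rightarrow> nat \<Rightarrow> contact \<Rightarrow> bits pmf" where
  "sample_dist P N d = do { pki \<leftarrow> pki_gen P N; s \<leftarrow> uniform_bits (seed_len P N);
     return_pmf (pki @ sample P N pki d s) }"

lemma pki_length: "well_formed P \<Longrightarrow> pki \<in> set_pmf (pki_gen P N) \<Longrightarrow> length pki = pki_len P N"
  by (simp add: well_formed_def)

lemma ppoly_unit_id:
  assumes "\<And>N e. e \<in> D N () \<Longrightarrow> length e = l N" "poly_bounded l"
  shows "ppoly D (\<lambda>N (i::unit) e. e) (\<lambda>N i e. e)"
  by (rule ppoly_id[where l = "\<lambda>N _. l N"]) (use assms in \<open>auto intro: poly_onI\<close>)

lemma poly_bounded_unit: "poly_on (\<lambda>N (i::unit). UNIV :: unit set) (\<lambda>N i. a N) \<longleftrightarrow> poly_bounded a"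
  by (simp add: poly_bounded_iff poly_on_def)

lemma poly_bounded_add: "poly_bounded a \<Longrightarrow> poly_bounded b \<Longrightarrow> poly_bounded (\<lambda>N. a N + b N)"
  unfolding poly_bounded_unit[symmetric] by (rule poly_on_add)

lemma poly_bounded_mult: "poly_bounded a \<Longrightarrow> poly_bounded b \<Longrightarrow> poly_bounded (\<lambda>N. a N * b N)"
  unfolding poly_bounded_unit[symmetric] by (rule poly_on_mult)

lemma poly_bounded_const: "poly_bounded (\<lambda>N. c)"
  unfolding poly_bounded_unit[symmetric] by (rule poly_on_const)

lemma poly_bounded_mono: "poly_bounded b \<Longrightarrow> (\<And>N. a N \<le> b N) \<Longrightarrow> poly_bounded a"
  unfolding poly_bounded_iff by (meson le_trans)

lemma poly_bounded_sample_len: "well_formed P \<Longrightarrow> poly_bounded (sample_len P)"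
  using poly_bounded_add[OF well_formed_poly(9,1)] by (simp add: sample_len_def[abs_def])

section \<open>Hybrids between the samples of two contacts\<close>

definition hybrid_rand :: "system \<Rightarrow> nat \<Rightarrow> contact \<Rightarrow> bits pmf" where
  "hybrid_rand P N d = do { pki \<leftarrow> pki_gen P N;
     w \<leftarrow> uniform_bits (surb_rand_len P N + draw_rand_len P N);
     return_pmf (pki @ sample_of P N pki d w) }"

definition hybrid_surb :: "system \<Rightarrow> nat \<Rightarrow> contact \<Rightarrow> bits pmf" where
  "hybrid_surb P N d = do { pki \<leftarrow> pki_gen P N; u \<leftarrow> uniform_bits (surb_len P N);
     v \<leftarrow> uniform_bits (draw_rand_len P N);
     return_pmf (pki @ u @ pubkey d [^]\<^bsub>grp P N\<^esub> draw P N v) }"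

definition hybrid_exp :: "system \<Rightarrow> nat \<Rightarrow> contact \<Rightarrow> bits pmf" where
  "hybrid_exp P N d = do { pki \<leftarrow> pki_gen P N; u \<leftarrow> uniform_bits (surb_len P N);
     y \<leftarrow> random_exponent P N; return_pmf (pki @ u @ pubkey d [^]\<^bsub>grp P N\<^esub> y) }"

text \<open>The challenge is the expanded seed, which is independent of the directory, so the
  directory can be fixed.\<close>

lemma sample_indist_prg:
  assumes wf: "well_formed P" and eff: "efficient_algorithms P" and "prg_secure P"
    and d: "\<And>N. valid_contact P N (d N)"
  shows "comp_indist (\<lambda>N. sample_dist P N (d N)) (\<lambda>N. hybrid_rand P N (d N))"
proof (rule comp_indistI)
  fix D :: "nat \<Rightarrow> circuit" assume D: "poly_bounded (\<lambda>N. circuit_size (D N))"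
  let ?a = "\<lambda>N. Pr (map_pmf (\<lambda>x. run (D N) x = [True]) (sample_dist P N (d N)))"
  let ?b = "\<lambda>N. Pr (map_pmf (\<lambda>x. run (D N) x = [True]) (hybrid_rand P N (d N)))"
  define f where "f N pki w = run (D N) (pki @ sample_of P N pki (d N) w)" for N pki w
  let ?D = "\<lambda>N (i::unit). {w::bits. length w = surb_rand_len P N + draw_rand_len P N}"
  have id: "ppoly ?D (\<lambda>N i e. e) (\<lambda>N i e. e)"
    by (rule ppoly_unit_id[where l = "\<lambda>N. surb_rand_len P N + draw_rand_len P N"])
      (auto intro!: poly_bounded_add well_formed_poly wf)
  show "negligible_fun (\<lambda>N. ?a N - ?b N)"
  proof (rule comp_indist_hardwire)
    show "comp_indist (\<lambda>N. map_pmf (prg P N) (uniform_bits (seed_len P N)))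
        (\<lambda>N. uniform_bits (surb_rand_len P N + draw_rand_len P N))"
      using assms(3) by (simp add: prg_secure_def)
    show "?a N = Pr (do { pki \<leftarrow> pki_gen P N; map_pmf (\<lambda>w. f N pki w = [True])
        (map_pmf (prg P N) (uniform_bits (seed_len P N))) })" for N
      by (simp add: sample_dist_def map_bind_pmf f_def sample_def pmf.map_comp o_def
          map_pmf_def[of _ "uniform_bits _"] bind_assoc_pmf bind_return_pmf)
    show "?b N = Pr (do { pki \<leftarrow> pki_gen P N; map_pmf (\<lambda>w. f N pki w = [True])
        (uniform_bits (surb_rand_len P N + draw_rand_len P N)) })" for N
      by (simp add: hybrid_rand_def f_def map_pmf_def bind_assoc_pmf bind_return_pmf)
    show "set_pmf (map_pmf (prg P N) (uniform_bits (seed_len P N))) \<subseteq> ?D N ()" for N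
      using wf by (auto simp: well_formed_def)
  next
    fix p assume p: "\<And>N. p N \<in> set_pmf (pki_gen P N)"
    have "ppoly ?D (\<lambda>N i e. e) (\<lambda>N i e. p N)"
      by (intro ppoly_const ppoly_fixed_length[OF id])
        (simp add: pki_length[OF wf p] poly_onI well_formed_poly wf)
    then show "ppoly ?D (\<lambda>N i e. e) (\<lambda>N i. f N (p N))"
      unfolding f_def
      by (intro ppoly_run ppoly_append ppoly_sample_of wf eff d id poly_onI D) (auto simp: p)
  qed simp
qed

text \<open>Here the challenge contains the directory, so only the coins \<open>v\<close> of the
  exponent are fixed; the blinded key then becomes a constant suffix.\<close>

lemma sample_indist_surb:
  assumes wf: "well_formed P" and "surbs_pseudorandom P"
    and d: "\<And>N. valid_contact P N (d N)"
  shows "comp_indist (\<lambda>N. hybrid_rand P N (d N)) (\<lambda>N. hybrid_surb P N (d N))"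
proof (rule comp_indistI)
  fix D :: "nat \<Rightarrow> circuit" assume D: "poly_bounded (\<lambda>N. circuit_size (D N))"
  let ?a = "\<lambda>N. Pr (map_pmf (\<lambda>x. run (D N) x = [True]) (hybrid_rand P N (d N)))"
  let ?b = "\<lambda>N. Pr (map_pmf (\<lambda>x. run (D N) x = [True]) (hybrid_surb P N (d N)))"
  define f where "f N v x = run (D N) (x @ pubkey (d N) [^]\<^bsub>grp P N\<^esub> draw P N v)" for N v x
  let ?V = "\<lambda>N. uniform_bits (draw_rand_len P N)" and ?R = "\<lambda>N. uniform_bits (surb_rand_len P N)"
  let ?X = "\<lambda>N. do { pki \<leftarrow> pki_gen P N; r \<leftarrow> ?R N; return_pmf (pki @ mk_surb P N pki (d N) r) }"
  let ?Y = "\<lambda>N. do { pki \<leftarrow> pki_gen P N; u \<leftarrow> uniform_bits (surb_len P N); return_pmf (pki @ u) }"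
  let ?D = "\<lambda>N (i::unit). {w::bits. length w = pki_len P N + surb_len P N}"
  have id: "ppoly ?D (\<lambda>N i e. e) (\<lambda>N i e. e)"
    by (rule ppoly_unit_id[where l = "\<lambda>N. pki_len P N + surb_len P N"])
      (auto intro!: poly_bounded_add well_formed_poly wf)
  show "negligible_fun (\<lambda>N. ?a N - ?b N)"
  proof (rule comp_indist_hardwire[of ?X ?Y _ ?V f])
    show "comp_indist ?X ?Y" using assms(2) d by (simp add: surbs_pseudorandom_def)
    fix N
    have "?a N = Pr (do { pki \<leftarrow> pki_gen P N; r \<leftarrow> ?R N; v \<leftarrow> ?V N;
          return_pmf (f N v (pki @ mk_surb P N pki (d N) r) = [True]) })"
      unfolding hybrid_rand_def uniform_bits_append map_bind_pmf bind_assoc_pmf bind_return_pmf map_return_pmf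
      by (intro arg_cong[where f = Pr] bind_pmf_cong refl) (simp add: sample_of_def f_def)
    also have "\<dots> = Pr (do { v \<leftarrow> ?V N; pki \<leftarrow> pki_gen P N; r \<leftarrow> ?R N;
          return_pmf (f N v (pki @ mk_surb P N pki (d N) r) = [True]) })"
      unfolding bind_commute_pmf[of "?R N"] bind_commute_pmf[of "pki_gen P N" "?V N"] ..
    finally show "?a N = Pr (do { v \<leftarrow> ?V N; map_pmf (\<lambda>x. f N v x = [True]) (?X N) })"
      by (simp add: map_bind_pmf)
    show "?b N = Pr (do { v \<leftarrow> ?V N; map_pmf (\<lambda>x. f N v x = [True]) (?Y N) })"
      unfolding map_bind_pmf map_return_pmf bind_commute_pmf[of "?V N"]
      by (simp add: hybrid_surb_def map_bind_pmf f_def)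
    show "set_pmf (?X N) \<subseteq> ?D N ()" "set_pmf (?Y N) \<subseteq> ?D N ()"
      using wf d[of N] by (auto simp: well_formed_def)
  next
    fix v :: "nat \<Rightarrow> bits"
    have "ppoly ?D (\<lambda>N i e. e) (\<lambda>N i e. pubkey (d N) [^]\<^bsub>grp P N\<^esub> draw P N (v N))"
      by (intro ppoly_const ppoly_fixed_length[OF id])
        (simp add: pow_carrier[OF wf valid_contactD(1)[OF wf d]] poly_onI well_formed_poly wf)
    then show "ppoly ?D (\<lambda>N i e. e) (\<lambda>N i. f N (v N))"
      unfolding f_def by (intro ppoly_run ppoly_append id poly_onI D)
  qed
qed

text \<open>Statistical distance bounds every test, whatever its size; averaging over directory and
  SURB string leaves a test on the exponent alone.\<close>

lemma sample_indist_draw: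
  assumes "draws_uniformly P"
  shows "comp_indist (\<lambda>N. hybrid_surb P N (d N)) (\<lambda>N. hybrid_exp P N (d N))"
proof (rule comp_indistI)
  fix D :: "nat \<Rightarrow> circuit" assume D: "poly_bounded (\<lambda>N. circuit_size (D N))"
  let ?a = "\<lambda>N. Pr (map_pmf (\<lambda>x. run (D N) x = [True]) (hybrid_surb P N (d N)))"
  let ?b = "\<lambda>N. Pr (map_pmf (\<lambda>x. run (D N) x = [True]) (hybrid_exp P N (d N)))"
  show "negligible_fun (\<lambda>N. ?a N - ?b N)"
  proof (rule negligible_mono)
    show "negligible_fun (\<lambda>N. stat_dist (map_pmf (draw P N) (uniform_bits (draw_rand_len P N))) (random_exponent P N))"
      using assms by (simp add: draws_uniformly_def)
    fix N
    define g :: "bits \<times> bits \<Rightarrow> nat \<Rightarrow> bool"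
      where "g x y = (run (D N) (fst x @ snd x @ pubkey (d N) [^]\<^bsub>grp P N\<^esub> y) = [True])" for x y
    let ?X = "map_pmf (draw P N) (uniform_bits (draw_rand_len P N))" and ?Y = "random_exponent P N"
    let ?Q = "pair_pmf (pki_gen P N) (uniform_bits (surb_len P N))"
    have "?a N = Pr (bind_pmf ?Q (\<lambda>x. map_pmf (g x) ?X))"
      by (simp add: hybrid_surb_def pair_pmf_def bind_assoc_pmf bind_return_pmf g_def map_pmf_def)
    moreover have "?b N = Pr (bind_pmf ?Q (\<lambda>x. map_pmf (g x) ?Y))"
      by (simp add: hybrid_exp_def pair_pmf_def bind_assoc_pmf bind_return_pmf g_def map_pmf_def)
    moreover obtain x where "\<bar>Pr (bind_pmf ?Q (\<lambda>x. map_pmf (g x) ?X)) - Pr (bind_pmf ?Q (\<lambda>x. map_pmf (g x) ?Y))\<bar>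
        \<le> \<bar>Pr (map_pmf (g x) ?X) - Pr (map_pmf (g x) ?Y)\<bar>"
      using averaging[of ?Q] by blast
    ultimately show "\<bar>?a N - ?b N\<bar> \<le> \<bar>stat_dist ?X ?Y\<bar>"
      using stat_dist_bound[of "g x" ?X ?Y] by linarith
  qed
qed

text \<open>Once the SURB is a uniform string, the contact is present only in the blinded key, so
  everything else can be fixed.\<close>

lemma sample_indist_blind:
  assumes wf: "well_formed P" and "blinding_indist P"
    and d: "\<And>N. valid_contact P N (d N)" "\<And>N. valid_contact P N (d' N)"
  shows "comp_indist (\<lambda>N. hybrid_exp P N (d N)) (\<lambda>N. hybrid_exp P N (d' N))"
proof (rule comp_indistI)
  fix D :: "nat \<Rightarrow> circuit" assume D: "poly_bounded (\<lambda>N. circuit_size (D N))"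
  let ?a = "\<lambda>N. Pr (map_pmf (\<lambda>x. run (D N) x = [True]) (hybrid_exp P N (d N)))"
  let ?b = "\<lambda>N. Pr (map_pmf (\<lambda>x. run (D N) x = [True]) (hybrid_exp P N (d' N)))"
  define f where "f N x z = run (D N) (fst x @ snd x @ z)" for N x z
  let ?X = "\<lambda>d N. map_pmf (\<lambda>y. pubkey (d N) [^]\<^bsub>grp P N\<^esub> y) (random_exponent P N)"
  let ?Q = "\<lambda>N. pair_pmf (pki_gen P N) (uniform_bits (surb_len P N))"
  let ?D = "\<lambda>N (i::unit). {w::bits. length w = grp_len P N}"
  have id: "ppoly ?D (\<lambda>N i e. e) (\<lambda>N i e. e)"
    by (rule ppoly_unit_id[where l = "grp_len P"]) (auto intro!: well_formed_poly wf)
  show "negligible_fun (\<lambda>N. ?a N - ?b N)"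
  proof (rule comp_indist_hardwire[of "?X d" "?X d'" _ ?Q f])
    show "comp_indist (?X d) (?X d')"
      using assms(2) d by (simp add: blinding_indist_def valid_contact_def)
    show "?a N = Pr (do { x \<leftarrow> ?Q N; map_pmf (\<lambda>z. f N x z = [True]) (?X d N) })"
      "?b N = Pr (do { x \<leftarrow> ?Q N; map_pmf (\<lambda>z. f N x z = [True]) (?X d' N) })" for N
      by (simp_all add: hybrid_exp_def pair_pmf_def bind_assoc_pmf bind_return_pmf f_def map_pmf_def)
    fix q assume q: "\<And>N. q N \<in> set_pmf (?Q N)"
    have "length (fst (q N)) = pki_len P N" "length (snd (q N)) = surb_len P N" for N
      using q[of N] pki_length[OF wf] by auto
    then have "ppoly ?D (\<lambda>N i e. e) (\<lambda>N i e. fst (q N))" "ppoly ?D (\<lambda>N i e. e) (\<lambda>N i e. snd (q N))"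
      by (intro ppoly_const ppoly_fixed_length[OF id];
        simp add: poly_onI well_formed_poly wf)+
    then show "ppoly ?D (\<lambda>N i e. e) (\<lambda>N i. f N (q N))"
      unfolding f_def by (intro ppoly_run ppoly_append id poly_onI D)
  qed (auto simp: pow_carrier[OF wf valid_contactD(1)[OF wf]] d)
qed

lemma sample_indist:
  assumes "well_formed P" "efficient_algorithms P" "prg_secure P" "draws_uniformly P"
    and "surbs_pseudorandom P" "blinding_indist P"
    and d: "\<And>N. valid_contact P N (d N)" "\<And>N. valid_contact P N (d' N)"
  shows "comp_indist (\<lambda>N. sample_dist P N (d N)) (\<lambda>N. sample_dist P N (d' N))"
proof -
  note h = sample_indist_prg[OF assms(1-3)] sample_indist_surb[OF assms(1,5)]
    sample_indist_draw[OF assms(4)] sample_indist_blind[OF assms(1,6) d]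
  have "comp_indist (\<lambda>N. sample_dist P N (d N)) (\<lambda>N. hybrid_exp P N (d N))"
    if "\<And>N. valid_contact P N (d N)" for d
    by (rule comp_indist_trans[OF h(1)[OF that] comp_indist_trans[OF h(2)[OF that] h(3)]])
  from comp_indist_trans[OF this[OF d(1)] comp_indist_trans[OF h(4) comp_indist_sym[OF this[OF d(2)]]]]
  show ?thesis .
qed

section \<open>Several samples under one directory\<close>

definition samples_dist :: "system \<Rightarrow> nat \<Rightarrow> nat \<Rightarrow> (nat \<Rightarrow> contact) \<Rightarrow> bits pmf" where
  "samples_dist P N n c = do { pki \<leftarrow> pki_gen P N; ss \<leftarrow> replicate_pmf n (uniform_bits (seed_len P N));
     return_pmf (pki @ concat (map (\<lambda>t. sample P N pki (c t) (ss ! t)) [0..<n])) }"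

text \<open>Indistinguishability concerns sequences in the security parameter and gives no bound
  uniform in the hybrid position. So a largest gap is singled out for every parameter instead of
  summing all gaps.\<close>

lemma telescope_bound:
  fixes a :: "nat \<Rightarrow> real"
  assumes "0 < n"
  shows "\<exists>k<n. \<bar>a 0 - a n\<bar> \<le> real n * \<bar>a k - a (Suc k)\<bar>"
proof (rule ccontr)
  assume "\<not> ?thesis"
  then have *: "real n * \<bar>a k - a (Suc k)\<bar> < \<bar>a 0 - a n\<bar>" if "k < n" for k using that by force
  have "\<bar>a 0 - a n\<bar> = \<bar>\<Sum>k<n. a k - a (Suc k)\<bar>" by (simp add: sum_lessThan_telescope')
  also have "\<dots> \<le> (\<Sum>k<n. \<bar>a k - a (Suc k)\<bar>)" by (rule sum_abs)
  also have "\<dots> < (\<Sum>k<n. \<bar>a 0 - a n\<bar> / real n)"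
    using * assms by (intro sum_strict_mono) (auto simp: field_simps)
  also have "\<dots> = \<bar>a 0 - a n\<bar>" using assms by simp
  finally show False by simp
qed

lemma set_replicate_pmf: "set_pmf (replicate_pmf n p) = {xs. length xs = n \<and> set xs \<subseteq> set_pmf p}"
  by (auto simp: set_replicate_pmf lists_eq_set)

lemma replicate_bits_nth:
  assumes "xs \<in> set_pmf (replicate_pmf n (uniform_bits l))" "t < n"
  shows "length (xs ! t) = l"
proof -
  have "t < length xs" "set xs \<subseteq> {x. length x = l}" using assms by (auto simp: set_replicate_pmf)
  then show ?thesis using nth_mem by blast
qed

text \<open>The entry at position \<open>k\<close> is drawn last, so that the others can be fixed
  around it.\<close>

lemma replicate_pmf_split:
  assumes "k < n"
  shows "replicate_pmf n p = do { xs \<leftarrow> replicate_pmf k p; ys \<leftarrow> replicate_pmf (n - Suc k) p; x \<leftarrow> p;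
     return_pmf (xs @ x # ys) }"
proof -
  have "n = k + Suc (n - Suc k)" using assms by simp
  then have "replicate_pmf n p = do { xs \<leftarrow> replicate_pmf k p; ys \<leftarrow> replicate_pmf (Suc (n - Suc k)) p; return_pmf (xs @ ys) }"
    by (metis replicate_pmf_distrib)
  also have "\<dots> = do { xs \<leftarrow> replicate_pmf k p; x \<leftarrow> p; ys \<leftarrow> replicate_pmf (n - Suc k) p; return_pmf (xs @ x # ys) }"
    by (simp add: bind_assoc_pmf bind_return_pmf map_pmf_def)
  finally show ?thesis by (simp add: bind_commute_pmf[of p])
qed


text \<open>Places a directory-and-sample string \<open>x\<close> at position \<open>k\<close> among further samples that are
  computed from the directory in \<open>x\<close> and fixed seeds.\<close>

definition surround ::
  "system \<Rightarrow> nat \<Rightarrow> (nat \<Rightarrow> contact) \<Rightarrow> (nat \<Rightarrow> contact) \<Rightarrow> nat \<Rightarrow> bits list \<Rightarrow> bits list \<Rightarrow> nat \<Rightarrow> bits \<Rightarrow> bits" where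
  "surround P N cl cr k xs ys m x = (let pki = take (pki_len P N) x in
     pki @ concat (map (\<lambda>t. sample P N pki (cl t) (xs ! t)) [0..<k]) @ drop (pki_len P N) x @
     concat (map (\<lambda>t. sample P N pki (cr (Suc k + t)) (ys ! t)) [0..<m]))"

text \<open>Left and right of \<open>k\<close> the contacts come from \<open>cl\<close> and
  \<open>cr\<close>. Two neighbouring hybrids thus have the same surroundings and differ only in the
  contact used at \<open>k\<close>.\<close>

lemma samples_dist_split:
  assumes wf: "well_formed P" and k: "k < n"
    and c: "\<And>t. t < k \<Longrightarrow> c t = cl t" "\<And>t. k < t \<Longrightarrow> c t = cr t"
  shows "map_pmf F (samples_dist P N n c) =
    do { p \<leftarrow> pair_pmf (replicate_pmf k (uniform_bits (seed_len P N)))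
                     (replicate_pmf (n - Suc k) (uniform_bits (seed_len P N)));
         map_pmf (\<lambda>x. F (surround P N cl cr k (fst p) (snd p) (n - Suc k) x)) (sample_dist P N (c k)) }"
proof -
  let ?U = "uniform_bits (seed_len P N)" and ?m = "n - Suc k"
  let ?X = "replicate_pmf k ?U" and ?Y = "replicate_pmf ?m ?U"
  have upt: "[0..<n] = [0..<k] @ k # map (\<lambda>t. Suc k + t) [0..<?m]"
  proof -
    have "[0..<n] = [0..<k] @ [k..<n]" using k upt_add_eq_append[of 0 k "n - k"] by simp
    also have "[k..<n] = k # [Suc k..<n]" using k by (rule upt_conv_Cons)
    also have "[Suc k..<n] = map (\<lambda>t. Suc k + t) [0..<?m]"
      using k map_add_upt[of "Suc k" ?m] by (simp add: add.commute)
    finally show ?thesis .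
  qed
  have eq: "pki @ concat (map (\<lambda>t. sample P N pki (c t) ((xs @ s # ys) ! t)) [0..<n]) =
      surround P N cl cr k xs ys ?m (pki @ sample P N pki (c k) s)"
    if "pki \<in> set_pmf (pki_gen P N)" "xs \<in> set_pmf ?X" for pki xs s ys
  proof -
    have "length xs = k" using that(2) by (simp add: set_replicate_pmf)
    moreover from this have front: "map (\<lambda>t. sample P N pki (c t) ((xs @ s # ys) ! t)) [0..<k] =
        map (\<lambda>t. sample P N pki (cl t) (xs ! t)) [0..<k]"
      using c(1) by (intro map_cong) (auto simp: nth_append)
    ultimately show ?thesis
      unfolding upt map_append front using pki_length[OF wf that(1)] c(2)
      by (simp add: surround_def Let_def nth_append o_def)
  qed
  have "map_pmf F (samples_dist P N n c) = do { pki \<leftarrow> pki_gen P N; xs \<leftarrow> ?X; ys \<leftarrow> ?Y; s \<leftarrow> ?U;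
      return_pmf (F (pki @ concat (map (\<lambda>t. sample P N pki (c t) ((xs @ s # ys) ! t)) [0..<n]))) }"
    by (simp add: samples_dist_def map_bind_pmf replicate_pmf_split[OF k] bind_assoc_pmf bind_return_pmf)
  also have "\<dots> = do { pki \<leftarrow> pki_gen P N; xs \<leftarrow> ?X; ys \<leftarrow> ?Y; s \<leftarrow> ?U;
      return_pmf (F (surround P N cl cr k xs ys ?m (pki @ sample P N pki (c k) s))) }"
    by (intro bind_pmf_cong refl) (simp add: eq)
  also have "\<dots> = do { xs \<leftarrow> ?X; ys \<leftarrow> ?Y; pki \<leftarrow> pki_gen P N; s \<leftarrow> ?U;
      return_pmf (F (surround P N cl cr k xs ys ?m (pki @ sample P N pki (c k) s))) }"
    by (subst bind_commute_pmf[of "pki_gen P N" ?X], subst bind_commute_pmf[of "pki_gen P N" ?Y]) (rule refl)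
  finally show ?thesis
    by (simp add: pair_pmf_def bind_assoc_pmf bind_return_pmf sample_dist_def map_bind_pmf)
qed

lemma ppoly_surround:
  assumes wf: "well_formed P" and eff: "efficient_algorithms P"
    and c: "\<And>N t. valid_contact P N (cl N t)" "\<And>N t. valid_contact P N (cr N t)"
    and k: "poly_bounded k" "poly_bounded m"
    and xs: "\<And>N t. t < k N \<Longrightarrow> length (xs N ! t) = seed_len P N"
    and ys: "\<And>N t. t < m N \<Longrightarrow> length (ys N ! t) = seed_len P N"
  shows "ppoly (\<lambda>N i. {pki @ z |pki z. pki \<in> set_pmf (pki_gen P N) \<and> length z = sample_len P N})
    (\<lambda>N (i::unit) e. e) (\<lambda>N i. surround P N (cl N) (cr N) (k N) (xs N) (ys N) (m N))"
proof -
  let ?D = "\<lambda>N (i::unit). {pki @ z |pki z. pki \<in> set_pmf (pki_gen P N) \<and> length z = sample_len P N}"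
  have id: "ppoly ?D (\<lambda>N i e. e) (\<lambda>N i e. e)"
    by (rule ppoly_unit_id[where l = "\<lambda>N. pki_len P N + sample_len P N"])
      (auto intro!: poly_bounded_add well_formed_poly poly_bounded_sample_len wf simp: pki_length[OF wf])
  have pki: "ppoly ?D (\<lambda>N i e. e) (\<lambda>N i e. take (pki_len P N) e)" by (intro ppoly_take id)
  have part: "ppoly ?D (\<lambda>N i e. e)
      (\<lambda>N i e. concat (map (\<lambda>t. sample P N (take (pki_len P N) e) (cc N t) (ss N ! t)) [0..<n N]))"
    if "\<And>N t. valid_contact P N (cc N t)" "\<And>N t. t < n N \<Longrightarrow> length (ss N ! t) = seed_len P N"
      "poly_bounded n" for cc and ss :: "nat \<Rightarrow> bits list" and n
  proof (rule ppoly_concat)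
    let ?E = "indexed (\<lambda>N i. n N) ?D"
    have idE: "ppoly ?E (\<lambda>N j e. e) (\<lambda>N j e. e)" by (rule ppoly_indexed[OF id])
    have pkiE: "ppoly ?E (\<lambda>N j e. e) (\<lambda>N j e. take (pki_len P N) e)" by (rule ppoly_indexed[OF pki])
    have seeds: "ppoly ?E (\<lambda>N j e. e) (\<lambda>N j e. ss N ! snd j)"
    proof (rule ppoly_const)
      show "fixed_length (?E N j) (\<lambda>e. e)" for N j using ppoly_fixed_length[OF idE] .
      show "poly_on ?E (\<lambda>N j. length (ss N ! snd j))"
        using poly_onI[OF well_formed_poly(6)[OF wf]]
        by (rule poly_on_mono) (auto simp: that indexed_def split: if_splits)
    qed
    show "ppoly ?E (\<lambda>N j e. e) (\<lambda>N j e. sample P N (take (pki_len P N) e) (cc N (snd j)) (ss N ! snd j))"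
      by (rule ppoly_sample[OF wf eff that(1) pkiE _ seeds]) (auto simp: pki_length[OF wf] that)
    show "fixed_length (?D N i) (\<lambda>e. e)" for N i using ppoly_fixed_length[OF id] .
  qed (rule poly_onI[OF that(3)])
  show ?thesis
    unfolding surround_def Let_def
    by (intro ppoly_append pki ppoly_drop id part c k xs ys)
qed

lemma samples_indist:
  assumes wf: "well_formed P" and eff: "efficient_algorithms P"
    and prims: "prg_secure P" "draws_uniformly P" "surbs_pseudorandom P" "blinding_indist P"
    and n: "poly_bounded n"
    and c: "\<And>N t. valid_contact P N (c N t)" "\<And>N t. valid_contact P N (c' N t)"
  shows "comp_indist (\<lambda>N. samples_dist P N (n N) (c N)) (\<lambda>N. samples_dist P N (n N) (c' N))"
proof (rule comp_indistI)
  fix D :: "nat \<Rightarrow> circuit" assume D: "poly_bounded (\<lambda>N. circuit_size (D N))"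
  define F where "F N = (\<lambda>x. run (D N) x = [True])" for N
  define hyb where "hyb N k t = (if t < k then c' N t else c N t)" for N and k t :: nat
  define S where "S N k xs ys x = surround P N (c' N) (c N) k xs ys (n N - Suc k) x" for N k xs ys x
  define a where "a N k = Pr (map_pmf (F N) (samples_dist P N (n N) (hyb N k)))" for N k
  have "map (\<lambda>t. sample P N pki (hyb N (n N) t) (ss ! t)) [0..<n N] =
      map (\<lambda>t. sample P N pki (c' N t) (ss ! t)) [0..<n N]" for N pki ss
    by (rule map_cong) (auto simp: hyb_def)
  then have "samples_dist P N (n N) (hyb N (n N)) = samples_dist P N (n N) (c' N)" for N
    unfolding samples_dist_def by (simp only:)
  moreover have "hyb N 0 = c N" for N by (simp add: hyb_def fun_eq_iff)
  ultimately have ends: "a N 0 = Pr (map_pmf (F N) (samples_dist P N (n N) (c N)))"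
    "a N (n N) = Pr (map_pmf (F N) (samples_dist P N (n N) (c' N)))" for N
    by (simp_all add: a_def)
  let ?G = "\<lambda>N c k xs ys. Pr (map_pmf (\<lambda>x. F N (S N k xs ys x)) (sample_dist P N (c N k)))"
  \<comment> \<open>\<open>q\<close> packs the worst hybrid position with the seeds on either side
    of it, so that a single choice yields a family to which indistinguishability applies. The
    lengths are recorded for \<open>ppoly_surround\<close>.\<close>
  have "\<forall>N. \<exists>q. fst q \<le> n N \<and> (\<forall>t<fst q. length (fst (snd q) ! t) = seed_len P N) \<and>
      (\<forall>t<n N - Suc (fst q). length (snd (snd q) ! t) = seed_len P N) \<and>
      \<bar>a N 0 - a N (n N)\<bar> \<le> real (n N) * \<bar>?G N c (fst q) (fst (snd q)) (snd (snd q)) - ?G N c' (fst q) (fst (snd q)) (snd (snd q))\<bar>"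
  proof
    fix N
    show "\<exists>q. fst q \<le> n N \<and> (\<forall>t<fst q. length (fst (snd q) ! t) = seed_len P N) \<and>
      (\<forall>t<n N - Suc (fst q). length (snd (snd q) ! t) = seed_len P N) \<and>
      \<bar>a N 0 - a N (n N)\<bar> \<le> real (n N) * \<bar>?G N c (fst q) (fst (snd q)) (snd (snd q)) - ?G N c' (fst q) (fst (snd q)) (snd (snd q))\<bar>"
    proof (cases "n N = 0")
      case True
      then show ?thesis by (intro exI[of _ "(0, [], [])"]) simp
    next
      case False
      then obtain k where k: "k < n N" "\<bar>a N 0 - a N (n N)\<bar> \<le> real (n N) * \<bar>a N k - a N (Suc k)\<bar>"
        using telescope_bound[of "n N" "a N"] by auto
      let ?U = "uniform_bits (seed_len P N)"
      let ?Q = "pair_pmf (replicate_pmf k ?U) (replicate_pmf (n N - Suc k) ?U)"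
      have "a N k = Pr (bind_pmf ?Q (\<lambda>p. map_pmf (\<lambda>x. F N (S N k (fst p) (snd p) x)) (sample_dist P N (c N k))))"
        unfolding a_def S_def by (subst samples_dist_split[OF wf k(1)]) (auto simp: hyb_def)
      moreover have "a N (Suc k) = Pr (bind_pmf ?Q (\<lambda>p. map_pmf (\<lambda>x. F N (S N k (fst p) (snd p) x)) (sample_dist P N (c' N k))))"
        unfolding a_def S_def by (subst samples_dist_split[OF wf k(1)]) (auto simp: hyb_def)
      moreover obtain p where p: "p \<in> set_pmf ?Q"
        "\<bar>Pr (bind_pmf ?Q (\<lambda>p. map_pmf (\<lambda>x. F N (S N k (fst p) (snd p) x)) (sample_dist P N (c N k)))) -
          Pr (bind_pmf ?Q (\<lambda>p. map_pmf (\<lambda>x. F N (S N k (fst p) (snd p) x)) (sample_dist P N (c' N k))))\<bar>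
         \<le> \<bar>?G N c k (fst p) (snd p) - ?G N c' k (fst p) (snd p)\<bar>"
        using averaging[of ?Q] by blast
      ultimately have "\<bar>a N k - a N (Suc k)\<bar> \<le> \<bar>?G N c k (fst p) (snd p) - ?G N c' k (fst p) (snd p)\<bar>"
        by simp
      then have "real (n N) * \<bar>a N k - a N (Suc k)\<bar> \<le> real (n N) * \<bar>?G N c k (fst p) (snd p) - ?G N c' k (fst p) (snd p)\<bar>"
        by (rule mult_left_mono) simp
      with k(2) have "\<bar>a N 0 - a N (n N)\<bar> \<le> real (n N) * \<bar>?G N c k (fst p) (snd p) - ?G N c' k (fst p) (snd p)\<bar>"
        by (rule order_trans)
      moreover have "length (fst p ! t) = seed_len P N" if "t < k" for t
        using p(1) that replicate_bits_nth by (cases p) auto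
      moreover have "length (snd p ! t) = seed_len P N" if "t < n N - Suc k" for t
        using p(1) that replicate_bits_nth by (cases p) auto
      ultimately show ?thesis
        using k(1) by (intro exI[of _ "(k, p)"]) (simp add: less_imp_le)
    qed
  qed
  from choice[OF this] obtain q where q: "\<And>N. fst (q N) \<le> n N"
    "\<And>N t. t < fst (q N) \<Longrightarrow> length (fst (snd (q N)) ! t) = seed_len P N"
    "\<And>N t. t < n N - Suc (fst (q N)) \<Longrightarrow> length (snd (snd (q N)) ! t) = seed_len P N"
    "\<And>N. \<bar>a N 0 - a N (n N)\<bar> \<le> real (n N) * \<bar>?G N c (fst (q N)) (fst (snd (q N))) (snd (snd (q N)))
      - ?G N c' (fst (q N)) (fst (snd (q N))) (snd (snd (q N)))\<bar>" by blast
  let ?D = "\<lambda>N (i::unit). {pki @ z |pki z. pki \<in> set_pmf (pki_gen P N) \<and> length z = sample_len P N}"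
  have "negligible_fun (\<lambda>N. ?G N c (fst (q N)) (fst (snd (q N))) (snd (snd (q N)))
      - ?G N c' (fst (q N)) (fst (snd (q N))) (snd (snd (q N))))"
    unfolding F_def
  proof (rule comp_indist_ppoly)
    show "comp_indist (\<lambda>N. sample_dist P N (c N (fst (q N)))) (\<lambda>N. sample_dist P N (c' N (fst (q N))))"
      by (rule sample_indist[OF wf eff prims c])
    have "poly_bounded (\<lambda>N. fst (q N))" "poly_bounded (\<lambda>N. n N - Suc (fst (q N)))"
      using n q(1) by (auto intro: poly_bounded_mono)
    then show "ppoly ?D (\<lambda>N i e. e) (\<lambda>N i e. run (D N) (S N (fst (q N)) (fst (snd (q N))) (snd (snd (q N))) e))"
      unfolding S_def by (intro ppoly_run ppoly_surround wf eff c q poly_onI D)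
    show "set_pmf (sample_dist P N (c N (fst (q N)))) \<subseteq> ?D N ()"
      "set_pmf (sample_dist P N (c' N (fst (q N)))) \<subseteq> ?D N ()" for N
      using length_sample[OF wf c(1)] length_sample[OF wf c(2)] by (fastforce simp: sample_dist_def)+
  qed
  from negligible_poly_mult[OF this n]
  have "negligible_fun (\<lambda>N. a N 0 - a N (n N))"
    by (rule negligible_mono) (use q(4) in \<open>simp add: abs_mult\<close>)
  then show "negligible_fun (\<lambda>N. Pr (map_pmf (\<lambda>x. run (D N) x = [True]) (samples_dist P N (n N) (c N))) -
      Pr (map_pmf (\<lambda>x. run (D N) x = [True]) (samples_dist P N (n N) (c' N))))"
    by (simp add: ends F_def)
qed

section \<open>The game as a simulation\<close>

text \<open>The real rounds in the simulator's form: the strings are a function of the nonce instead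
  of the round. A table filled this way agrees with the function, so searching it changes
  nothing.\<close>

definition fun_step ::
  "system \<Rightarrow> nat \<Rightarrow> bits list \<Rightarrow> (bits \<Rightarrow> bits \<times> bits) \<Rightarrow> circuit list \<times> bits \<Rightarrow>
   bits \<times> entry list \<Rightarrow> bits \<times> entry list" where
  "fun_step P N sks f l s = sim_step P N sks l (f (req_nonce P N (fst l) (fst s))) s"

definition node_samples ::
  "system \<Rightarrow> nat \<Rightarrow> bits \<Rightarrow> (bool \<Rightarrow> contact) \<Rightarrow> (bool \<Rightarrow> bits) \<Rightarrow> bits \<Rightarrow> bits \<Rightarrow> bits \<times> bits" where
  "node_samples P N pki dest name k n =
     (sample P N pki (dest False) (kdf P N (n @ name False @ k)),
      sample P N pki (dest True) (kdf P N (n @ name True @ k)))"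

lemma lookup_consistent:
  assumes "\<forall>e\<in>set tab. snd (snd e) = f (fst (snd e))"
  shows "lookup n tab (f n) = f n"
  using assms by (induction tab) auto

section \<open>Answers of the nodes and of the simulator\<close>

lemma parse_Lookup_iff:
  "parse msg = Lookup i j n s \<longleftrightarrow> (\<exists>x. msg = [[False], [j], x, n, s] \<and> i = nat_of_bits x)"
  by (cases msg rule: parse.cases) auto

lemma length_1_conv: "length xs = 1 \<longleftrightarrow> (\<exists>x. xs = [x])"
  by (auto simp: length_Suc_conv)

lemma req_key_Some:
  assumes "req_key P N cs v = Some i"
  obtains s where "parse (map (\<lambda>C. run C v) cs) = Lookup i (req_name P N cs v) (req_nonce P N cs v) s"
    "i < nodes P"
proof -
  have ws: "well_shaped P N cs" and c0: "run (cs ! 0) v = [False]"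
    and i: "i = nat_of_bits (run (cs ! 2) v)" "i < nodes P"
    using assms by (auto simp: req_key_def split: if_splits)
  obtain a b c d e where cs: "cs = [a, b, c, d, e]"
    using ws by (auto simp: well_shaped_def numeral_eq_Suc length_Suc_conv)
  obtain j where j: "run b v = [j]"
    using ws length_1_conv[of "run b v"] by (auto simp: well_shaped_def cs)
  show ?thesis
    by (rule that[of "run e v"])
      (use ws c0 i j in \<open>simp_all add: parse_Lookup_iff cs req_name_def req_nonce_def\<close>)
qed

text \<open>One regular lookup suffices to establish the static shape, since output lengths do not
  depend on the view.\<close>

lemma req_key_Lookup:
  assumes "parse (map (\<lambda>C. run C v) cs) = Lookup i j n s" "i < nodes P" "length n = nonce_len P N"
  shows "req_key P N cs v = Some i" "req_name P N cs v = j" "req_nonce P N cs v = n"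
proof -
  obtain x where x: "map (\<lambda>C. run C v) cs = [[False], [j], x, n, s]" "i = nat_of_bits x"
    using assms(1) by (auto simp: parse_Lookup_iff)
  then obtain a b c d e where cs: "cs = [a, b, c, d, e]"
    by (auto simp: map_eq_Cons_conv)
  have r: "run a v = [False]" "run b v = [j]" "run c v = x" "run d v = n" using x by (auto simp: cs)
  have "length (outputs a) = 1" "length (outputs b) = 1" "length (outputs d) = nonce_len P N"
    using r assms(3) length_run[of a v] length_run[of b v] length_run[of d v] by simp_all
  then have "well_shaped P N cs" by (simp add: well_shaped_def cs)
  then show "req_key P N cs v = Some i" "req_name P N cs v = j" "req_nonce P N cs v = n"
    using r x(2) assms(2) by (auto simp: req_key_def req_name_def req_nonce_def cs)
qed

text \<open>\<open>recipient_reply\<close> never answers, so a contact request can at most add to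
  \<open>mail\<close>. No answer depends on that field, and \<open>used\<close>, which decides about
  later lookups, is untouched.\<close>

lemma discovery_oracle_silent:
  assumes "\<And>i. req_key P N cs v = Some i \<Longrightarrow> req_nonce P N cs v \<in> used \<sigma> i"
  obtains \<sigma>' where "discovery_oracle P N pki k sks db name \<sigma> (map (\<lambda>C. run C v) cs)
      = return_pmf (encode_answer P N None, \<sigma>')" "used \<sigma>' = used \<sigma>"
proof -
  let ?m = "map (\<lambda>C. run C v) cs"
  consider (lookup) i j n s where "parse ?m = Lookup i j n s"
    | (contact) i hdr pl where "parse ?m = ContactInit i hdr pl" | (bad) "parse ?m = Malformed"
    by (cases "parse ?m") auto
  then show ?thesis
  proof cases
    case lookup
    have "\<not> (i < nodes P \<and> length n = nonce_len P N \<and> n \<notin> used \<sigma> i)"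
      using req_key_Lookup[OF lookup] assms by blast
    then show ?thesis
      by (intro that[of \<sigma>]) (auto simp: discovery_oracle_def serve_def lookup)
  next
    case contact
    show ?thesis
    proof (cases "\<exists>d. map_of (issued \<sigma>) hdr = Some d \<and> i < nodes P \<and> d \<noteq> fake P N")
      case True
      then obtain d where "map_of (issued \<sigma>) hdr = Some d" "i < nodes P" "d \<noteq> fake P N" by blast
      then show ?thesis
        by (intro that[of "\<sigma>\<lparr>mail := (d, hdr @ pl) # mail \<sigma>\<rparr>"])
          (simp_all add: discovery_oracle_def serve_def contact recipient_reply_def)
    next
      case False
      then show ?thesis
        by (intro that[of \<sigma>]) (auto simp: discovery_oracle_def serve_def contact split: option.split)
    qed
  next
    case bad
    then show ?thesis by (intro that[of \<sigma>]) (simp_all add: discovery_oracle_def serve_def)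
  qed
qed

text \<open>The coins \<open>r'\<close> sign the message to the owner. They affect the new state
  through \<open>mail\<close> only, and hence not the field \<open>used\<close> that the simulator
  tracks.\<close>

lemma discovery_oracle_answer:
  assumes key: "req_key P N cs v = Some i" and fresh: "req_nonce P N cs v \<notin> used \<sigma> i"
    and dest: "\<And>j. (case db (name j) of Some d \<Rightarrow> d | None \<Rightarrow> fake P N) = dest j"
    and n_def: "n = req_nonce P N cs v"
    and z_def: "z = (if req_name P N cs v then snd else fst) (node_samples P N pki dest name k n)"
  obtains \<sigma>' where "discovery_oracle P N pki k sks db name \<sigma> (map (\<lambda>C. run C v) cs) =
      do { r \<leftarrow> uniform_bits (sig_rand_len P N); r' \<leftarrow> uniform_bits (sig_rand_len P N);
           return_pmf (encode_answer P N (Some (n @ z @ sign P N (sks ! i) (n @ z) r)), \<sigma>' r') }"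
    "\<And>r'. used (\<sigma>' r') = (used \<sigma>)(i := insert n (used \<sigma> i))"
proof -
  obtain s where parse: "parse (map (\<lambda>C. run C v) cs) = Lookup i (req_name P N cs v) n s"
    and i: "i < nodes P"
    using req_key_Some[OF key] unfolding n_def by blast
  let ?j = "req_name P N cs v"
  obtain d surb y bpk where der: "derive_surb P N pki k db (name ?j) n = (d, surb, y, bpk)"
    by (metis prod_cases4)
  have z: "surb @ bpk = z"
    using der dest[of ?j]
    by (auto simp: derive_surb_def Let_def z_def node_samples_def sample_def sample_of_def)
  have fresh': "n \<notin> used \<sigma> i" "length n = nonce_len P N" using fresh by (simp_all add: n_def)
  let ?y = "bits_of_nat (exp_len P N) y"
  have "discovery_oracle P N pki k sks db name \<sigma> (map (\<lambda>C. run C v) cs) =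
      do { r \<leftarrow> uniform_bits (sig_rand_len P N); r' \<leftarrow> uniform_bits (sig_rand_len P N);
           return_pmf (encode_answer P N (Some (n @ z @ sign P N (sks ! i) (n @ z) r)),
             \<sigma>\<lparr>used := (used \<sigma>)(i := insert n (used \<sigma> i)), issued := (surb, d) # issued \<sigma>,
               mail := (if name ?j \<in> dom db then (d, n @ ?y @ sign P N (sks ! i) (n @ ?y) r') # mail \<sigma>
                        else mail \<sigma>)\<rparr>) }"
    using fresh' i
    by (simp add: discovery_oracle_def serve_def parse der Let_def map_bind_pmf flip: z)
  then show ?thesis by (rule that) simp
qed

text \<open>The invariant matches the nodes' used nonces with the table entries for that node.
  Signature coins are drawn in advance for every round, answered or not; this does not change the
  distribution and allows them to be hard-wired later.\<close>

lemma interact_discovery: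
  assumes dest: "\<And>j. (case db (name j) of Some d \<Rightarrow> d | None \<Rightarrow> fake P N) = dest j"
    and used: "\<And>i n. n \<in> used \<sigma> i \<longleftrightarrow> replayed (Some i) n tab"
    and tab: "\<forall>e\<in>set tab. snd (snd e) = node_samples P N pki dest name k (fst (snd e))"
  shows "interact (discovery_oracle P N pki k sks db name) rs v \<sigma> =
    map_pmf (\<lambda>\<rho>s. fst (fold (fun_step P N sks (node_samples P N pki dest name k)) (zip rs \<rho>s) (v, tab)))
      (replicate_pmf (length rs) (uniform_bits (sig_rand_len P N)))"
  using used tab
proof (induction rs arbitrary: v \<sigma> tab)
  case Nil
  then show ?case by simp
next
  case (Cons cs rs)
  let ?f = "node_samples P N pki dest name k" and ?U = "uniform_bits (sig_rand_len P N)"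
  let ?orc = "discovery_oracle P N pki k sks db name"
  let ?R = "replicate_pmf (length rs) ?U"
  define key where "key = req_key P N cs v"
  define n where "n = req_nonce P N cs v"
  define tab' where "tab' = (key, n, ?f n) # tab"
  have look: "lookup n tab (?f n) = ?f n" by (rule lookup_consistent) (rule Cons.prems(2))
  have step: "fun_step P N sks ?f (cs, \<rho>) (v, tab) =
      (v @ sim_answer P N sks key n (replayed key n tab) ((if req_name P N cs v then snd else fst) (?f n)) \<rho>, tab')" for \<rho>
    by (simp add: fun_step_def sim_step_def Let_def key_def[symmetric] n_def[symmetric] look tab'_def)
  have tab'_ok: "\<forall>e\<in>set tab'. snd (snd e) = ?f (fst (snd e))" using Cons.prems(2) by (simp add: tab'_def)
  have rhs: "map_pmf (\<lambda>\<rho>s. fst (fold (fun_step P N sks ?f) (zip (cs # rs) \<rho>s) (v, tab))) (replicate_pmf (length (cs # rs)) ?U) =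
      do { \<rho> \<leftarrow> ?U; map_pmf (\<lambda>\<rho>s. fst (fold (fun_step P N sks ?f) (zip rs \<rho>s) (fun_step P N sks ?f (cs, \<rho>) (v, tab)))) ?R }"
    by (simp add: map_bind_pmf map_pmf_def bind_assoc_pmf bind_return_pmf)
  show ?case
  proof (cases "\<forall>i. key = Some i \<longrightarrow> n \<in> used \<sigma> i")
    case True
    then obtain \<sigma>' where \<sigma>': "?orc \<sigma> (map (\<lambda>C. run C v) cs) = return_pmf (encode_answer P N None, \<sigma>')"
      "used \<sigma>' = used \<sigma>"
      using discovery_oracle_silent[of P N cs v \<sigma>] unfolding key_def n_def by blast
    have ans: "sim_answer P N sks key n (replayed key n tab) z \<rho> = encode_answer P N None" for z \<rho>
      using True Cons.prems(1) by (auto simp: sim_answer_def split: option.split)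
    have used': "m \<in> used \<sigma>' i \<longleftrightarrow> replayed (Some i) m tab'" for i m
      using True Cons.prems(1) \<sigma>'(2) by (auto simp: tab'_def replayed_def)
    show ?thesis
      unfolding rhs step ans
      by (simp add: \<sigma>'(1) bind_return_pmf Cons.IH[OF used' tab'_ok])
  next
    case False
    then obtain i where i: "key = Some i" "n \<notin> used \<sigma> i" by blast
    let ?z = "(if req_name P N cs v then snd else fst) (?f n)"
    obtain \<sigma>' where \<sigma>': "?orc \<sigma> (map (\<lambda>C. run C v) cs) =
      do { r \<leftarrow> ?U; r' \<leftarrow> ?U;
           return_pmf (encode_answer P N (Some (n @ ?z @ sign P N (sks ! i) (n @ ?z) r)), \<sigma>' r') }"
      "\<And>r'. used (\<sigma>' r') = (used \<sigma>)(i := insert n (used \<sigma> i))"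
      using discovery_oracle_answer[where db = db and name = name and dest = dest and pki = pki
          and k = k and sks = sks, OF i(1)[unfolded key_def] i(2)[unfolded n_def] dest n_def refl] by blast
    have ans: "sim_answer P N sks key n (replayed key n tab) ?z \<rho> =
        encode_answer P N (Some (n @ ?z @ sign P N (sks ! i) (n @ ?z) \<rho>))" for \<rho>
      using i Cons.prems(1) by (simp add: sim_answer_def)
    have used': "m \<in> used (\<sigma>' r') i' \<longleftrightarrow> replayed (Some i') m tab'" for r' i' m
      using Cons.prems(1) i by (auto simp: \<sigma>'(2) tab'_def replayed_def)
    show ?thesis
      unfolding rhs step ans
      by (simp add: \<sigma>'(1) bind_assoc_pmf bind_return_pmf Cons.IH[OF used' tab'_ok])
  qed
qed

section \<open>The reduction to the security of the key derivation function\<close>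

definition seeded ::
  "system \<Rightarrow> nat \<Rightarrow> bits list \<Rightarrow> (circuit list \<times> bits) list \<Rightarrow> bits \<Rightarrow> bits \<Rightarrow> (bool \<Rightarrow> contact) \<Rightarrow> nat \<Rightarrow>
   bits list \<Rightarrow> bits \<times> entry list" where
  "seeded P N sks ls pki v dest r ss =
     sim_fold P N sks ls (\<lambda>t. sample P N pki (dest (odd t)) (ss ! t)) [0..<r] (v, [])"

lemma sim_fold_cong:
  assumes "\<And>r. r \<in> set rs \<Longrightarrow> Z (2 * r) = Z' (2 * r) \<and> Z (2 * r + 1) = Z' (2 * r + 1)"
  shows "sim_fold P N sks ls Z rs s = sim_fold P N sks ls Z' rs s"
  unfolding sim_fold_def using assms by (intro fold_cong) auto

lemma seeded_0: "seeded P N sks ls pki v dest 0 ss = (v, [])"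
  by (simp add: seeded_def sim_fold_def)

lemma seeded_append:
  assumes "2 * r \<le> length ss"
  shows "seeded P N sks ls pki v dest r (ss @ us) = seeded P N sks ls pki v dest r ss"
  unfolding seeded_def using assms by (intro sim_fold_cong) (auto simp: nth_append)

lemma seeded_Suc:
  assumes "length ss = 2 * r"
  shows "seeded P N sks ls pki v dest (Suc r) (ss @ a # b # us) =
    sim_step P N sks (ls ! r) (sample P N pki (dest False) a, sample P N pki (dest True) b)
      (seeded P N sks ls pki v dest r ss)"
proof -
  let ?Z = "\<lambda>ss t. sample P N pki (dest (odd t)) (ss ! t)"
  have "seeded P N sks ls pki v dest (Suc r) (ss @ a # b # us) =
      sim_step P N sks (ls ! r) (?Z (ss @ a # b # us) (2 * r), ?Z (ss @ a # b # us) (2 * r + 1))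
        (seeded P N sks ls pki v dest r (ss @ a # b # us))"
    by (simp add: seeded_def sim_fold_def)
  then show ?thesis using assms by (simp add: seeded_append nth_append)
qed

lemma seeded_from:
  assumes "r \<le> R"
  shows "seeded P N sks ls pki v dest R ss =
    sim_fold P N sks ls (\<lambda>t. sample P N pki (dest (odd t)) (ss ! t)) [r..<R] (seeded P N sks ls pki v dest r ss)"
proof -
  have "[0..<R] = [0..<r] @ [r..<R]" using assms upt_add_eq_append[of 0 r "R - r"] by simp
  then show ?thesis by (simp add: seeded_def sim_fold_def)
qed

text \<open>Each round of the adversary costs two queries, one for each username, because the username
  it asks for is not known when the circuits are built.\<close>

definition queries :: "(nat \<Rightarrow> bool \<Rightarrow> circuit) \<Rightarrow> nat \<Rightarrow> nat \<Rightarrow> circuit list list" where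
  "queries Q r R = concat (map (\<lambda>r. [[Q r False], [Q r True]]) [r..<R])"

lemma queries_step: "r < R \<Longrightarrow> queries Q r R = [Q r False] # [Q r True] # queries Q (Suc r) R"
  by (simp add: queries_def upt_conv_Cons)

lemma queries_end: "queries Q R R = []"
  by (simp add: queries_def)

definition seeds :: "system \<Rightarrow> nat \<Rightarrow> nat \<Rightarrow> bits list set" where
  "seeds P N m = {ss. length ss = m \<and> (\<forall>s\<in>set ss. length s = seed_len P N)}"

lemma seeds_snoc: "ss \<in> seeds P N m \<Longrightarrow> length s = seed_len P N \<Longrightarrow> ss @ [s] \<in> seeds P N (Suc m)"
  by (auto simp: seeds_def)

text \<open>The reduction has no input of its own, so its view is the concatenation of the seeds
  received. From it \<open>Q r j\<close> recomputes the simulated game up to round \<open>r\<close>;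
  the additional seed present at the second query of a round is ignored.\<close>

locale kdf_reduction =
  fixes P :: system and N :: nat and sks :: "bits list" and ls :: "(circuit list \<times> bits) list"
    and pki v :: bits and dest :: "bool \<Rightarrow> contact" and name :: "bool \<Rightarrow> bits"
    and Q :: "nat \<Rightarrow> bool \<Rightarrow> circuit"
  assumes wf: "well_formed P" and names: "name False \<noteq> name True"
    and Q: "\<And>r j ss. r < length ls \<Longrightarrow> ss \<in> seeds P N (2 * r + of_bool j) \<Longrightarrow>
      run (Q r j) (concat ss) = req_nonce P N (fst (ls ! r)) (fst (seeded P N sks ls pki v dest r ss)) @ name j"
begin

abbreviation "state \<equiv> seeded P N sks ls pki v dest"
abbreviation "R \<equiv> length ls"
abbreviation "nonce r ss \<equiv> req_nonce P N (fst (ls ! r)) (fst (state r ss))"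

lemma Q_first:
  assumes "r < R" "ss \<in> seeds P N (2 * r)"
  shows "run (Q r False) (concat ss) = nonce r ss @ name False"
  using Q[OF assms(1), of ss False] assms(2) by simp

lemma Q_second:
  assumes "r < R" "ss \<in> seeds P N (2 * r)" "length a = seed_len P N"
  shows "run (Q r True) (concat ss @ a) = nonce r ss @ name True"
  using Q[OF assms(1), of "ss @ [a]" True] seeds_snoc[OF assms(2,3)] assms(2)
  by (simp add: seeded_append seeds_def)

text \<open>The oracle appends the key to nonce and username, which gives the string a node feeds to
  the KDF. Repeated nonces need no separate case: both sides perform the same step with the same
  pair of strings.\<close>

lemma interact_kdf:
  assumes "r \<le> R" "ss \<in> seeds P N (2 * r)"
  shows "\<exists>ss'\<in>seeds P N (2 * R). interact (kdf_oracle P N) (queries Q r R) (concat ss) k = return_pmf (concat ss') \<and>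
    state R ss' = fold (fun_step P N sks (node_samples P N pki dest name k)) (drop r ls) (state r ss)"
  using assms
proof (induction "R - r" arbitrary: r ss)
  case 0
  then show ?case by (intro bexI[of _ ss]) (simp_all add: queries_end)
next
  case (Suc m)
  then have r: "r < R" by simp
  let ?n = "nonce r ss"
  let ?a = "kdf P N (?n @ name False @ k)" and ?b = "kdf P N (?n @ name True @ k)"
  have len: "length (kdf P N x) = seed_len P N" for x using wf by (simp add: well_formed_def)
  have ss: "ss @ [?a, ?b] \<in> seeds P N (2 * Suc r)" using Suc.prems len by (auto simp: seeds_def)
  have step: "interact (kdf_oracle P N) (queries Q r R) (concat ss) k =
      interact (kdf_oracle P N) (queries Q (Suc r) R) (concat (ss @ [?a, ?b])) k"
    using Q_first[OF r Suc.prems(2)] Q_second[OF r Suc.prems(2) len]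
    by (simp add: queries_step[OF r] kdf_oracle_def bind_return_pmf)
  have "length ss = 2 * r" using Suc.prems by (simp add: seeds_def)
  then have "state (Suc r) (ss @ [?a, ?b]) =
      fun_step P N sks (node_samples P N pki dest name k) (ls ! r) (state r ss)"
    by (simp add: seeded_Suc fun_step_def node_samples_def)
  moreover have "drop r ls = ls ! r # drop (Suc r) ls" using r by (simp add: Cons_nth_drop_Suc)
  ultimately show ?case
    using Suc.hyps(1)[of "Suc r" "ss @ [?a, ?b]"] Suc.hyps(2) r ss unfolding step by simp
qed

abbreviation "nonces tab \<equiv> (\<lambda>e. fst (snd e)) ` set tab"
abbreviation "samples a b \<equiv> (sample P N pki (dest False) a, sample P N pki (dest True) b)"

definition seeds_known :: "(bits \<rightharpoonup> bits) \<Rightarrow> entry list \<Rightarrow> bits \<Rightarrow> bits \<Rightarrow> bits \<Rightarrow> bool" where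
  "seeds_known T tab n a b \<longleftrightarrow> T (n @ name False) = Some a \<and> T (n @ name True) = Some b \<and>
     length a = seed_len P N \<and> length b = seed_len P N \<and>
     (\<forall>e\<in>set tab. fst (snd e) = n \<longrightarrow> snd (snd e) = samples a b)"

text \<open>A nonce has either both of its values sampled or neither. Only strings of nonce length
  are considered, since for them the concatenation with a username determines the nonce.\<close>

definition table_ok :: "(bits \<rightharpoonup> bits) \<Rightarrow> entry list \<Rightarrow> bool" where
  "table_ok T tab \<longleftrightarrow> (\<forall>n. length n = nonce_len P N \<longrightarrow>
     (if n \<in> nonces tab then \<exists>a b. seeds_known T tab n a b
      else T (n @ name False) = None \<and> T (n @ name True) = None))"

lemma lookup_mem:
  "n \<in> nonces tab \<Longrightarrow> \<exists>e\<in>set tab. fst (snd e) = n \<and> lookup n tab y = snd (snd e)"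
  by (induction tab) auto

lemma lookup_not_mem: "n \<notin> nonces tab \<Longrightarrow> lookup n tab y = y"
  by (induction tab) auto

lemma snd_sim_step: "snd (sim_step P N sks l z s) =
  (req_key P N (fst l) (fst s), req_nonce P N (fst l) (fst s), lookup (req_nonce P N (fst l) (fst s)) (snd s) z) # snd s"
  by (simp add: sim_step_def Let_def)

text \<open>The right side draws two fresh seeds in every round, whereas the random function repeats
  its values on an old nonce. The views agree because in that case the table already holds the
  strings and the new seeds have no effect.\<close>

lemma interact_random:
  assumes h: "\<And>ss. ss \<in> seeds P N (2 * R) \<Longrightarrow> h (concat ss) = H (fst (state R ss))"
    and "r \<le> R" "ss \<in> seeds P N (2 * r)" "table_ok T (snd (state r ss))"
  shows "map_pmf h (interact (random_function_oracle P N) (queries Q r R) (concat ss) T) =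
    map_pmf (\<lambda>us. H (fst (state R (ss @ us)))) (replicate_pmf (2 * (R - r)) (uniform_bits (seed_len P N)))"
  using assms(2-4)
proof (induction "R - r" arbitrary: r ss T)
  case 0
  then show ?case by (simp add: queries_end h)
next
  case (Suc m)
  then have r: "r < R" by simp
  let ?U = "uniform_bits (seed_len P N)"
  define n where "n = nonce r ss"
  define tab where "tab = snd (state r ss)"
  have ss: "length ss = 2 * r" using Suc.prems by (simp add: seeds_def)
  have len_n: "length n = nonce_len P N" by (simp add: n_def)
  have T: "table_ok T tab" using Suc.prems by (simp add: tab_def)
  let ?us = "replicate_pmf (2 * (R - Suc r)) ?U"
  have "2 * (R - r) = Suc (Suc (2 * (R - Suc r)))" using r by simp
  then have rhs: "map_pmf (\<lambda>us. H (fst (state R (ss @ us)))) (replicate_pmf (2 * (R - r)) ?U) =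
      do { a \<leftarrow> ?U; b \<leftarrow> ?U; map_pmf (\<lambda>us. H (fst (state R ((ss @ [a, b]) @ us)))) ?us }"
    by (simp add: map_bind_pmf map_pmf_def bind_assoc_pmf bind_return_pmf)
  have IH: "map_pmf h (interact (random_function_oracle P N) (queries Q (Suc r) R) (concat (ss @ [a, b])) T') =
      map_pmf (\<lambda>us. H (fst (state R ((ss @ [a, b]) @ us)))) ?us"
    if "length a = seed_len P N" "length b = seed_len P N" "table_ok T' (snd (state (Suc r) (ss @ [a, b])))" for a b T'
    using that Suc.prems r Suc.hyps(2)
    by (intro Suc.hyps(1)) (auto simp: seeds_def)
  have state_Suc: "state (Suc r) (ss @ [a, b]) = sim_step P N sks (ls ! r)
      (samples a b) (state r ss)" for a b
    using seeded_Suc[OF ss] by simp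
  have tab_Suc: "snd (state (Suc r) (ss @ [a, b])) = (req_key P N (fst (ls ! r)) (fst (state r ss)), n,
      lookup n tab (samples a b)) # tab" for a b
    by (simp add: state_Suc snd_sim_step n_def tab_def)
  show ?case
  proof (cases "n \<in> nonces tab")
    case True
    then obtain a b where known: "seeds_known T tab n a b"
      using T len_n unfolding table_ok_def by presburger
    then have ab: "T (n @ name False) = Some a" "T (n @ name True) = Some b"
      "length a = seed_len P N" "length b = seed_len P N"
      "\<forall>e\<in>set tab. fst (snd e) = n \<longrightarrow> snd (snd e) = samples a b"
      by (simp_all add: seeds_known_def)
    have lookup: "lookup n tab y = samples a b" for y
      using lookup_mem[OF True, of y] ab(5) by auto
    let ?tab = "snd (state (Suc r) (ss @ [a, b]))"
    have "n' \<in> nonces ?tab \<longleftrightarrow> n' \<in> nonces tab" for n'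
      using True by (auto simp: tab_Suc)
    moreover have "seeds_known T ?tab n' x y \<longleftrightarrow> seeds_known T tab n' x y" for n' x y
      using ab unfolding tab_Suc lookup seeds_known_def by auto
    ultimately have ok: "table_ok T ?tab" using T by (simp add: table_ok_def)
    \<comment> \<open>With the nonce in the table, the step ignores its pair of samples, and later
      rounds use other positions of the seed list.\<close>
    have same: "state R ((ss @ [x, y]) @ us) = state R ((ss @ [a, b]) @ us)" for x y us
    proof -
      have "state (Suc r) ((ss @ [x, y]) @ us) = state (Suc r) ((ss @ [a, b]) @ us)"
        using ss unfolding sim_step_def Let_def append_assoc append_Cons append_Nil seeded_Suc[OF ss]
        by (simp add: n_def[symmetric] tab_def[symmetric] lookup)
      then show ?thesis
        unfolding seeded_from[of "Suc r" R, OF Suc_leI[OF r]]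
        by (simp only:) (rule sim_fold_cong, simp add: nth_append ss)
    qed
    have "interact (random_function_oracle P N) (queries Q r R) (concat ss) T =
        interact (random_function_oracle P N) (queries Q (Suc r) R) (concat (ss @ [a, b])) T"
      using Q_first[OF r Suc.prems(2)] Q_second[OF r Suc.prems(2) ab(3)] ab(1,2)
      by (simp add: queries_step[OF r] random_function_oracle_def bind_return_pmf n_def)
    moreover have "do { x \<leftarrow> ?U; y \<leftarrow> ?U; map_pmf (\<lambda>us. H (fst (state R ((ss @ [x, y]) @ us)))) ?us } =
        do { x \<leftarrow> ?U; y \<leftarrow> ?U; map_pmf (\<lambda>us. H (fst (state R ((ss @ [a, b]) @ us)))) ?us }"
      by (intro bind_pmf_cong map_pmf_cong refl arg_cong[where f = "\<lambda>s. H (fst s)", OF same])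
    ultimately show ?thesis
      unfolding rhs using IH[OF ab(3,4) ok] by simp
  next
    case False
    then have None: "T (n @ name False) = None" "T (n @ name True) = None"
      using T len_n unfolding table_ok_def by auto
    have ok: "table_ok (T(n @ name False \<mapsto> a, n @ name True \<mapsto> b)) (snd (state (Suc r) (ss @ [a, b])))"
      if "length a = seed_len P N" "length b = seed_len P N" for a b
      unfolding table_ok_def
    proof (intro allI impI)
      fix n' :: bits assume n': "length n' = nonce_len P N"
      let ?T = "T(n @ name False \<mapsto> a, n @ name True \<mapsto> b)" and ?tab = "snd (state (Suc r) (ss @ [a, b]))"
      show "if n' \<in> nonces ?tab then \<exists>x y. seeds_known ?T ?tab n' x y
        else ?T (n' @ name False) = None \<and> ?T (n' @ name True) = None"
      proof (cases "n' = n")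
        case True
        have "e \<notin> set tab" if "fst (snd e) = n" for e using that False by blast
        \<comment> \<open>Distinct usernames keep the second update from overwriting the
          first.\<close>
        then have "seeds_known ?T ?tab n a b"
          using that names unfolding seeds_known_def tab_Suc lookup_not_mem[OF False] by auto
        then show ?thesis using True by (auto simp: tab_Suc)
      next
        case neq: False
        \<comment> \<open>Both nonces have \<open>nonce_len\<close> bits, so different nonces give
          different queries even if the usernames differ in length.\<close>
        have "n' @ name j \<noteq> n @ name j'" for j j' using neq n' len_n by simp
        then have upd: "?T (n' @ name j) = T (n' @ name j)" for j by simp
        have "n' \<in> nonces ?tab \<longleftrightarrow> n' \<in> nonces tab" using neq by (auto simp: tab_Suc)
        moreover have "seeds_known ?T ?tab n' x y \<longleftrightarrow> seeds_known T tab n' x y" for x y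
          using neq unfolding seeds_known_def upd tab_Suc by auto
        ultimately show ?thesis
          using T[unfolded table_ok_def, rule_format, OF n'] unfolding upd by simp
      qed
    qed
    have "interact (random_function_oracle P N) (queries Q r R) (concat ss) T =
        do { a \<leftarrow> ?U; b \<leftarrow> ?U; interact (random_function_oracle P N) (queries Q (Suc r) R) (concat (ss @ [a, b]))
               (T(n @ name False \<mapsto> a, n @ name True \<mapsto> b)) }"
      using Q_first[OF r Suc.prems(2)] Q_second[OF r Suc.prems(2)] None names
      by (auto simp: queries_step[OF r] random_function_oracle_def bind_return_pmf bind_assoc_pmf n_def[symmetric]
          intro!: bind_pmf_cong)
    then show ?thesis
      unfolding rhs by (simp only: map_bind_pmf) (intro bind_pmf_cong refl IH ok; simp)
  qed
qed

end

section \<open>Circuits of the reductions\<close>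

lemma ppoly_circuits:
  assumes "ppoly D g f"
  obtains C c where "\<And>N i. circuit_size (C N i) \<le> (N + 2) ^ c"
    "\<And>N i e. e \<in> D N i \<Longrightarrow> run (C N i) (g N i e) = f N i e"
proof -
  obtain s where s: "poly_on D s" "\<And>N i. reducible (D N i) (s N i) (g N i) (f N i)"
    using assms unfolding ppoly_def by blast
  obtain c where c: "\<And>N i. D N i \<noteq> {} \<Longrightarrow> s N i \<le> (N + 2) ^ c"
    using s(1) unfolding poly_on_def by blast
  have "\<exists>C. circuit_size C \<le> (N + 2) ^ c \<and> (\<forall>e\<in>D N i. run C (g N i e) = f N i e)" for N i
  proof -
    have "reducible (D N i) ((N + 2) ^ c) (g N i) (f N i)"
    proof (cases "D N i = {}")
      case False
      then show ?thesis using reducible_mono[OF s(2) c] by blast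
    qed (simp add: reducible_empty)
    then show ?thesis unfolding reducible_def by blast
  qed
  then show ?thesis using that by metis
qed

definition seed_env :: "system \<Rightarrow> (nat \<Rightarrow> nat) \<Rightarrow> nat \<Rightarrow> nat \<times> nat \<Rightarrow> bits list set" where
  "seed_env P R N i = {ss \<in> seeds P N (snd i). fst i \<le> R N \<and> 2 * fst i \<le> snd i \<and> snd i \<le> 2 * R N}"

lemma queries_size:
  assumes "\<And>r j. circuit_size (Q r j) \<le> S"
  shows "length (queries Q r R) = 2 * (R - r)"
    and "(\<Sum>cs\<leftarrow>queries Q r R. length cs + (\<Sum>C\<leftarrow>cs. circuit_size C)) \<le> (R - r) * (2 * (1 + S))"
proof -
  have "length (queries Q r R) = 2 * (R - r) \<and>
    (\<Sum>cs\<leftarrow>queries Q r R. length cs + (\<Sum>C\<leftarrow>cs. circuit_size C)) \<le> (R - r) * (2 * (1 + S))"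
  proof (induction "R - r" arbitrary: r)
    case 0
    then show ?case by (simp add: queries_def)
  next
    case (Suc m)
    then have r: "r < R" and m: "m = R - Suc r" by simp_all
    show ?case using Suc.hyps(1)[OF m] assms[of r False] assms[of r True]
      unfolding Suc.hyps(2)[symmetric] m[symmetric] queries_step[OF r] by simp
  qed
  then show "length (queries Q r R) = 2 * (R - r)"
    "(\<Sum>cs\<leftarrow>queries Q r R. length cs + (\<Sum>C\<leftarrow>cs. circuit_size C)) \<le> (R - r) * (2 * (1 + S))" by auto
qed

lemma uniform_bits_0: "uniform_bits 0 = return_pmf []"
  by (simp add: uniform_bits_def pmf_of_set_singleton)

lemma adversary_size_bounds:
  "coins A \<le> adversary_size A" "length (rounds A) \<le> adversary_size A"
  "circuit_size (guess A) \<le> adversary_size A"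
  "(\<Sum>cs\<leftarrow>rounds A. \<Sum>C\<leftarrow>cs. circuit_size C) \<le> adversary_size A"
proof -
  have "(\<Sum>cs\<leftarrow>rounds A. \<Sum>C\<leftarrow>cs. circuit_size C) \<le> (\<Sum>cs\<leftarrow>rounds A. length cs + (\<Sum>C\<leftarrow>cs. circuit_size C))"
    by (intro sum_list_mono) simp
  then show "(\<Sum>cs\<leftarrow>rounds A. \<Sum>C\<leftarrow>cs. circuit_size C) \<le> adversary_size A"
    by (simp add: adversary_size_def)
qed (simp_all add: adversary_size_def)

context simulation
begin

text \<open>The seeds are expanded to samples, which then form the environment of
  \<open>ppoly_sim_fold\<close>. The directory is a constant here, as the KDF challenge does not
  involve it.\<close>

lemma ppoly_seeded:
  assumes pki: "\<And>N. pki N \<in> set_pmf (pki_gen P N)"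
    and dest: "\<And>N j. valid_contact P N (dest N j)"
  shows "ppoly (seed_env P R) (\<lambda>N i ss. concat ss)
    (\<lambda>N i ss. fst (seeded P N (sks N) (ls N) (pki N) (pki N @ w N) (dest N) (fst i) ss))"
proof -
  let ?D = "seed_env P R" and ?g = "\<lambda>(N::nat) (i :: nat \<times> nat) (ss :: bits list). concat ss"
  let ?z = "\<lambda>N ss t. sample P N (pki N) (dest N (odd t)) (ss ! t)"
  let ?zs = "\<lambda>N i ss. map (?z N ss) [0..<snd i]"
  have m: "poly_on ?D (\<lambda>N i. snd i)"
    using poly_on_mult[OF poly_on_const[of ?D 2] poly_onI[OF R]]
    by (rule poly_on_mono) (auto simp: seed_env_def)
  have gg: "ppoly ?D ?g ?g"
  proof (rule ppoly_id)
    show "length (concat ss) = snd i * seed_len P N" if "ss \<in> ?D N i" for N i ss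
      using that length_concat_const[of ss] by (auto simp: seed_env_def seeds_def)
    show "poly_on ?D (\<lambda>N i. snd i * seed_len P N)"
      by (intro poly_on_mult m poly_onI well_formed_poly wf)
  qed
  have zs: "ppoly ?D ?g (\<lambda>N i ss. concat (?zs N i ss))"
  proof (rule ppoly_concat[OF _ m])
    let ?E = "indexed (\<lambda>(N::nat) i. snd i) ?D"
    have seed: "ppoly ?E (\<lambda>N j. concat) (\<lambda>N j ss. ss ! snd j)"
      by (rule ppoly_concat_nth[OF ppoly_indexed[OF gg]]) (auto simp: seed_env_def seeds_def)
    have "ppoly ?E (\<lambda>N j. concat) (\<lambda>N j ss. pki N)"
      by (intro ppoly_const ppoly_fixed_length_base[OF seed])
        (simp add: pki_length[OF wf pki] poly_onI well_formed_poly wf)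
    then show "ppoly ?E (\<lambda>N j. concat) (\<lambda>N j ss. ?z N ss (snd j))"
      by (rule ppoly_sample[OF wf eff dest _ pki seed]) (auto simp: seed_env_def seeds_def)
    show "fixed_length (?D N i) concat" for N i using ppoly_fixed_length[OF gg] .
  qed
  have "ppoly ?D ?g (\<lambda>N i ss. pki N)"
    by (intro ppoly_const ppoly_fixed_length[OF gg])
      (simp add: pki_length[OF wf pki] poly_onI well_formed_poly wf)
  from ppoly_append[OF this zs]
  have "ppoly ?D ?g (\<lambda>N i ss. fst (pki N, ?zs N i ss) @ concat (snd (pki N, ?zs N i ss)))" by simp
  moreover have "ppoly ?D (\<lambda>N i ss. fst (pki N, ?zs N i ss) @ concat (snd (pki N, ?zs N i ss)))
    (\<lambda>N i ss. fst (sim_fold P N (sks N) (ls N) (\<lambda>t. snd (pki N, ?zs N i ss) ! t) [0..<fst i]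
       (fst (pki N, ?zs N i ss) @ w N, [])))"
  proof (rule ppoly_map[OF ppoly_sim_fold, where \<pi> = "\<lambda>_ i. i"])
    fix N i ss assume "ss \<in> ?D N i"
    then show "(pki N, ?zs N i ss) \<in> sim_env P R N i"
      by (auto simp: sim_env_def seed_env_def seeds_def pki_length[OF wf pki]
          intro!: length_sample[OF wf dest pki])
  qed
  ultimately have "ppoly ?D ?g (\<lambda>N i ss. fst (sim_fold P N (sks N) (ls N) (\<lambda>t. snd (pki N, ?zs N i ss) ! t) [0..<fst i]
       (fst (pki N, ?zs N i ss) @ w N, [])))"
    by (rule ppoly_comp)
  then show ?thesis
  proof (rule ppoly_cong)
    fix N i ss assume "ss \<in> ?D N i"
    then show "fst (sim_fold P N (sks N) (ls N) (\<lambda>t. snd (pki N, ?zs N i ss) ! t) [0..<fst i]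
       (fst (pki N, ?zs N i ss) @ w N, [])) =
       fst (seeded P N (sks N) (ls N) (pki N) (pki N @ w N) (dest N) (fst i) ss)"
      unfolding seeded_def
      by (intro arg_cong[where f = fst]) (auto simp: seed_env_def intro!: sim_fold_cong)
  qed
qed

lemma kdf_step:
  assumes kdf: "kdf_secure P"
    and pki: "\<And>N. pki N \<in> set_pmf (pki_gen P N)"
    and dest: "\<And>N j. valid_contact P N (dest N j)"
    and names: "\<And>N. name N False \<noteq> name N True" "\<And>j. poly_bounded (\<lambda>N. length (name N j))"
    and G: "poly_bounded (\<lambda>N. circuit_size (G N))"
  shows "negligible_fun (\<lambda>N.
    Pr (do { k \<leftarrow> uniform_bits (key_len P N);
      return_pmf (run (G N) (fst (fold (fun_step P N (sks N)
        (node_samples P N (pki N) (dest N) (name N) k)) (ls N) (pki N @ w N, []))) = [True]) }) -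
    Pr (do { us \<leftarrow> replicate_pmf (2 * R N) (uniform_bits (seed_len P N));
      return_pmf (run (G N) (fst (seeded P N (sks N) (ls N) (pki N) (pki N @ w N) (dest N) (R N) us)) = [True]) }))"
    (is "negligible_fun (\<lambda>N. Pr (?real N) - Pr (?ideal N))")
proof -
  let ?st = "\<lambda>N. seeded P N (sks N) (ls N) (pki N) (pki N @ w N) (dest N)"
  note view = ppoly_seeded[OF pki dest]
  \<comment> \<open>Queries exist only for rounds before \<open>R N\<close>; beyond, nothing bounds
    the size of \<open>ls N ! fst i\<close>.\<close>
  define D where "D N i = {ss \<in> seed_env P R N i. fst i < R N}" for N i
  have view': "ppoly D (\<lambda>N i ss. concat ss) (\<lambda>N i ss. fst (?st N (fst i) ss))"
    using ppoly_map[OF view, of D "\<lambda>_ _ e. e" "\<lambda>_ i. i"] by (simp add: D_def)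
  have query: "ppoly D (\<lambda>N i ss. concat ss)
      (\<lambda>N i ss. req_nonce P N (fst (ls N ! fst i)) (fst (?st N (fst i) ss)) @ name N j)" for j
  proof (intro ppoly_append ppoly_req_nonce[OF wf view'] ppoly_const ppoly_fixed_length_base[OF view']
      poly_onI names)
    show "poly_on D (\<lambda>N i. \<Sum>C\<leftarrow>fst (ls N ! fst i). circuit_size C)"
      using poly_onI[OF cs]
      by (rule poly_on_mono) (auto simp: D_def intro!: circuits_of_round)
  qed
  have "\<exists>C c. (\<forall>N i. circuit_size (C N i) \<le> (N + 2) ^ c) \<and> (\<forall>N i. \<forall>ss\<in>D N i.
      run (C N i) (concat ss) = req_nonce P N (fst (ls N ! fst i)) (fst (?st N (fst i) ss)) @ name N j)" for j
    by (rule ppoly_circuits[OF query[of j]]) blast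
  then obtain C c where C: "\<And>j N i. circuit_size (C j N i) \<le> (N + 2) ^ c j"
    "\<And>j N i ss. ss \<in> D N i \<Longrightarrow>
      run (C j N i) (concat ss) = req_nonce P N (fst (ls N ! fst i)) (fst (?st N (fst i) ss)) @ name N j"
    by metis
  \<comment> \<open>The second component is the number of seeds received before this query, which
    fixes the input length of the circuit.\<close>
  define Q where "Q N r j = C j N (r, 2 * r + of_bool j)" for N r j
  define S where "S N = (N + 2) ^ c False + (N + 2) ^ c True" for N :: nat
  have Q_size: "circuit_size (Q N r j) \<le> S N" for N r j
    using C(1)[of j N "(r, 2 * r + of_bool j)"] by (cases j) (simp_all add: Q_def S_def)
  have S: "poly_bounded S"
    unfolding S_def by (intro poly_bounded_add) (auto simp: poly_bounded_iff)
  have red: "kdf_reduction P N (sks N) (ls N) (pki N) (pki N @ w N) (dest N) (name N) (Q N)" for N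
  proof
    fix r j ss assume r: "r < length (ls N)" and ss: "ss \<in> seeds P N (2 * r + of_bool j)"
    then have "ss \<in> D N (r, 2 * r + of_bool j)"
      using ls(1)[of N] by (cases j) (auto simp: D_def seed_env_def)
    from C(2)[OF this, of j] show "run (Q N r j) (concat ss) =
        req_nonce P N (fst (ls N ! r)) (fst (?st N r ss)) @ name N j"
      by (simp add: Q_def)
  qed (use wf names in auto)
  have "ppoly (seed_env P R) (\<lambda>N i ss. concat ss) (\<lambda>N i ss. run (G N) (fst (?st N (fst i) ss)))"
    by (intro ppoly_run view poly_onI G)
  then obtain F e where F: "\<And>N i. circuit_size (F N i) \<le> (N + 2) ^ e"
    "\<And>N i ss. ss \<in> seed_env P R N i \<Longrightarrow> run (F N i) (concat ss) = run (G N) (fst (?st N (fst i) ss))"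
    by (rule ppoly_circuits) blast
  define Gs where "Gs N = F N (R N, 2 * R N)" for N
  have Gs: "run (Gs N) (concat ss) = run (G N) (fst (?st N (length (ls N)) ss))"
    if "ss \<in> seeds P N (2 * length (ls N))" for N ss
    unfolding Gs_def using F(2)[of ss N "(R N, 2 * R N)"] that ls(1)[of N] by (simp add: seed_env_def)
  \<comment> \<open>No coins are needed: those of the game adversary are part of \<open>w\<close>,
    those of the signatures part of \<open>ls\<close>.\<close>
  define B where "B N = \<lparr>coins = 0, rounds = queries (Q N) 0 (R N), guess = Gs N\<rparr>" for N
  have "computationally_bounded B"
    unfolding computationally_bounded_def
  proof (rule poly_bounded_mono)
    show "poly_bounded (\<lambda>N. 2 * R N + R N * (2 * (1 + S N)) + (N + 2) ^ e)"
      by (intro poly_bounded_add poly_bounded_mult poly_bounded_const R S) (auto simp: poly_bounded_iff)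
    show "adversary_size (B N) \<le> 2 * R N + R N * (2 * (1 + S N)) + (N + 2) ^ e" for N
      using queries_size[of "Q N" "S N" 0 "R N", OF Q_size] F(1)[of N "(R N, 2 * R N)"]
      by (simp add: adversary_size_def B_def Gs_def)
  qed
  then have "negligible_fun (\<lambda>N.
       Pr (do { k \<leftarrow> uniform_bits (key_len P N); adversary_output (kdf_oracle P N) (B N) [] k })
     - Pr (adversary_output (random_function_oracle P N) (B N) [] Map.empty))"
    using kdf by (simp add: kdf_secure_def)
  moreover have "adversary_output (kdf_oracle P N) (B N) [] k = return_pmf (run (G N) (fst (fold (fun_step P N (sks N)
        (node_samples P N (pki N) (dest N) (name N) k)) (ls N) (pki N @ w N, []))) = [True])" for N k
  proof -
    interpret kdf_reduction P N "sks N" "ls N" "pki N" "pki N @ w N" "dest N" "name N" "Q N" by (rule red)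
    obtain ss' where ss': "ss' \<in> seeds P N (2 * length (ls N))"
      "interact (kdf_oracle P N) (queries (Q N) 0 (length (ls N))) (concat []) k = return_pmf (concat ss')"
      "?st N (length (ls N)) ss' = fold (fun_step P N (sks N) (node_samples P N (pki N) (dest N) (name N) k))
         (drop 0 (ls N)) (?st N 0 [])"
      using interact_kdf[of 0 "[]" k] by (auto simp: seeds_def)
    then show ?thesis
      using Gs[OF ss'(1)] ls(1)[of N]
      by (simp add: adversary_output_def B_def uniform_bits_0 bind_return_pmf seeded_0)
  qed
  moreover have "adversary_output (random_function_oracle P N) (B N) [] Map.empty = ?ideal N" for N
  proof -
    interpret kdf_reduction P N "sks N" "ls N" "pki N" "pki N @ w N" "dest N" "name N" "Q N" by (rule red)
    have "map_pmf (\<lambda>view. run (Gs N) view = [True])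
        (interact (random_function_oracle P N) (queries (Q N) 0 (length (ls N))) (concat []) Map.empty) =
      map_pmf (\<lambda>us. run (G N) (fst (?st N (length (ls N)) ([] @ us))) = [True])
        (replicate_pmf (2 * (length (ls N) - 0)) (uniform_bits (seed_len P N)))"
      by (rule interact_random[where H = "\<lambda>v. run (G N) v = [True]"])
        (simp_all add: Gs, simp_all add: seeds_def seeded_0 table_ok_def)
    then show ?thesis
      using ls(1)[of N]
      by (simp add: adversary_output_def B_def uniform_bits_0 bind_return_pmf map_pmf_def)
  qed
  ultimately show ?thesis by simp
qed

text \<open>After the KDF is replaced, seeds influence the game only through their samples, so the
  simulator followed by the final guess is one distinguisher for
  \<open>samples_dist\<close>.\<close>

lemma ideal_step:
  assumes prims: "prg_secure P" "draws_uniformly P" "surbs_pseudorandom P" "blinding_indist P"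
    and dest: "\<And>N j. valid_contact P N (dest N j)" "\<And>N j. valid_contact P N (dest' N j)"
    and G: "poly_bounded (\<lambda>N. circuit_size (G N))"
  defines "ideal \<equiv> \<lambda>dest N. do { pki \<leftarrow> pki_gen P N;
      us \<leftarrow> replicate_pmf (2 * R N) (uniform_bits (seed_len P N));
      return_pmf (run (G N) (fst (seeded P N (sks N) (ls N) pki (pki @ w N) (dest N) (R N) us)) = [True]) }"
  shows "negligible_fun (\<lambda>N. Pr (ideal dest N) - Pr (ideal dest' N))"
proof -
  have "ppoly (sim_env P R) (\<lambda>N i e. fst e @ concat (snd e))
    (\<lambda>N i e. run (G N) (fst (sim_fold P N (sks N) (ls N) (\<lambda>t. snd e ! t) [0..<fst i] (fst e @ w N, []))))"
    by (intro ppoly_run ppoly_sim_fold poly_onI G)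
  then obtain C c where C: "\<And>N i. circuit_size (C N i) \<le> (N + 2) ^ c"
    "\<And>N i e. e \<in> sim_env P R N i \<Longrightarrow> run (C N i) (fst e @ concat (snd e)) =
      run (G N) (fst (sim_fold P N (sks N) (ls N) (\<lambda>t. snd e ! t) [0..<fst i] (fst e @ w N, [])))"
    by (rule ppoly_circuits) blast
  define D where "D N = C N (R N, 2 * R N)" for N
  have "poly_bounded (\<lambda>N. circuit_size (D N))"
    unfolding D_def poly_bounded_iff using C(1) by blast
  moreover have "comp_indist (\<lambda>N. samples_dist P N (2 * R N) (\<lambda>t. dest N (odd t)))
      (\<lambda>N. samples_dist P N (2 * R N) (\<lambda>t. dest' N (odd t)))"
    by (rule samples_indist[OF wf eff prims]) (intro poly_bounded_mult poly_bounded_const R dest)+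
  ultimately have "negligible_fun (\<lambda>N.
      Pr (map_pmf (\<lambda>x. run (D N) x = [True]) (samples_dist P N (2 * R N) (\<lambda>t. dest N (odd t)))) -
      Pr (map_pmf (\<lambda>x. run (D N) x = [True]) (samples_dist P N (2 * R N) (\<lambda>t. dest' N (odd t)))))"
    unfolding Pr_map by (simp add: comp_indist_def)
  moreover have "map_pmf (\<lambda>x. run (D N) x = [True]) (samples_dist P N (2 * R N) (\<lambda>t. dest N (odd t))) = ideal dest N"
    if dest: "\<And>N j. valid_contact P N (dest N j)" for dest N
    unfolding samples_dist_def ideal_def map_bind_pmf map_return_pmf
  proof (intro bind_pmf_cong refl)
    fix pki us assume pki: "pki \<in> set_pmf (pki_gen P N)"
      and us: "us \<in> set_pmf (replicate_pmf (2 * R N) (uniform_bits (seed_len P N)))"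
    let ?z = "\<lambda>t. sample P N pki (dest N (odd t)) (us ! t)"
    let ?e = "(pki, map ?z [0..<2 * R N])"
    have "?e \<in> sim_env P R N (R N, 2 * R N)"
      using replicate_bits_nth[OF us] by (auto simp: sim_env_def pki_length[OF wf pki] intro!: length_sample[OF wf dest pki])
    from C(2)[OF this]
    have "run (D N) (pki @ concat (map ?z [0..<2 * R N])) = run (G N) (fst (sim_fold P N (sks N) (ls N)
        (\<lambda>t. map ?z [0..<2 * R N] ! t) [0..<R N] (pki @ w N, [])))"
      by (simp add: D_def)
    also have "sim_fold P N (sks N) (ls N) (\<lambda>t. map ?z [0..<2 * R N] ! t) [0..<R N] (pki @ w N, []) =
        seeded P N (sks N) (ls N) pki (pki @ w N) (dest N) (R N) us"
      unfolding seeded_def by (rule sim_fold_cong) auto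
    finally show "return_pmf (run (D N) (pki @ concat (map ?z [0..<2 * R N])) = [True]) =
        return_pmf (run (G N) (fst (seeded P N (sks N) (ls N) pki (pki @ w N) (dest N) (R N) us)) = [True])"
      by simp
  qed
  ultimately show ?thesis using dest by simp
qed


end

section \<open>Membership unobservability\<close>

definition fixed_keys_game ::
  "system \<Rightarrow> nat \<Rightarrow> (bits \<rightharpoonup> contact) \<Rightarrow> (bool \<Rightarrow> bits) \<Rightarrow> contact \<Rightarrow> adversary \<Rightarrow> (bits \<times> bits) list \<Rightarrow> bool \<Rightarrow> bool pmf"
  where
  "fixed_keys_game P N db name d A keys b =
     do { pki \<leftarrow> pki_gen P N; k \<leftarrow> uniform_bits (key_len P N);
          adversary_output (discovery_oracle P N pki k (map snd keys) (register (name b) d db) name) A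
            (pki @ concat (map fst keys)) initial_state }"

text \<open>The signing keys do not depend on directory or secret and are drawn first, so that they
  can be fixed.\<close>

lemma Exp_G4_conv:
  "Exp_G4 P N db name d A = do { keys \<leftarrow> replicate_pmf (nodes P) (sig_gen P N);
     b \<leftarrow> bernoulli_pmf (1 / 2); map_pmf (\<lambda>b'. b' = b) (fixed_keys_game P N db name d A keys b) }"
proof -
  let ?K = "replicate_pmf (nodes P) (sig_gen P N)" and ?B = "bernoulli_pmf (1 / 2)"
  let ?a = "\<lambda>pki k keys b. map_pmf (\<lambda>b'. b' = b)
     (adversary_output (discovery_oracle P N pki k (map snd keys) (register (name b) d db) name) A
                 (pki @ concat (map fst keys)) initial_state)"
  let ?U = "uniform_bits (key_len P N)"
  have "Exp_G4 P N db name d A = do { pki \<leftarrow> pki_gen P N; k \<leftarrow> ?U; keys \<leftarrow> ?K; b \<leftarrow> ?B; ?a pki k keys b }"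
    by (simp add: Exp_G4_def Let_def map_pmf_def)
  also have "\<dots> = do { keys \<leftarrow> ?K; pki \<leftarrow> pki_gen P N; k \<leftarrow> ?U; b \<leftarrow> ?B; ?a pki k keys b }"
    by (subst bind_commute_pmf[of ?U ?K], subst bind_commute_pmf[of "pki_gen P N" ?K]) (rule refl)
  also have "\<dots> = do { keys \<leftarrow> ?K; b \<leftarrow> ?B; pki \<leftarrow> pki_gen P N; k \<leftarrow> ?U; ?a pki k keys b }"
    by (subst bind_commute_pmf[of ?U ?B], subst bind_commute_pmf[of "pki_gen P N" ?B]) (rule refl)
  finally show ?thesis by (simp add: fixed_keys_game_def map_bind_pmf)
qed

text \<open>Comparing the game with a fair coin brings the advantage into the form required by
  \<open>averaging\<close>. The exact value is half the difference on the right; the factor is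
  dropped.\<close>

lemma advantage_fixed_keys:
  "\<exists>keys\<in>set_pmf (replicate_pmf (nodes P) (sig_gen P N)).
     advantage_G4 P N db name d A \<le> \<bar>Pr (fixed_keys_game P N db name d A keys True) -
       Pr (fixed_keys_game P N db name d A keys False)\<bar>"
proof -
  let ?K = "replicate_pmf (nodes P) (sig_gen P N)"
  let ?X = "\<lambda>keys. do { b \<leftarrow> bernoulli_pmf (1 / 2); map_pmf (\<lambda>b'. b' = b) (fixed_keys_game P N db name d A keys b) }"
  obtain keys where keys: "keys \<in> set_pmf ?K"
    "\<bar>Pr (bind_pmf ?K ?X) - Pr (bind_pmf ?K (\<lambda>_. bernoulli_pmf (1 / 2)))\<bar> \<le>
      \<bar>Pr (?X keys) - Pr (bernoulli_pmf (1 / 2))\<bar>"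
    using averaging[of ?K ?X "\<lambda>_. bernoulli_pmf (1 / 2)"] by blast
  let ?p = "\<lambda>b. Pr (fixed_keys_game P N db name d A keys b)"
  have T: "Pr (map_pmf (\<lambda>b'. b' = True) q) = Pr q" for q by simp
  have F: "Pr (map_pmf (\<lambda>b'. b' = False) q) = 1 - Pr q" for q
  proof -
    have "(\<lambda>b'. b' = False) -` {True} = {False}" by auto
    then show ?thesis by (simp add: pmf_map measure_pmf_single pmf_False_conv_True)
  qed
  have "Pr (?X keys) = ?p True * (1 / 2) + (1 - ?p False) * (1 / 2)"
    by (simp only: pmf_bind integral_bernoulli_pmf T F) simp
  then have "Pr (?X keys) - Pr (bernoulli_pmf (1 / 2)) = (?p True - ?p False) / 2"
    by (simp add: field_simps)
  moreover have "\<bar>u\<bar> \<le> \<bar>z\<bar>" if "u = z / 2" for u z :: real using that by simp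
  ultimately have "\<bar>Pr (?X keys) - Pr (bernoulli_pmf (1 / 2))\<bar> \<le> \<bar>?p True - ?p False\<bar>"
    by blast
  moreover have "advantage_G4 P N db name d A =
      \<bar>Pr (bind_pmf ?K ?X) - Pr (bind_pmf ?K (\<lambda>_. bernoulli_pmf (1 / 2)))\<bar>"
    by (simp add: advantage_G4_def Exp_G4_conv)
  ultimately show ?thesis using keys by force
qed

text \<open>Coins to be hard-wired come first. The directory follows, because it stays random when
  the contacts are exchanged, and the secret is innermost for the KDF step. Freshness sends the
  username that is not registered to the fake contact.\<close>

lemma fixed_keys_game_conv:
  fixes P :: system and N :: nat and d :: contact
  assumes names: "name False \<noteq> name True" and fresh: "\<And>j. name j \<notin> dom db"
  defines "dest \<equiv> \<lambda>b j. if j = b then d else fake P N"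
  shows "fixed_keys_game P N db name d A keys b =
    do { r \<leftarrow> uniform_bits (coins A);
         \<rho>s \<leftarrow> replicate_pmf (length (rounds A)) (uniform_bits (sig_rand_len P N));
         pki \<leftarrow> pki_gen P N; k \<leftarrow> uniform_bits (key_len P N);
         return_pmf (run (guess A) (fst (fold (fun_step P N (map snd keys)
           (node_samples P N pki (dest b) name k)) (zip (rounds A) \<rho>s)
           (pki @ concat (map fst keys) @ r, []))) = [True]) }"
proof -
  let ?C = "uniform_bits (coins A)" and ?U = "uniform_bits (key_len P N)"
  let ?S = "replicate_pmf (length (rounds A)) (uniform_bits (sig_rand_len P N))"
  let ?v = "\<lambda>pki k r \<rho>s. run (guess A) (fst (fold (fun_step P N (map snd keys)
           (node_samples P N pki (dest b) name k)) (zip (rounds A) \<rho>s)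
           (pki @ concat (map fst keys) @ r, []))) = [True]"
  have dest: "(case register (name b) d db (name j) of Some d \<Rightarrow> d | None \<Rightarrow> fake P N) = dest b j" for j
  proof -
    have "name j = name b \<longleftrightarrow> j = b" using names by (cases j; cases b) auto
    then show ?thesis using fresh[of j] by (auto simp: register_def dest_def domIff)
  qed
  have "fixed_keys_game P N db name d A keys b =
      do { pki \<leftarrow> pki_gen P N; k \<leftarrow> ?U; r \<leftarrow> ?C; \<rho>s \<leftarrow> ?S; return_pmf (?v pki k r \<rho>s) }"
    unfolding fixed_keys_game_def adversary_output_def
    by (subst interact_discovery[where db = "register (name b) d db" and name = name and dest = "dest b" and tab = "[]", OF dest])
      (simp_all add: initial_state_def replayed_def map_pmf_def bind_assoc_pmf bind_return_pmf)
  also have "\<dots> = do { pki \<leftarrow> pki_gen P N; r \<leftarrow> ?C; \<rho>s \<leftarrow> ?S; k \<leftarrow> ?U; return_pmf (?v pki k r \<rho>s) }"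
    by (subst bind_commute_pmf[of ?U ?C], subst bind_commute_pmf[of ?U ?S]) (rule refl)
  also have "\<dots> = do { r \<leftarrow> ?C; \<rho>s \<leftarrow> ?S; pki \<leftarrow> pki_gen P N; k \<leftarrow> ?U; return_pmf (?v pki k r \<rho>s) }"
    by (subst bind_commute_pmf[of "pki_gen P N" ?C], subst bind_commute_pmf[of "pki_gen P N" ?S]) (rule refl)
  finally show ?thesis .
qed

lemma zip_rounds_size:
  assumes "length \<rho>s = length rs"
  shows "(\<Sum>l\<leftarrow>zip rs \<rho>s. \<Sum>C\<leftarrow>fst l. circuit_size C) = (\<Sum>cs\<leftarrow>rs. \<Sum>C\<leftarrow>cs. circuit_size C)"
proof -
  have "map (\<lambda>l. \<Sum>C\<leftarrow>fst l. circuit_size C) (zip rs \<rho>s) = map (\<lambda>cs. \<Sum>C\<leftarrow>cs. circuit_size C) (map fst (zip rs \<rho>s))"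
    by simp
  then show ?thesis using assms by (simp only: map_fst_zip)
qed

lemma advantage_negligible:
  assumes wf: "well_formed P" and eff: "efficient_algorithms P" and kdf: "kdf_secure P"
    and prims: "prg_secure P" "draws_uniformly P" "surbs_pseudorandom P" "blinding_indist P"
    and names: "\<And>j. poly_bounded (\<lambda>N. length (name N j))" "\<And>N. name N False \<noteq> name N True"
    and fresh: "\<And>N j. name N j \<notin> dom (db N)"
    and d: "\<And>N. valid_contact P N (d N)"
    and A: "computationally_bounded A"
  shows "negligible_fun (\<lambda>N. advantage_G4 P N (db N) (name N) (d N) (A N))"
proof -
  let ?g = "\<lambda>N. fixed_keys_game P N (db N) (name N) (d N) (A N)"
  define dest where "dest b N j = (if j = b then d N else fake P N)" for b N and j :: bool
  have dest: "valid_contact P N (dest b N j)" for b N j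
    using d wf by (simp add: dest_def well_formed_def)
  define R where "R N = length (rounds (A N))" for N
  have A': "poly_bounded (\<lambda>N. adversary_size (A N))" using A by (simp add: computationally_bounded_def)
  have R: "poly_bounded R"
    unfolding R_def by (rule poly_bounded_mono[OF A']) (rule adversary_size_bounds)
  have G: "poly_bounded (\<lambda>N. circuit_size (guess (A N)))"
    by (rule poly_bounded_mono[OF A']) (rule adversary_size_bounds)
  have "\<forall>N. \<exists>keys. keys \<in> set_pmf (replicate_pmf (nodes P) (sig_gen P N)) \<and>
      advantage_G4 P N (db N) (name N) (d N) (A N) \<le>
      \<bar>Pr (?g N keys True) - Pr (?g N keys False)\<bar>"
    by (intro allI advantage_fixed_keys[unfolded Bex_def])
  from choice[OF this] obtain keys where keys: "\<And>N. keys N \<in> set_pmf (replicate_pmf (nodes P) (sig_gen P N))"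
    "\<And>N. advantage_G4 P N (db N) (name N) (d N) (A N) \<le>
      \<bar>Pr (?g N (keys N) True) - Pr (?g N (keys N) False)\<bar>"
    by blast
  define sks where "sks N = map snd (keys N)" for N
  define vks where "vks N = concat (map fst (keys N))" for N
  have keys_len: "length (keys N) = nodes P" "\<forall>x\<in>set (keys N). length (fst x) = vk_len P N \<and> length (snd x) = sk_len P N" for N
  proof -
    show "length (keys N) = nodes P" using keys(1)[of N] by (simp add: set_replicate_pmf)
    have "\<forall>(vk, sk) \<in> set_pmf (sig_gen P N). length vk = vk_len P N \<and> length sk = sk_len P N"
      using wf unfolding well_formed_def by blast
    then show "\<forall>x\<in>set (keys N). length (fst x) = vk_len P N \<and> length (snd x) = sk_len P N"
      using keys(1)[of N] unfolding set_replicate_pmf by fastforce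
  qed
  have sks: "\<forall>a<nodes P. length (sks N ! a) = sk_len P N" for N
    using keys_len[of N] by (simp add: sks_def)
  have vks: "length (vks N) = nodes P * vk_len P N" for N
    using keys_len[of N] length_concat_const[of "map fst (keys N)"] by (simp add: vks_def)
  let ?Q = "\<lambda>N. pair_pmf (uniform_bits (coins (A N))) (replicate_pmf (R N) (uniform_bits (sig_rand_len P N)))"
  let ?U = "\<lambda>N. uniform_bits (key_len P N)" and ?S = "\<lambda>N. replicate_pmf (2 * R N) (uniform_bits (seed_len P N))"
  let ?e = "\<lambda>x N. bind_pmf (?Q N) (\<lambda>c. bind_pmf (pki_gen P N) (x N c))"
  define ls where "ls N c = zip (rounds (A N)) (snd c)" for N and c :: "bits \<times> bits list"
  define w where "w N c = vks N @ fst c" for N and c :: "bits \<times> bits list"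
  define real where "real b N c pki = do { k \<leftarrow> ?U N;
      return_pmf (run (guess (A N)) (fst (fold (fun_step P N (sks N)
        (node_samples P N pki (dest b N) (name N) k)) (ls N c) (pki @ w N c, []))) = [True]) }" for b N c pki
  define ideal where "ideal b N c pki = do { us \<leftarrow> ?S N;
      return_pmf (run (guess (A N)) (fst (seeded P N (sks N) (ls N c) pki (pki @ w N c) (dest b N) (R N) us)) = [True]) }"
    for b N c pki
  have game: "?g N (keys N) b = ?e (real b) N" for N b
    unfolding fixed_keys_game_conv[OF names(2) fresh]
    by (simp add: pair_pmf_def bind_assoc_pmf bind_return_pmf real_def[abs_def] ls_def w_def sks_def vks_def
        dest_def[abs_def] R_def)
  have sim: "simulation P sks (\<lambda>N. ls N (c N)) R (\<lambda>N. w N (c N))"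
    if c: "\<And>N. c N \<in> set_pmf (?Q N)" for c
  proof
    have c': "length (fst (c N)) = coins (A N)" "length (snd (c N)) = R N"
      "\<forall>x\<in>set (snd (c N)). length x = sig_rand_len P N" for N
      using c[of N] by (cases "c N"; auto simp: set_replicate_pmf)+
    show "length (ls N (c N)) = R N" for N using c'(2)[of N] by (simp add: ls_def R_def)
    show "\<forall>l\<in>set (ls N (c N)). length (snd l) = sig_rand_len P N" for N
      using c'(3)[of N] by (auto simp: ls_def dest: set_zip_rightD)
    show "poly_bounded (\<lambda>N. \<Sum>l\<leftarrow>ls N (c N). \<Sum>C\<leftarrow>fst l. circuit_size C)"
    proof (rule poly_bounded_mono[OF A'])
      fix N
      have "(\<Sum>l\<leftarrow>ls N (c N). \<Sum>C\<leftarrow>fst l. circuit_size C) = (\<Sum>cs\<leftarrow>rounds (A N). \<Sum>C\<leftarrow>cs. circuit_size C)"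
        unfolding ls_def by (rule zip_rounds_size) (simp add: c' R_def)
      then show "(\<Sum>l\<leftarrow>ls N (c N). \<Sum>C\<leftarrow>fst l. circuit_size C) \<le> adversary_size (A N)"
        using adversary_size_bounds(4)[of "A N"] by simp
    qed
    have "poly_bounded (\<lambda>N. nodes P * vk_len P N + coins (A N))"
      by (intro poly_bounded_add poly_bounded_mult poly_bounded_const well_formed_poly wf
          poly_bounded_mono[OF A'] adversary_size_bounds)
    then show "poly_bounded (\<lambda>N. length (w N (c N)))" by (simp add: w_def vks c')
  qed (use wf eff sks R in auto)
  have kdf_gap: "negligible_fun (\<lambda>N. Pr (?e (real b) N) - Pr (?e (ideal b) N))" for b
  \<comment> \<open>Applied twice: to the coins and to the directory.\<close>
  proof (intro negligible_averaging)
    fix c pki assume c: "\<And>N. c N \<in> set_pmf (?Q N)" and pki: "\<And>N. pki N \<in> set_pmf (pki_gen P N)"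
    show "negligible_fun (\<lambda>N. Pr (real b N (c N) (pki N)) - Pr (ideal b N (c N) (pki N)))"
      unfolding real_def ideal_def
      by (rule simulation.kdf_step[OF sim[OF c] kdf pki dest names(2,1) G])
  qed
  have swap: "negligible_fun (\<lambda>N. Pr (?e (ideal True) N) - Pr (?e (ideal False) N))"
  \<comment> \<open>Applied only to the coins; the directory belongs to the challenge strings of
    \<open>ideal_step\<close>.\<close>
  proof (rule negligible_averaging)
    fix c assume c: "\<And>N. c N \<in> set_pmf (?Q N)"
    show "negligible_fun (\<lambda>N. Pr (bind_pmf (pki_gen P N) (ideal True N (c N))) -
        Pr (bind_pmf (pki_gen P N) (ideal False N (c N))))"
      unfolding ideal_def
      by (rule simulation.ideal_step[OF sim[OF c] prims dest dest G])
  qed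
  have "negligible_fun (\<lambda>N. Pr (?g N (keys N) True) - Pr (?g N (keys N) False))"
    unfolding game
    by (rule negligible_trans[OF kdf_gap negligible_trans[OF swap negligible_sym[OF kdf_gap]]])
  then show ?thesis
  proof (rule negligible_mono)
    fix N
    have "0 \<le> advantage_G4 P N (db N) (name N) (d N) (A N)" by (simp add: advantage_G4_def)
    then show "\<bar>advantage_G4 P N (db N) (name N) (d N) (A N)\<bar> \<le>
      \<bar>Pr (?g N (keys N) True) - Pr (?g N (keys N) False)\<bar>"
      using keys(2)[of N] by simp
  qed
qed

text \<open>With equal usernames the hidden bit has no influence on the database, so every guess is
  a coin toss.\<close>

lemma advantage_same_names:
  assumes "name False = name True"
  shows "advantage_G4 P N db name d A = 0"
proof -
  have "fixed_keys_game P N db name d A keys True = fixed_keys_game P N db name d A keys False" for keys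
    using assms by (simp add: fixed_keys_game_def)
  then show ?thesis
    using advantage_fixed_keys[of P N db name d A] by (auto simp: advantage_G4_def)
qed

theorem mainTheorem3:
  fixes P :: system
    and db :: "nat \<Rightarrow> bits \<rightharpoonup> contact"
    and name :: "nat \<Rightarrow> bool \<Rightarrow> bits"
    and d :: "nat \<Rightarrow> contact"
    and A :: "nat \<Rightarrow> adversary"
  assumes "well_formed P" and "efficient_algorithms P"
    and "kdf_secure P" and "prg_secure P" and "draws_uniformly P"
    and "surbs_pseudorandom P" and "blinding_indist P"
    and "\<And>j. poly_bounded (\<lambda>\<eta>. length (name \<eta> j))"
    and "\<And>\<eta> j. name \<eta> j \<notin> dom (db \<eta>)"
    and "\<And>\<eta>. valid_contact P \<eta> (d \<eta>)"
    and "computationally_bounded A"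
  shows "negligible_fun (\<lambda>\<eta>. advantage_G4 P \<eta> (db \<eta>) (name \<eta>) (d \<eta>) (A \<eta>))"
proof -
  define same where "same \<eta> \<longleftrightarrow> name \<eta> False = name \<eta> True" for \<eta>
  \<comment> \<open>The usernames may coincide at some parameters only. There the advantage
    vanishes, so they are replaced by two distinct one-bit names, with an empty database to keep
    them unregistered.\<close>
  define name' where "name' \<eta> j = (if same \<eta> then [j] else name \<eta> j)" for \<eta> j
  define db' where "db' \<eta> = (if same \<eta> then Map.empty else db \<eta>)" for \<eta>
  have "negligible_fun (\<lambda>\<eta>. advantage_G4 P \<eta> (db' \<eta>) (name' \<eta>) (d \<eta>) (A \<eta>))"
  proof (rule advantage_negligible[OF assms(1-7)])
    show "poly_bounded (\<lambda>\<eta>. length (name' \<eta> j))" for j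
      by (rule poly_bounded_mono[OF poly_bounded_add[OF poly_bounded_const[of 1] assms(8)[of j]]])
        (simp add: name'_def)
    show "name' \<eta> False \<noteq> name' \<eta> True" for \<eta> by (simp add: name'_def same_def)
    show "name' \<eta> j \<notin> dom (db' \<eta>)" for \<eta> j using assms(9) by (simp add: name'_def db'_def)
  qed (use assms in auto)
  then show ?thesis
  proof (rule negligible_mono)
    fix \<eta>
    show "\<bar>advantage_G4 P \<eta> (db \<eta>) (name \<eta>) (d \<eta>) (A \<eta>)\<bar> \<le> \<bar>advantage_G4 P \<eta> (db' \<eta>) (name' \<eta>) (d \<eta>) (A \<eta>)\<bar>"
    proof (cases "same \<eta>")
      case True
      then show ?thesis by (simp add: same_def advantage_same_names)
    next
      case False
      then show ?thesis by (simp add: name'_def[abs_def] db'_def)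
    qed
  qed
qed

end
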